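(* Let $L\in\{1,\infty\}$, $0<p,r,q\le\infty$, $a,b\in SV(0,L)$ be such that the space $L^{\mathcal L}_{p,r,b,q,a}=L^{\mathcal L}_{p,r,b,q,a}(0,L)$ is non-trivial (i.e. $\neq\{0\}$). Let $0<W<\infty$, $0<U<\infty$, $0<V\le\infty$. Then: (i) $\|f\|_{L^{\mathcal L}_{p,r,b,q,a}}\sim\|H^{(U,W)}f\|_{B^{\mathcal L}_{p,r,b,q,a}}$ for all $f\in\mathfrak M(0,L)$ if and only if $p>U$. (ii) $\|f\|_{L^{\mathcal L}_{p,r,b,q,a}}\sim\|H_{(V,W)}f\|_{B^{\mathcal L}_{p,r,b,q,a}}$ for all $f\in\mathfrak M(0,L)$ if and only if $p<V$.
   Context: Conventions: $1/\infty=0$. $\mathfrak M(0,L)$ is the set of complex-valued Lebesgue measurable a.e. finite functions on $(0,L)$ (identified if equal a.e.). For $0<q\le\infty$, $\|\cdot\|_{q,(a,b)}$ is the usual Lebesgue (quasi-)norm on the interval $(a,b)$ (essential supremum if $q=\infty$). $f^*(t)=\inf\{\lambda>0:\ |\{x\in(0,L):|f(x)|>\lambda\}|\le t\}$ is the non-increasing rearrangement. $F\sim G$ means $c\,G\le F\le C\,G$ with constants $0<c\le C<\infty$ independent of $f$ (both sides may be $\infty$). $SV=SV(0,L)$: positive measurable $b$ on $(0,L)$ such that for every $\varepsilon>0$ the function $t^{\varepsilon}b(t)$ is equivalent ($\sim$, pointwise with constants) to a non-decreasing function and $t^{-\varepsilon}b(t)$ is equivalent to a non-increasing function. For measurable $g$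 on $(0,L)$ (possibly with value $\infty$), $$\|g\|_{B^{\mathcal L}_{p,r,b,q,a}}=\Big\|t^{-\frac1r}b(t)\big\|u^{\frac1p-\frac1q}a(u)|g(u)|\big\|_{q,(0,t)}\Big\|_{r,(0,L)},$$ and $L^{\mathcal L}_{p,r,b,q,a}$ is the set of $f\in\mathfrak M(0,L)$ with $\|f\|_{L^{\mathcal L}_{p,r,b,q,a}}:=\|f^*\|_{B^{\mathcal L}_{p,r,b,q,a}}<\infty$. Averaging operators, for $f\in\mathfrak M(0,L)$, $t\in(0,L)$: $$(H^{(U,W)}f)(t)=t^{-1/U}\big\|v^{\frac1U-\frac1W}f^*(v)\big\|_{W,(0,t)},\qquad (H_{(V,W)}f)(t)=t^{-1/V}\big\|v^{\frac1V-\frac1W}f^*(v)\big\|_{W,(t,L)}.$$ *)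

theory Defs
  imports "HOL-Analysis.Analysis" "HOL-Probability.Essential_Supremum"
begin

text \<open>
  The endpoint \<open>L\<close> and all integrability exponents are extended reals, so that \<open>\<infinity>\<close> is allowed;
  the interval \<open>(0,L)\<close> is \<open>einterval 0 L\<close>. Rearrangements, averages and norms are
  \<open>ennreal\<close>-valued, since they may be infinite.
\<close>

text \<open>Note that \<open>1/\<infinity> = 0\<close> holds in \<open>ereal\<close>.\<close>

definition rcp :: "ereal \<Rightarrow> real" where
  "rcp p = real_of_ereal (1 / p)"

text \<open>The library has no real power on \<open>ennreal\<close>; the following is meant for exponents \<open>s > 0\<close>.\<close>

definition epow :: "ennreal \<Rightarrow> real \<Rightarrow> ennreal" where
  "epow x s = (if x = \<infinity> then \<infinity> else ennreal (enn2real x powr s))"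

definition Lnorm :: "ereal \<Rightarrow> real set \<Rightarrow> (real \<Rightarrow> ennreal) \<Rightarrow> ennreal" where
  "Lnorm q A g =
     (if q = \<infinity> then esssup (lebesgue_on A) g
      else epow (\<integral>\<^sup>+ x. epow (g x) (real_of_ereal q) \<partial>lebesgue_on A) (rcp q))"

definition equiv_on :: "'a set \<Rightarrow> ('a \<Rightarrow> ennreal) \<Rightarrow> ('a \<Rightarrow> ennreal) \<Rightarrow> bool" where
  "equiv_on S F G \<longleftrightarrow>
     (\<exists>c C :: real. 0 < c \<and> c \<le> C \<and>
        (\<forall>x\<in>S. ennreal c * G x \<le> F x \<and> F x \<le> ennreal C * G x))"

text \<open>
  Complex values are finite everywhere; as elements are only considered up to equality almost
  everywhere, every a.e. finite function has such a representative. The identification itself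
  is made explicit where it matters, namely in \<open>null_funs\<close> below.
\<close>

definition Mfun :: "ereal \<Rightarrow> (real \<Rightarrow> complex) set" where
  "Mfun L = borel_measurable (lebesgue_on (einterval 0 L))"

definition null_funs :: "ereal \<Rightarrow> (real \<Rightarrow> complex) set" where
  "null_funs L = {f \<in> Mfun L. AE x in lebesgue_on (einterval 0 L). f x = 0}"

text \<open>The infimum is taken in \<open>ennreal\<close>, so it is \<open>\<infinity>\<close> if no \<open>y\<close> qualifies.\<close>

definition rearr :: "ereal \<Rightarrow> (real \<Rightarrow> complex) \<Rightarrow> real \<Rightarrow> ennreal" where
  "rearr L f t =
     Inf (ennreal ` {y. 0 < y \<and>
       emeasure lebesgue {x \<in> einterval 0 L. cmod (f x) > y} \<le> ennreal t})"

text \<open>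
  In the equivalences the monotone function is \<open>ennreal\<close>-valued, but the two-sided estimate forces
  it to be positive and finite on \<open>(0,L)\<close>.
\<close>

definition SV :: "ereal \<Rightarrow> (real \<Rightarrow> real) set" where
  "SV L = {b \<in> borel_measurable (lebesgue_on (einterval 0 L)).
     (\<forall>t\<in>einterval 0 L. 0 < b t) \<and>
     (\<forall>\<epsilon>>0.
        (\<exists>h :: real \<Rightarrow> ennreal. mono_on (einterval 0 L) h \<and>
            equiv_on (einterval 0 L) (\<lambda>t. ennreal (t powr \<epsilon> * b t)) h) \<and>
        (\<exists>h :: real \<Rightarrow> ennreal. antimono_on (einterval 0 L) h \<and>
            equiv_on (einterval 0 L) (\<lambda>t. ennreal (t powr (- \<epsilon>) * b t)) h))}"

text \<open>All functions \<open>g\<close> to which this is applied are nonnegative, hence \<open>|g| = g\<close>.\<close>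

definition B_norm :: "ereal \<Rightarrow> ereal \<Rightarrow> ereal \<Rightarrow> (real \<Rightarrow> real) \<Rightarrow> ereal \<Rightarrow> (real \<Rightarrow> real)
    \<Rightarrow> (real \<Rightarrow> ennreal) \<Rightarrow> ennreal" where
  "B_norm L p r b q a g =
     Lnorm r (einterval 0 L) (\<lambda>t. ennreal (t powr (- rcp r) * b t) *
       Lnorm q {0<..<t} (\<lambda>u. ennreal (u powr (rcp p - rcp q) * a u) * g u))"

definition LL_norm :: "ereal \<Rightarrow> ereal \<Rightarrow> ereal \<Rightarrow> (real \<Rightarrow> real) \<Rightarrow> ereal \<Rightarrow> (real \<Rightarrow> real)
    \<Rightarrow> (real \<Rightarrow> complex) \<Rightarrow> ennreal" where
  "LL_norm L p r b q a f = B_norm L p r b q a (rearr L f)"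

definition LL_space :: "ereal \<Rightarrow> ereal \<Rightarrow> ereal \<Rightarrow> (real \<Rightarrow> real) \<Rightarrow> ereal \<Rightarrow> (real \<Rightarrow> real)
    \<Rightarrow> (real \<Rightarrow> complex) set" where
  "LL_space L p r b q a = {f \<in> Mfun L. LL_norm L p r b q a f < \<infinity>}"

definition H_upper :: "ereal \<Rightarrow> ereal \<Rightarrow> ereal \<Rightarrow> (real \<Rightarrow> complex) \<Rightarrow> real \<Rightarrow> ennreal" where
  "H_upper L U W f t = ennreal (t powr (- rcp U)) *
     Lnorm W {0<..<t} (\<lambda>v. ennreal (v powr (rcp U - rcp W)) * rearr L f v)"

definition H_lower :: "ereal \<Rightarrow> ereal \<Rightarrow> ereal \<Rightarrow> (real \<Rightarrow> complex) \<Rightarrow> real \<Rightarrow> ennreal" where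
  "H_lower L V W f t = ennreal (t powr (- rcp V)) *
     Lnorm W (einterval (ereal t) L) (\<lambda>v. ennreal (v powr (rcp V - rcp W)) * rearr L f v)"

end

theory Submission
  imports Defs
begin

text \<open>
  Write all norms with respect to \<open>du/u\<close>: the inner weight becomes \<open>w(u) = u powr (1/p) * a(u)\<close>.
  For non-increasing \<open>g = f\<^sup>*\<close> and a slightly smaller power \<open>\<alpha> < 1/U\<close>, the average \<open>H\<^sup>(\<^sup>U\<^sup>,\<^sup>W\<^sup>) f (u)\<close> is at most
  a constant times the supremum of \<open>(v/u) powr \<alpha> * g(v)\<close> over \<open>v < u\<close>, whatever \<open>W\<close> is. A value \<open>g(v)\<close> is controlled by the values
  of \<open>g\<close> on \<open>(v/2, v)\<close>, so \<open>w\<close> times this supremum is dominated by the convolution of \<open>w g\<close> with a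
  kernel decaying like a power, provided that \<open>1/p < \<alpha>\<close>. This gives the inequality on each
  \<open>(0, t)\<close> for every \<open>q\<close>, and hence for the full norm. The dual operator is treated in the same way with
  suprema over \<open>v > u\<close> and \<open>1/V < \<alpha> < 1/p\<close>; the contribution of \<open>v \<ge> t\<close> to the norm on \<open>(0, t)\<close> is
  a supremum operator in \<open>t\<close>, to which the same inequality applies in the outer norm, with weight \<open>w b\<close>.

  For the converse, if \<open>p \<le> U\<close> then \<open>H\<^sup>(\<^sup>U\<^sup>,\<^sup>W\<^sup>)\<close> multiplies \<open>x powr (- (1/p - \<eta>))\<close>, cut off at some \<open>d\<close>, on \<open>(0, d)\<close>
  by at least \<open>(\<eta> W) powr (- 1/W)\<close>, which is unbounded as \<open>\<eta>\<close> tends to \<open>0\<close>. Non-triviality of the space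
  provides a \<open>d\<close> for which the norm of this function is finite. If \<open>p \<ge> V\<close>, the same is done with
  \<open>max x \<delta> powr (- (1/p + \<eta>))\<close> and sufficiently small \<open>\<delta>\<close>.
\<close>

section \<open>Lebesgue quasi-norms\<close>

text \<open>This is why averages are first replaced by suprema: a single value of a non-increasing
  function is bounded by its average over (v/2, v) taken in the exponent of the norm itself, and
  after raising to that power only Tonelli's theorem is needed. Two gaps between exponents are
  spent: the one between 1/U (or 1/V) and \<alpha> makes a power integrable in the exponent
  \<open>W\<close>, the one between \<alpha> and 1/p is halved, one half absorbing the slowly
  varying weight and the other remaining as decay of the kernel. For the lower operator the average
  at u does not control \<open>rearr L f u\<close> near the end point when \<open>L = 1\<close>,
  since (u, L) shrinks. The average at u/2 does; being non-increasing itself, it can be fed into the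
  supremum inequality over v < u, which undoes the dilation. For \<open>V \<le> p\<close> the test
  power is steeper than 1/p, so it has to be truncated near 0 to have a finite norm, and its gain is
  available only where (u, N u) stays below the cut-off.\<close>

lemma rcp_ereal: "0 < Q \<Longrightarrow> rcp (ereal Q) = 1 / Q"
  by (simp add: rcp_def one_ereal_def)

lemma rcp_infinity [simp]: "rcp \<infinity> = 0"
  by (simp add: rcp_def)

lemma rcp_nonneg: "0 < p \<Longrightarrow> 0 \<le> rcp p"
  by (cases p) (auto simp: rcp_ereal)

lemma rcp_strict_antimono: "0 < p \<Longrightarrow> p < q \<Longrightarrow> rcp q < rcp p"
  by (cases p; cases q) (auto simp: rcp_ereal field_simps)

lemma rcp_antimono: "0 < p \<Longrightarrow> p \<le> q \<Longrightarrow> rcp q \<le> rcp p"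
  using rcp_strict_antimono[of p q] by (cases "p = q") (auto simp: less_le)

lemma epow_zero [simp]: "epow 0 s = 0"
  by (simp add: epow_def)

lemma epow_top [simp]: "epow \<infinity> s = \<infinity>" "epow top s = top"
  by (simp_all add: epow_def)

lemma epow_ennreal: "0 \<le> x \<Longrightarrow> epow (ennreal x) s = ennreal (x powr s)"
  by (simp add: epow_def)

lemma epow_mono: assumes "x \<le> y" "0 \<le> s" shows "epow x s \<le> epow y s"
proof (cases y)
  case (real b)
  then obtain a where "x = ennreal a" "0 \<le> a" "a \<le> b"
    using assms(1) by (cases x) (auto simp: top_unique)
  then show ?thesis using real assms by (simp add: epow_ennreal powr_mono2 ennreal_leI)
qed simp

lemma epow_mult: "0 < s \<Longrightarrow> epow (x * y) s = epow x s * epow y s"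
proof (cases x; cases y)
  assume "0 < s"
  fix a b assume *: "x = ennreal a" "0 \<le> a" "y = ennreal b" "0 \<le> b"
  then have "epow (x * y) s = epow (ennreal (a * b)) s" by (simp add: ennreal_mult)
  also have "\<dots> = epow x s * epow y s"
    using * by (subst epow_ennreal) (simp_all add: epow_ennreal powr_mult ennreal_mult)
  finally show ?thesis .
next
  assume "0 < s" fix a assume "x = ennreal a" "0 \<le> a" "y = top"
  then show ?thesis using \<open>0 < s\<close>
    by (cases "a = 0") (auto simp: epow_ennreal ennreal_mult_top)
next
  assume "0 < s" fix a assume "y = ennreal a" "0 \<le> a" "x = top"
  then show ?thesis using \<open>0 < s\<close>
    by (cases "a = 0") (auto simp: epow_ennreal ennreal_top_mult)
qed (simp add: ennreal_top_mult)

lemma epow_epow: "0 < s \<Longrightarrow> epow (epow x s) t = epow x (s * t)"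
  by (cases x) (auto simp: epow_ennreal powr_powr)

lemma epow_one [simp]: "epow x 1 = x"
  by (cases x) (auto simp: epow_ennreal)

lemma epow_eq_0_iff: "epow x s = 0 \<longleftrightarrow> x = 0"
  by (cases x) (auto simp: epow_ennreal)

text \<open>Bounding the sum by twice the maximum gives one constant for all \<open>s > 0\<close>,
  so convex and concave powers need not be distinguished.\<close>

lemma epow_add_le:
  assumes "0 < s" shows "epow (x + y) s \<le> ennreal (2 powr s) * (epow x s + epow y s)"
proof -
  have "x + y \<le> ennreal 2 * max x y"
    by (simp add: mult_2 add_mono)
  then have "epow (x + y) s \<le> epow (ennreal 2 * max x y) s"
    using assms by (intro epow_mono) auto
  also have "\<dots> = ennreal (2 powr s) * epow (max x y) s"
    using assms by (subst epow_mult) (auto simp: epow_ennreal simp del: ennreal_numeral)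
  also have "epow (max x y) s \<le> epow x s + epow y s"
    by (auto simp: max_def)
  finally show ?thesis by (simp add: mult_left_mono)
qed

lemma epow_measurable [measurable (raw)]:
  assumes [measurable]: "f \<in> borel_measurable M"
  shows "(\<lambda>x. epow (f x) s) \<in> borel_measurable M"
  unfolding epow_def infinity_ennreal_def by measurable

lemma ereal_pos_cases:
  assumes "0 < (q::ereal)"
  obtains "q = \<infinity>" | Q where "q = ereal Q" "0 < Q"
  using assms by (cases q) auto

section \<open>Rules for the quasi-norms with an arbitrary positive exponent\<close>

lemma Lnorm_infinity: "Lnorm \<infinity> A F = esssup (lebesgue_on A) F"
  by (simp add: Lnorm_def)

lemma Lnorm_ereal:
  "0 < Q \<Longrightarrow> Lnorm (ereal Q) A F = epow (\<integral>\<^sup>+ x. epow (F x) Q \<partial>lebesgue_on A) (1 / Q)"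
  by (simp add: Lnorm_def rcp_ereal)

lemma epow_Lnorm:
  "0 < Q \<Longrightarrow> epow (Lnorm (ereal Q) A F) Q = (\<integral>\<^sup>+ x. epow (F x) Q \<partial>lebesgue_on A)"
  by (simp add: Lnorm_ereal epow_epow)

text \<open>For \<open>q = \<infinity>\<close> the smaller function has to be measurable, because
  \<open>esssup\<close> of a non-measurable function is top.\<close>

lemma Lnorm_mono:
  assumes "0 < q" "F \<in> borel_measurable (lebesgue_on A)" "\<And>x. x \<in> A \<Longrightarrow> F x \<le> G x"
  shows "Lnorm q A F \<le> Lnorm q A G"
  using assms(1)
proof (cases rule: ereal_pos_cases)
  case 1
  then show ?thesis using assms by (auto simp: Lnorm_infinity intro!: esssup_AE_mono)
next
  case (2 Q)
  then show ?thesis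
    using assms by (auto simp: Lnorm_ereal intro!: epow_mono nn_integral_mono)
qed

text \<open>\<open>F\<close> and \<open>G\<close> are measurable simultaneously, and if they are
  not, both essential suprema are top.\<close>

lemma Lnorm_cong:
  assumes "\<And>x. x \<in> A \<Longrightarrow> F x = G x"
  shows "Lnorm q A F = Lnorm q A G"
proof -
  have "(F \<in> borel_measurable (lebesgue_on A)) = (G \<in> borel_measurable (lebesgue_on A))"
    using assms by (intro measurable_cong) auto
  moreover have "AE x in lebesgue_on A. F x = G x"
    using assms by auto
  ultimately have "esssup (lebesgue_on A) F = esssup (lebesgue_on A) G"
    by (metis esssup_AE_cong esssup_non_measurable)
  moreover have "(\<integral>\<^sup>+ x. epow (F x) (real_of_ereal q) \<partial>lebesgue_on A)
      = (\<integral>\<^sup>+ x. epow (G x) (real_of_ereal q) \<partial>lebesgue_on A)"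
    using assms by (intro nn_integral_cong) auto
  ultimately show ?thesis by (simp add: Lnorm_def)
qed

lemma measurable_lebesgue_on_subset:
  assumes "F \<in> borel_measurable (lebesgue_on B)" "A \<subseteq> B"
  shows "F \<in> borel_measurable (lebesgue_on A)"
  using assms by (rule measurable_restrict_mono)

lemma Lnorm_subset:
  assumes "0 < q" "F \<in> borel_measurable (lebesgue_on B)" "A \<subseteq> B" "A \<in> sets borel" "B \<in> sets borel"
  shows "Lnorm q A F \<le> Lnorm q B F"
  using assms(1)
proof (cases rule: ereal_pos_cases)
  case 1
  have sA: "A \<inter> space lebesgue \<in> sets lebesgue" and sB: "B \<inter> space lebesgue \<in> sets lebesgue"
    using assms(4,5) by auto
  have "AE x in lebesgue_on B. F x \<le> esssup (lebesgue_on B) F"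
    by (rule esssup_AE)
  then have "AE x in lebesgue. x \<in> B \<longrightarrow> F x \<le> esssup (lebesgue_on B) F"
    by (simp only: AE_restrict_space_iff[OF sB])
  then have "AE x in lebesgue. x \<in> A \<longrightarrow> F x \<le> esssup (lebesgue_on B) F"
    by (rule eventually_mono) (use assms(3) in auto)
  then have "AE x in lebesgue_on A. F x \<le> esssup (lebesgue_on B) F"
    by (simp only: AE_restrict_space_iff[OF sA])
  then have "esssup (lebesgue_on A) F \<le> esssup (lebesgue_on B) F"
    by (rule esssup_I[OF measurable_lebesgue_on_subset[OF assms(2,3)]])
  then show ?thesis by (simp only: 1 Lnorm_infinity)
next
  case (2 Q)
  have "(\<integral>\<^sup>+ x. epow (F x) Q \<partial>lebesgue_on A) \<le> (\<integral>\<^sup>+ x. epow (F x) Q \<partial>lebesgue_on B)"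
    using assms by (simp add: nn_integral_restrict_space)
      (auto intro!: nn_integral_mono split: split_indicator)
  then show ?thesis
    using 2 by (auto simp: Lnorm_ereal intro!: epow_mono)
qed

lemma Lnorm_zero: "0 < q \<Longrightarrow> Lnorm q A (\<lambda>x. 0) = 0"
  using esssup_I[of "\<lambda>x. 0" "lebesgue_on A" "0::ennreal"]
  by (erule_tac ereal_pos_cases) (simp_all add: Lnorm_ereal Lnorm_infinity)

lemma Lnorm_eq_0_imp_AE:
  assumes "0 < q" "F \<in> borel_measurable (lebesgue_on A)" "Lnorm q A F = 0"
  shows "AE x in lebesgue_on A. F x = 0"
  using assms(1)
proof (cases rule: ereal_pos_cases)
  case 1
  then show ?thesis using assms esssup_AE[of F "lebesgue_on A"] by (auto simp: Lnorm_infinity)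
next
  case (2 Q)
  then show ?thesis using assms
    by (auto simp: Lnorm_ereal epow_eq_0_iff nn_integral_0_iff_AE)
qed

lemma Lnorm_pos:
  assumes "0 < q" "F \<in> borel_measurable (lebesgue_on {x<..<y})" "\<And>u. u \<in> {x<..<y} \<Longrightarrow> 0 < F u" "x < y"
  shows "0 < Lnorm q {x<..<y} F"
proof (rule ccontr)
  assume "\<not> ?thesis"
  then have "AE u in lebesgue_on {x<..<y}. F u = 0"
    using assms by (intro Lnorm_eq_0_imp_AE) auto
  then have "AE u in lebesgue_on {x<..<y}. False"
    by (rule lebesgue_on_mono) (use assms(3) in force)
  then have "emeasure (lebesgue_on {x<..<y}) {x<..<y} = 0"
    using AE_iff_measurable[of "{x<..<y}" "lebesgue_on {x<..<y}" "\<lambda>_. False"]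
    by (simp add: greaterThanLessThan_def greaterThan_def lessThan_def Int_def)
  then show False using assms(4) by (simp add: emeasure_restrict_space)
qed

lemma Lnorm_cmult_le:
  assumes "0 < q" and [measurable]: "F \<in> borel_measurable (lebesgue_on A)"
  shows "Lnorm q A (\<lambda>x. c * F x) \<le> c * Lnorm q A F"
  using assms(1)
proof (cases rule: ereal_pos_cases)
  case 1
  have "AE x in lebesgue_on A. c * F x \<le> c * esssup (lebesgue_on A) F"
    using esssup_AE[of F "lebesgue_on A"] by eventually_elim (auto intro: mult_left_mono)
  then show ?thesis using 1 by (auto simp: Lnorm_infinity)
next
  case (2 Q)
  then show ?thesis
    by (simp add: Lnorm_ereal epow_mult nn_integral_cmult epow_epow)
qed

text \<open>The factor is an arbitrary extended number, because it will contain suprema that may be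
  infinite. For the essential supremum the reverse inequality is division by \<open>c\<close>; if
  \<open>c = top\<close>, a finite norm forces \<open>F\<close> to vanish almost everywhere.\<close>

lemma Lnorm_cmult:
  assumes "0 < q" and [measurable]: "F \<in> borel_measurable (lebesgue_on A)"
  shows "Lnorm q A (\<lambda>x. c * F x) = c * Lnorm q A F"
  using assms(1)
proof (cases rule: ereal_pos_cases)
  case 1
  show ?thesis
  proof (rule antisym[OF Lnorm_cmult_le[OF assms]])
    have *: "AE x in lebesgue_on A. c * F x \<le> Lnorm q A (\<lambda>x. c * F x)"
      using 1 esssup_AE[of "\<lambda>x. c * F x" "lebesgue_on A"] by (simp add: Lnorm_infinity)
    consider "c = 0" | "c = top" | "0 < c" "c < top"
      using not_gr_zero top.not_eq_extremum by blast
    then show "c * Lnorm q A F \<le> Lnorm q A (\<lambda>x. c * F x)"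
    proof cases
      assume c: "c = top"
      show ?thesis
      proof (cases "Lnorm q A (\<lambda>x. c * F x) = top")
        case False
        have "AE x in lebesgue_on A. F x \<le> 0"
          using * False c by (auto elim!: eventually_mono simp: ennreal_top_mult top_unique split: if_splits)
        then have "Lnorm q A F \<le> 0" using 1 by (auto simp: Lnorm_infinity simp del: le_zero_eq)
        then show ?thesis by simp
      qed simp
    next
      assume c: "0 < c" "c < top"
      have "AE x in lebesgue_on A. F x \<le> Lnorm q A (\<lambda>x. c * F x) / c"
        using *
      proof eventually_elim
        case (elim x)
        have "F x = c * F x / c"
          using c by (simp add: ennreal_mult_divide_eq mult.commute[of c])
        then show ?case using divide_right_mono_ennreal[OF elim, of c] by simp
      qed
      then have "Lnorm q A F \<le> Lnorm q A (\<lambda>x. c * F x) / c"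
        using 1 by (auto simp: Lnorm_infinity)
      then have "c * Lnorm q A F \<le> c * (Lnorm q A (\<lambda>x. c * F x) / c)"
        by (rule mult_left_mono) simp
      also have "\<dots> = Lnorm q A (\<lambda>x. c * F x)"
        using c by (subst ennreal_times_divide, subst mult.commute, subst ennreal_mult_divide_eq) auto
      finally show ?thesis .
    qed simp
  qed
next
  case (2 Q)
  then show ?thesis
    by (simp add: Lnorm_ereal epow_mult nn_integral_cmult epow_epow)
qed

text \<open>The factor 2 is the root of the constant 2 powr Q of the integrands, and 2 powr (1/Q)
  comes from taking the root of a sum of two integrals. For \<open>q = \<infinity>\<close> the value
  2 is a harmless enlargement of 1.\<close>

lemma Lnorm_add:
  assumes "0 < q" and [measurable]: "F \<in> borel_measurable (lebesgue_on A)"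
    "G \<in> borel_measurable (lebesgue_on A)"
  shows "Lnorm q A (\<lambda>x. F x + G x) \<le> ennreal (2 * 2 powr rcp q) * (Lnorm q A F + Lnorm q A G)"
  using assms(1)
proof (cases rule: ereal_pos_cases)
  case 1
  have "AE x in lebesgue_on A. F x + G x \<le> esssup (lebesgue_on A) F + esssup (lebesgue_on A) G"
    using esssup_AE[of F "lebesgue_on A"] esssup_AE[of G "lebesgue_on A"]
    by eventually_elim (auto intro: add_mono)
  then have "Lnorm q A (\<lambda>x. F x + G x) \<le> 1 * (Lnorm q A F + Lnorm q A G)"
    using 1 by (auto simp: Lnorm_infinity)
  also have "\<dots> \<le> ennreal (2 * 2 powr rcp q) * (Lnorm q A F + Lnorm q A G)"
    using 1 by (intro mult_right_mono) auto
  finally show ?thesis .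
next
  case (2 Q)
  have "(\<integral>\<^sup>+ x. epow (F x + G x) Q \<partial>lebesgue_on A)
      \<le> (\<integral>\<^sup>+ x. ennreal (2 powr Q) * (epow (F x) Q + epow (G x) Q) \<partial>lebesgue_on A)"
    using 2 by (intro nn_integral_mono epow_add_le)
  also have "\<dots> = ennreal (2 powr Q) *
      ((\<integral>\<^sup>+ x. epow (F x) Q \<partial>lebesgue_on A) + (\<integral>\<^sup>+ x. epow (G x) Q \<partial>lebesgue_on A))"
    by (simp add: nn_integral_cmult nn_integral_add)
  finally have "Lnorm q A (\<lambda>x. F x + G x) \<le> epow (ennreal (2 powr Q) *
      ((\<integral>\<^sup>+ x. epow (F x) Q \<partial>lebesgue_on A) + (\<integral>\<^sup>+ x. epow (G x) Q \<partial>lebesgue_on A))) (1 / Q)"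
    using 2 by (auto simp: Lnorm_ereal intro!: epow_mono)
  also have "\<dots> = ennreal 2 * epow ((\<integral>\<^sup>+ x. epow (F x) Q \<partial>lebesgue_on A)
      + (\<integral>\<^sup>+ x. epow (G x) Q \<partial>lebesgue_on A)) (1 / Q)"
    using 2 by (subst epow_mult) (auto simp: epow_ennreal powr_powr)
  also have "\<dots> \<le> ennreal 2 * (ennreal (2 powr (1 / Q)) * (Lnorm q A F + Lnorm q A G))"
    using 2 by (intro mult_left_mono) (auto simp: Lnorm_ereal intro!: epow_add_le)
  also have "\<dots> = ennreal (2 * 2 powr rcp q) * (Lnorm q A F + Lnorm q A G)"
    using 2 by (simp add: rcp_ereal ennreal_mult mult.assoc del: ennreal_numeral)
  finally show ?thesis .
qed

section \<open>Power kernels and convolution\<close>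

lemma borel_measurable_if_superlevel_intervals:
  fixes g :: "real \<Rightarrow> ennreal"
  assumes "is_interval A" "\<And>y. is_interval {x \<in> A. y < g x}"
  shows "g \<in> borel_measurable (lebesgue_on A)"
proof (rule borel_measurableI_greater)
  fix y
  have "{x \<in> A. y < g x} \<in> sets lebesgue"
    using real_interval_borel_measurable[OF assms(2)] by auto
  then show "{x \<in> space (lebesgue_on A). y < g x} \<in> sets (lebesgue_on A)"
    using real_interval_borel_measurable[OF assms(1)] by (auto simp: sets_restrict_space_iff)
qed

lemma borel_measurable_antimono_on:
  fixes g :: "real \<Rightarrow> ennreal"
  assumes "antimono_on A g" "is_interval A"
  shows "g \<in> borel_measurable (lebesgue_on A)"
proof (rule borel_measurable_if_superlevel_intervals[OF assms(2)])
  fix y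
  show "is_interval {x \<in> A. y < g x}"
    unfolding is_interval_1
  proof (intro ballI allI impI, elim conjE)
    fix a b x assume "a \<in> {x \<in> A. y < g x}" "b \<in> {x \<in> A. y < g x}" "a \<le> x" "x \<le> b"
    moreover from this have "x \<in> A"
      using assms(2) unfolding is_interval_1 by blast
    ultimately show "x \<in> {x \<in> A. y < g x}"
      using monotone_onD[OF assms(1), of x b] by auto
  qed
qed

lemma borel_measurable_mono_on:
  fixes g :: "real \<Rightarrow> ennreal"
  assumes "mono_on A g" "is_interval A"
  shows "g \<in> borel_measurable (lebesgue_on A)"
proof (rule borel_measurable_if_superlevel_intervals[OF assms(2)])
  fix y
  show "is_interval {x \<in> A. y < g x}"
    unfolding is_interval_1
  proof (intro ballI allI impI, elim conjE)
    fix a b x assume "a \<in> {x \<in> A. y < g x}" "b \<in> {x \<in> A. y < g x}" "a \<le> x" "x \<le> b"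
    moreover from this have "x \<in> A"
      using assms(2) unfolding is_interval_1 by blast
    ultimately show "x \<in> {x \<in> A. y < g x}"
      using monotone_onD[OF assms(1), of a x] by auto
  qed
qed

lemma is_interval_einterval: "is_interval (einterval x y)"
  unfolding is_interval_1 by (auto simp: einterval_iff intro: less_le_trans le_less_trans[of "ereal _" "ereal _"])

section \<open>Explicit integrals of powers\<close>

lemma nn_integral_lebesgue_on_has_integral:
  fixes f :: "real \<Rightarrow> real"
  assumes "(f has_integral I) S" "\<And>x. x \<in> S \<Longrightarrow> 0 \<le> f x" "S \<in> sets borel"
  shows "(\<integral>\<^sup>+ u. ennreal (f u) \<partial>lebesgue_on S) = ennreal I"
  using nn_integral_has_integral_lebesgue'[OF assms(2,1)] assms(3)
  by (simp add: nn_integral_restrict_space nn_integral_completion)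

lemma nn_integral_inverse_Ioo:
  assumes "0 < x" "x < (y::real)"
  shows "(\<integral>\<^sup>+ u. ennreal (1 / u) \<partial>lebesgue_on {x<..<y}) = ennreal (ln (y / x))"
proof (rule nn_integral_lebesgue_on_has_integral)
  have "((\<lambda>u. 1 / u) has_integral (ln y - ln x)) {x..y}"
    using assms by (intro fundamental_theorem_of_calculus)
      (auto intro!: derivative_eq_intros simp flip: has_real_derivative_iff_has_vector_derivative)
  then show "((\<lambda>u. 1 / u) has_integral ln (y / x)) {x<..<y}"
    using assms by (simp add: has_integral_Icc_iff_Ioo ln_div)
qed (use assms in auto)

text \<open>End points form a null set, so one statement covers both (0, t) and (0, t], which both
  occur.\<close>

lemma nn_integral_powr_from_0:
  assumes "0 < c" "0 < t" "S \<in> sets borel" "{0<..<t} \<subseteq> S" "S \<subseteq> {0..t}"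
  shows "(\<integral>\<^sup>+ u. ennreal (u powr (c - 1)) \<partial>lebesgue_on S) = ennreal (t powr c / c)"
proof (rule nn_integral_lebesgue_on_has_integral)
  have "((\<lambda>u. u powr (c - 1)) has_integral (t powr c / c)) {0..t}"
    using has_integral_powr_from_0[of "c - 1" t] assms by simp
  moreover have "negligible {x \<in> {0..t} - S. x powr (c - 1) \<noteq> 0}"
    by (rule negligible_subset[of "{0, t}"], simp) (use assms(4) in \<open>auto simp: subset_iff order.order_iff_strict\<close>)
  moreover have "negligible {x \<in> S - {0..t}. x powr (c - 1) \<noteq> 0}"
    by (rule negligible_subset[of "{}"]) (use assms in auto)
  ultimately show "((\<lambda>u. u powr (c - 1)) has_integral (t powr c / c)) S"
    by (subst (asm) has_integral_spike_set_eq)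
qed (use assms in auto)

lemma nn_integral_powr_to_infinity:
  assumes "0 < c" "0 < t"
  shows "(\<integral>\<^sup>+ u. ennreal (u powr (- c - 1)) \<partial>lebesgue_on {t<..}) = ennreal (t powr (- c) / c)"
proof (rule nn_integral_lebesgue_on_has_integral)
  have "((\<lambda>u. u powr (- c - 1)) has_integral (t powr (- c) / c)) {t..}"
    using has_integral_powr_to_inf[of "- c - 1" t] assms by simp
  moreover have "negligible {x \<in> {t..} - {t<..}. x powr (- c - 1) \<noteq> 0}"
    by (rule negligible_subset[of "{t}"]) auto
  moreover have "negligible {x \<in> {t<..} - {t..}. x powr (- c - 1) \<noteq> 0}"
    by (rule negligible_subset[of "{}"]) auto
  ultimately show "((\<lambda>u. u powr (- c - 1)) has_integral (t powr (- c) / c)) {t<..}"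
    by (subst (asm) has_integral_spike_set_eq)
qed auto

lemma borel_measurable_lebesgue_on [measurable (raw)]:
  "f \<in> borel_measurable borel \<Longrightarrow> f \<in> borel_measurable (lebesgue_on A)"
  by (simp add: measurable_completion measurable_restrict_space1)

text \<open>This is the norm of the constant 1 with respect to du/u, for which (x, y) has measure ln
  (y/x). For \<open>q = \<infinity>\<close> the exponent is 0 and the value 1.\<close>

lemma Lnorm_inverse_Ioo:
  assumes "0 < q" "0 < x" "x < (y::real)"
  shows "Lnorm q {x<..<y} (\<lambda>u. ennreal (u powr (- rcp q))) = ennreal (ln (y / x) powr rcp q)"
  using assms(1)
proof (cases rule: ereal_pos_cases)
  case 1
  have "Lnorm q {x<..<y} (\<lambda>u. ennreal (u powr (- rcp q))) = Lnorm q {x<..<y} (\<lambda>u. 1)"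
    using 1 assms by (intro Lnorm_cong) auto
  also have "\<dots> = 1"
    using 1 assms by (simp add: Lnorm_infinity esssup_const emeasure_restrict_space)
  finally show ?thesis using 1 assms by simp
next
  case (2 Q)
  have "(\<integral>\<^sup>+ u. epow (ennreal (u powr (- rcp q))) Q \<partial>lebesgue_on {x<..<y})
      = (\<integral>\<^sup>+ u. ennreal (1 / u) \<partial>lebesgue_on {x<..<y})"
    using 2 assms
    by (intro nn_integral_cong) (auto simp: epow_ennreal powr_powr rcp_ereal powr_minus_divide[of _ 1, symmetric])
  then show ?thesis
    using 2 assms by (simp add: Lnorm_ereal nn_integral_inverse_Ioo epow_ennreal rcp_ereal)
qed

lemma Lnorm_powr_from_0:
  assumes "0 < W" "0 < c" "0 < t"
  shows "Lnorm (ereal W) {0<..<t} (\<lambda>v. ennreal (v powr (c - 1 / W)))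
    = ennreal (t powr c * (c * W) powr (- 1 / W))"
proof -
  have "(\<integral>\<^sup>+ u. epow (ennreal (u powr (c - 1 / W))) W \<partial>lebesgue_on {0<..<t})
      = (\<integral>\<^sup>+ u. ennreal (u powr (c * W - 1)) \<partial>lebesgue_on {0<..<t})"
    using assms by (intro nn_integral_cong) (auto simp: epow_ennreal powr_powr algebra_simps)
  also have "\<dots> = ennreal (t powr (c * W) / (c * W))"
    using assms by (intro nn_integral_powr_from_0) auto
  finally show ?thesis
    using assms by (simp add: Lnorm_ereal epow_ennreal powr_divide powr_powr powr_minus_divide)
qed

text \<open>The function \<open>exp (- \<beta> * \<bar>ln x\<bar>)\<close> on the positive reals.\<close>

definition kern :: "real \<Rightarrow> real \<Rightarrow> real" where
  "kern \<beta> x = min (x powr \<beta>) (x powr (- \<beta>))"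

lemma kern_nonneg [simp]: "0 \<le> kern \<beta> x"
  by (simp add: kern_def)

lemma kern_measurable [measurable]: "kern \<beta> \<in> borel_measurable borel"
  unfolding kern_def by measurable

lemma kern_eq_powr: assumes "0 \<le> \<beta>" "0 < x" "x \<le> 1" shows "kern \<beta> x = x powr \<beta>"
proof -
  have "x powr \<beta> \<le> x powr (- \<beta>)" using assms by (intro powr_mono') auto
  then show ?thesis by (simp add: kern_def)
qed

lemma kern_eq_powr_minus: assumes "0 \<le> \<beta>" "1 \<le> x" shows "kern \<beta> x = x powr (- \<beta>)"
proof -
  have "x powr (- \<beta>) \<le> x powr \<beta>" using assms by (intro powr_mono) auto
  then show ?thesis by (simp add: kern_def)
qed

lemma kern_le_1: assumes "0 \<le> \<beta>" "0 < x" shows "kern \<beta> x \<le> 1"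
proof (cases "x \<le> 1")
  case True then show ?thesis using assms by (simp add: kern_eq_powr powr_le1)
next
  case False then show ?thesis using assms
    by (simp add: kern_eq_powr_minus powr_minus_divide ge_one_powr_ge_zero)
qed

text \<open>Since du/u is invariant under dilations, the bound depends neither on \<open>s\<close>
  nor on \<open>A\<close>. For finite exponents the parts \<open>u \<le> s\<close> and
  \<open>u > s\<close> of the kernel contribute 1/(\<beta> Q) each to the integral.\<close>

lemma Lnorm_kern:
  assumes "0 < q" "0 < \<beta>"
  obtains K :: real where "0 < K"
    "\<And>A s. A \<in> sets borel \<Longrightarrow> A \<subseteq> {0<..} \<Longrightarrow> 0 < s \<Longrightarrow>
      Lnorm q A (\<lambda>u. ennreal (u powr (- rcp q) * kern \<beta> (u / s))) \<le> ennreal K"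
  using assms(1)
proof (cases rule: ereal_pos_cases)
  case 1
  show ?thesis
  proof (rule that[of 1])
    fix A :: "real set" and s :: real assume *: "A \<in> sets borel" "A \<subseteq> {0<..}" "0 < s"
    show "Lnorm q A (\<lambda>u. ennreal (u powr (- rcp q) * kern \<beta> (u / s))) \<le> ennreal 1"
      unfolding 1 Lnorm_infinity
    proof (rule esssup_I)
      show "AE u in lebesgue_on A. ennreal (u powr (- rcp \<infinity>) * kern \<beta> (u / s)) \<le> ennreal 1"
        using * assms by (intro AE_I2) (auto intro!: kern_le_1)
    qed measurable
  qed simp
next
  case (2 Q)
  show ?thesis
  proof (rule that[of "(2 / (\<beta> * Q)) powr (1 / Q)"])
    fix A :: "real set" and s :: real assume *: "A \<in> sets borel" "A \<subseteq> {0<..}" "0 < s"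
    let ?f1 = "\<lambda>u. ennreal (s powr (- (\<beta> * Q))) * ennreal (u powr (\<beta> * Q - 1))"
    let ?f2 = "\<lambda>u. ennreal (s powr (\<beta> * Q)) * ennreal (u powr (- (\<beta> * Q) - 1))"
    have le: "epow (ennreal (u powr (- rcp q) * kern \<beta> (u / s))) Q * indicator A u
        \<le> ?f1 u * indicator {0<..s} u + ?f2 u * indicator {s<..} u" for u
    proof (cases "u \<in> A")
      case True
      then have u: "0 < u" using * by auto
      have e: "epow (ennreal (u powr (- rcp q) * kern \<beta> (u / s))) Q
          = ennreal (u powr (- 1) * kern \<beta> (u / s) powr Q)"
        using 2 by (simp add: epow_ennreal powr_mult powr_powr rcp_ereal)
      show ?thesis
      proof (cases "u \<le> s")
        case le: True
        then have "kern \<beta> (u / s) powr Q = (u / s) powr (\<beta> * Q)"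
          using assms u * by (simp add: kern_eq_powr powr_powr)
        then show ?thesis unfolding e using u le * True
          by (simp add: powr_divide powr_diff powr_minus_divide ennreal_mult[symmetric] mult_ac)
      next
        case le: False
        then have "kern \<beta> (u / s) powr Q = (u / s) powr (- (\<beta> * Q))"
          using assms u * by (simp add: kern_eq_powr_minus powr_powr)
        then show ?thesis unfolding e using u le * True
          by (simp add: powr_divide powr_diff powr_minus_divide ennreal_mult[symmetric] mult_ac)
      qed
    qed simp
    have "(\<integral>\<^sup>+ u. epow (ennreal (u powr (- rcp q) * kern \<beta> (u / s))) Q \<partial>lebesgue_on A)
        = (\<integral>\<^sup>+ u. epow (ennreal (u powr (- rcp q) * kern \<beta> (u / s))) Q * indicator A u \<partial>lebesgue)"
      using * by (simp add: nn_integral_restrict_space)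
    also have "\<dots> \<le> (\<integral>\<^sup>+ u. ?f1 u * indicator {0<..s} u + ?f2 u * indicator {s<..} u \<partial>lebesgue)"
      using le by (rule nn_integral_mono)
    also have "\<dots> = (\<integral>\<^sup>+ u. ?f1 u * indicator {0<..s} u \<partial>lebesgue) + (\<integral>\<^sup>+ u. ?f2 u * indicator {s<..} u \<partial>lebesgue)"
      by (intro nn_integral_add measurable_completion) measurable
    also have "\<dots> = (\<integral>\<^sup>+ u. ?f1 u \<partial>lebesgue_on {0<..s}) + (\<integral>\<^sup>+ u. ?f2 u \<partial>lebesgue_on {s<..})"
      by (simp add: nn_integral_restrict_space)
    also have "(\<integral>\<^sup>+ u. ?f1 u \<partial>lebesgue_on {0<..s}) = ennreal (s powr (- (\<beta> * Q))) * ennreal (s powr (\<beta> * Q) / (\<beta> * Q))"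
      using assms 2 * by (subst nn_integral_cmult, measurable)
        (subst nn_integral_powr_from_0[where t=s], auto)
    also have "\<dots> = ennreal (1 / (\<beta> * Q))"
      using assms 2 * by (simp add: ennreal_mult[symmetric] powr_minus_divide)
    also have "(\<integral>\<^sup>+ u. ?f2 u \<partial>lebesgue_on {s<..}) = ennreal (s powr (\<beta> * Q)) * ennreal (s powr (- (\<beta> * Q)) / (\<beta> * Q))"
      using assms 2 * by (subst nn_integral_cmult) (auto simp: nn_integral_powr_to_infinity)
    also have "\<dots> = ennreal (1 / (\<beta> * Q))"
      using assms 2 * by (simp add: ennreal_mult[symmetric] powr_minus_divide)
    also have "ennreal (1 / (\<beta> * Q)) + ennreal (1 / (\<beta> * Q)) = ennreal (2 / (\<beta> * Q))"
      using assms 2 by (simp add: ennreal_plus[symmetric] del: ennreal_plus)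
    finally have "epow (\<integral>\<^sup>+ u. epow (ennreal (u powr (- rcp q) * kern \<beta> (u / s))) Q \<partial>lebesgue_on A) (1 / Q)
        \<le> epow (ennreal (2 / (\<beta> * Q))) (1 / Q)"
      using 2 by (intro epow_mono) auto
    then show "Lnorm q A (\<lambda>u. ennreal (u powr (- rcp q) * kern \<beta> (u / s))) \<le> ennreal ((2 / (\<beta> * Q)) powr (1 / Q))"
      using assms 2 by (simp add: Lnorm_ereal epow_ennreal)
  qed (use assms 2 in simp)
qed

text \<open>A countable cover of \<open>lborel\<close> by sets of finite measure serves for the
  completion as well. The interchange of integrals in the convolution inequality relies on
  this.\<close>

lemma sigma_finite_lebesgue_on: "A \<in> sets borel \<Longrightarrow> sigma_finite_measure (lebesgue_on (A :: real set))"
proof (rule sigma_finite_measure_restrict_space)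
  obtain C :: "real set set" where "countable C" "C \<subseteq> sets lborel" "\<Union>C = space lborel"
    "\<forall>a\<in>C. emeasure lborel a \<noteq> \<infinity>"
    using lborel.sigma_finite_countable by auto
  then show "sigma_finite_measure (lebesgue :: real measure)"
    by (intro sigma_finite_measure.intro exI[of _ C]) auto
qed auto

text \<open>Taking \<open>q\<close>-th powers turns this into Young's inequality for the convolution with an integrable
  kernel on the multiplicative group of positive reals.\<close>

lemma Lnorm_kern_convolution:
  assumes "0 < q" "0 < \<beta>"
  obtains K :: real where "0 < K"
    "\<And>A F \<Phi>. A \<in> sets borel \<Longrightarrow> A \<subseteq> {0<..} \<Longrightarrow>
      F \<in> borel_measurable (lebesgue_on A) \<Longrightarrow> \<Phi> \<in> borel_measurable (lebesgue_on A) \<Longrightarrow>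
      (\<And>u. u \<in> A \<Longrightarrow> \<Phi> u \<le> Lnorm q A (\<lambda>s. ennreal (s powr (- rcp q) * kern \<beta> (u / s)) * F s)) \<Longrightarrow>
      Lnorm q A (\<lambda>u. ennreal (u powr (- rcp q)) * \<Phi> u)
        \<le> ennreal K * Lnorm q A (\<lambda>s. ennreal (s powr (- rcp q)) * F s)"
  using assms(1)
proof (cases rule: ereal_pos_cases)
  case 1
  show ?thesis
  proof (rule that[of 1])
    fix A and F \<Phi> :: "real \<Rightarrow> ennreal"
    assume A: "A \<in> sets borel" "A \<subseteq> {0<..}"
      and [measurable]: "F \<in> borel_measurable (lebesgue_on A)" "\<Phi> \<in> borel_measurable (lebesgue_on A)"
      and le: "\<And>u. u \<in> A \<Longrightarrow> \<Phi> u \<le> Lnorm q A (\<lambda>s. ennreal (s powr (- rcp q) * kern \<beta> (u / s)) * F s)"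
    have *: "\<Phi> u \<le> Lnorm q A F" if "u \<in> A" for u
    proof -
      have "\<Phi> u \<le> Lnorm q A (\<lambda>s. ennreal (s powr (- rcp q) * kern \<beta> (u / s)) * F s)"
        using le that .
      also have "\<dots> \<le> Lnorm q A (\<lambda>s. 1 * F s)"
      proof (rule Lnorm_mono[OF assms(1)])
        fix s assume "s \<in> A"
        then have "0 < s" "0 < u" using A that by auto
        then have "s powr (- rcp q) * kern \<beta> (u / s) \<le> 1"
          using assms 1 kern_le_1[of \<beta> "u / s"] by simp
        then show "ennreal (s powr (- rcp q) * kern \<beta> (u / s)) * F s \<le> 1 * F s"
          by (intro mult_right_mono) (simp_all flip: ennreal_1)
      qed measurable
      finally show ?thesis by simp
    qed
    have "Lnorm q A (\<lambda>u. ennreal (u powr (- rcp q)) * \<Phi> u) = esssup (lebesgue_on A) \<Phi>"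
      using 1 A by (subst Lnorm_cong[of A _ \<Phi>]) (auto simp: Lnorm_infinity)
    also have "\<dots> \<le> Lnorm q A F"
      using * by (intro esssup_I) auto
    also have "Lnorm q A F = Lnorm q A (\<lambda>s. ennreal (s powr (- rcp q)) * F s)"
      using 1 A by (intro Lnorm_cong) auto
    finally show "Lnorm q A (\<lambda>u. ennreal (u powr (- rcp q)) * \<Phi> u)
        \<le> ennreal 1 * Lnorm q A (\<lambda>s. ennreal (s powr (- rcp q)) * F s)"
      by simp
  qed simp
next
  case (2 Q)
  obtain K where K: "0 < K" "\<And>A s. A \<in> sets borel \<Longrightarrow> A \<subseteq> {0<..} \<Longrightarrow> 0 < s \<Longrightarrow>
      Lnorm q A (\<lambda>u. ennreal (u powr (- rcp q) * kern \<beta> (u / s))) \<le> ennreal K"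
    using Lnorm_kern[OF assms] by blast
  show ?thesis
  proof (rule that[OF K(1)])
    fix A and F \<Phi> :: "real \<Rightarrow> ennreal"
    assume A: "A \<in> sets borel" "A \<subseteq> {0<..}"
      and F [measurable]: "F \<in> borel_measurable (lebesgue_on A)"
      and [measurable]: "\<Phi> \<in> borel_measurable (lebesgue_on A)"
      and le: "\<And>u. u \<in> A \<Longrightarrow> \<Phi> u \<le> Lnorm q A (\<lambda>s. ennreal (s powr (- rcp q) * kern \<beta> (u / s)) * F s)"
    interpret sigma_finite_measure "lebesgue_on A" using A(1) by (rule sigma_finite_lebesgue_on)
    interpret pair_sigma_finite "lebesgue_on A" "lebesgue_on A" ..
    \<comment> \<open>The factor u powr (- 1/q) goes into the kernel \<open>k\<close> and s powr (-
      1/q) into \<open>G\<close>. After the interchange the inner integral of \<open>k\<close> over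
      u is then exactly the quantity bounded uniformly in s.\<close>
    define G where "G = (\<lambda>s. epow (ennreal (s powr (- rcp q)) * F s) Q)"
    define k where "k = (\<lambda>u s. epow (ennreal (u powr (- rcp q) * kern \<beta> (u / s))) Q)"
    have [measurable]: "G \<in> borel_measurable (lebesgue_on A)"
      unfolding G_def by measurable
    have [measurable]: "(\<lambda>x. x) \<in> borel_measurable (lebesgue_on A)"
      by (rule borel_measurable_lebesgue_on) simp
    have fst_meas [measurable]: "fst \<in> borel_measurable (lebesgue_on A \<Otimes>\<^sub>M lebesgue_on A)"
      and snd_meas [measurable]: "snd \<in> borel_measurable (lebesgue_on A \<Otimes>\<^sub>M lebesgue_on A)"
      using measurable_compose[OF measurable_fst \<open>(\<lambda>x. x) \<in> _\<close>]
        measurable_compose[OF measurable_snd \<open>(\<lambda>x. x) \<in> _\<close>] by simp_all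
    have [measurable]: "(\<lambda>x. G (snd x)) \<in> borel_measurable (lebesgue_on A \<Otimes>\<^sub>M lebesgue_on A)"
      by (rule measurable_compose[OF measurable_snd]) simp
    have [measurable]: "(\<lambda>x. k (fst x) (snd x)) \<in> borel_measurable (lebesgue_on A \<Otimes>\<^sub>M lebesgue_on A)"
      unfolding k_def by measurable
    have [measurable]: "(\<lambda>u. k u s) \<in> borel_measurable (lebesgue_on A)" for s
      unfolding k_def by measurable
    have *: "epow (ennreal (u powr (- rcp q)) * \<Phi> u) Q \<le> (\<integral>\<^sup>+ s. k u s * G s \<partial>lebesgue_on A)" if "u \<in> A" for u
    proof -
      have "epow (ennreal (u powr (- rcp q)) * \<Phi> u) Q
          \<le> epow (ennreal (u powr (- rcp q)) * Lnorm q A (\<lambda>s. ennreal (s powr (- rcp q) * kern \<beta> (u / s)) * F s)) Q"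
        using le[OF that] 2 by (intro epow_mono mult_left_mono) auto
      also have "\<dots> = epow (ennreal (u powr (- rcp q))) Q *
          (\<integral>\<^sup>+ s. epow (ennreal (s powr (- rcp q) * kern \<beta> (u / s)) * F s) Q \<partial>lebesgue_on A)"
        using 2 by (simp add: epow_mult epow_Lnorm)
      also have "\<dots> = (\<integral>\<^sup>+ s. epow (ennreal (u powr (- rcp q))) Q *
          epow (ennreal (s powr (- rcp q) * kern \<beta> (u / s)) * F s) Q \<partial>lebesgue_on A)"
        by (rule nn_integral_cmult[symmetric]) measurable
      also have "\<dots> = (\<integral>\<^sup>+ s. k u s * G s \<partial>lebesgue_on A)"
        using 2 by (simp add: k_def G_def epow_mult ennreal_mult mult_ac)
      finally show ?thesis .
    qed
    have "(\<integral>\<^sup>+ u. epow (ennreal (u powr (- rcp q)) * \<Phi> u) Q \<partial>lebesgue_on A)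
        \<le> (\<integral>\<^sup>+ u. \<integral>\<^sup>+ s. k u s * G s \<partial>lebesgue_on A \<partial>lebesgue_on A)"
      using * by (intro nn_integral_mono) auto
    also have "\<dots> = (\<integral>\<^sup>+ s. \<integral>\<^sup>+ u. k u s * G s \<partial>lebesgue_on A \<partial>lebesgue_on A)"
      by (rule Fubini'[symmetric]) (simp add: case_prod_beta)
    also have "\<dots> = (\<integral>\<^sup>+ s. (\<integral>\<^sup>+ u. k u s \<partial>lebesgue_on A) * G s \<partial>lebesgue_on A)"
      by (simp add: nn_integral_multc)
    also have "\<dots> \<le> (\<integral>\<^sup>+ s. epow (ennreal K) Q * G s \<partial>lebesgue_on A)"
    proof (intro nn_integral_mono mult_right_mono)
      fix s assume "s \<in> space (lebesgue_on A)"
      then have "epow (Lnorm q A (\<lambda>u. ennreal (u powr (- rcp q) * kern \<beta> (u / s)))) Q \<le> epow (ennreal K) Q"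
        using A 2 K by (intro epow_mono) auto
      then show "(\<integral>\<^sup>+ u. k u s \<partial>lebesgue_on A) \<le> epow (ennreal K) Q"
        using 2 by (simp add: epow_Lnorm k_def)
    qed simp
    also have "\<dots> = epow (ennreal K) Q * (\<integral>\<^sup>+ s. G s \<partial>lebesgue_on A)"
      by (rule nn_integral_cmult) measurable
    finally have "epow (\<integral>\<^sup>+ u. epow (ennreal (u powr (- rcp q)) * \<Phi> u) Q \<partial>lebesgue_on A) (1 / Q)
        \<le> epow (epow (ennreal K) Q * (\<integral>\<^sup>+ s. G s \<partial>lebesgue_on A)) (1 / Q)"
      using 2 by (intro epow_mono) auto
    then show "Lnorm q A (\<lambda>u. ennreal (u powr (- rcp q)) * \<Phi> u)
        \<le> ennreal K * Lnorm q A (\<lambda>s. ennreal (s powr (- rcp q)) * F s)"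
      using 2 by (simp add: Lnorm_ereal G_def epow_mult epow_epow)
  qed
qed

section \<open>Slowly varying functions and weighted norms\<close>

text \<open>Passing to \<open>G\<close> and back costs the factor C/c. Applied to the definition of
  \<open>SV\<close>, this turns the auxiliary monotone functions into an almost monotonicity of the
  weight itself.\<close>

lemma equiv_on_compare:
  assumes "equiv_on S F G"
  obtains K :: real where "0 < K" "\<And>x y. x \<in> S \<Longrightarrow> y \<in> S \<Longrightarrow> G x \<le> G y \<Longrightarrow> F x \<le> ennreal K * F y"
proof -
  obtain c C where c: "0 < c" "c \<le> C" "\<And>x. x \<in> S \<Longrightarrow> ennreal c * G x \<le> F x"
    "\<And>x. x \<in> S \<Longrightarrow> F x \<le> ennreal C * G x"
    using assms unfolding equiv_on_def by blast
  have "F x \<le> ennreal (C / c) * F y" if "x \<in> S" "y \<in> S" "G x \<le> G y" for x y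
  proof -
    have "F x \<le> ennreal C * G x" using c that by auto
    also have "\<dots> \<le> ennreal C * G y" using that by (intro mult_left_mono) auto
    also have "\<dots> = ennreal (C / c) * (ennreal c * G y)"
      using c by (simp add: mult.assoc[symmetric] ennreal_mult[symmetric])
    also have "\<dots> \<le> ennreal (C / c) * F y" using c that by (intro mult_left_mono) auto
    finally show ?thesis .
  qed
  then show ?thesis using c by (intro that[of "C / c"]) auto
qed

lemma SV_pos: "a \<in> SV L \<Longrightarrow> t \<in> einterval 0 L \<Longrightarrow> 0 < a t"
  by (auto simp: SV_def)

lemma SV_measurable: "a \<in> SV L \<Longrightarrow> a \<in> borel_measurable (lebesgue_on (einterval 0 L))"
  by (auto simp: SV_def)

lemma SV_mono_on:
  assumes "a \<in> SV L" "0 < \<epsilon>"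
  obtains h where "mono_on (einterval 0 L) h" "equiv_on (einterval 0 L) (\<lambda>t. ennreal (t powr \<epsilon> * a t)) h"
  using assms unfolding SV_def by blast

lemma SV_antimono_on:
  assumes "a \<in> SV L" "0 < \<epsilon>"
  obtains h where "antimono_on (einterval 0 L) h"
    "equiv_on (einterval 0 L) (\<lambda>t. ennreal (t powr (- \<epsilon>) * a t)) h"
  using assms unfolding SV_def by blast

text \<open>The two almost monotonicity conditions in a single estimate of Potter type: the
  non-decreasing one gives the case \<open>t \<le> s\<close>, the non-increasing one the case
  \<open>t > s\<close>.\<close>

lemma SV_kern:
  assumes a: "a \<in> SV L" and e: "0 < \<epsilon>"
  obtains C where "0 < C"
    "\<And>s t. s \<in> einterval 0 L \<Longrightarrow> t \<in> einterval 0 L \<Longrightarrow> kern \<epsilon> (t / s) * a t \<le> C * a s"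
proof -
  obtain h where h: "mono_on (einterval 0 L) h" "equiv_on (einterval 0 L) (\<lambda>t. ennreal (t powr \<epsilon> * a t)) h"
    using SV_mono_on[OF a e] .
  obtain h' where h': "antimono_on (einterval 0 L) h'"
      "equiv_on (einterval 0 L) (\<lambda>t. ennreal (t powr (- \<epsilon>) * a t)) h'"
    using SV_antimono_on[OF a e] .
  obtain K where K: "0 < K" "\<And>x y. x \<in> einterval 0 L \<Longrightarrow> y \<in> einterval 0 L \<Longrightarrow> h x \<le> h y \<Longrightarrow>
      ennreal (x powr \<epsilon> * a x) \<le> ennreal K * ennreal (y powr \<epsilon> * a y)"
    using equiv_on_compare[OF h(2)] by blast
  obtain K' where K': "0 < K'" "\<And>x y. x \<in> einterval 0 L \<Longrightarrow> y \<in> einterval 0 L \<Longrightarrow> h' x \<le> h' y \<Longrightarrow>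
      ennreal (x powr (- \<epsilon>) * a x) \<le> ennreal K' * ennreal (y powr (- \<epsilon>) * a y)"
    using equiv_on_compare[OF h'(2)] by blast
  have "kern \<epsilon> (t / s) * a t \<le> max K K' * a s" if st: "s \<in> einterval 0 L" "t \<in> einterval 0 L" for s t
  proof -
    have pos: "0 < s" "0 < t" "0 < a s" "0 < a t"
      using st SV_pos[OF a] by (auto simp: einterval_iff)
    show ?thesis
    proof (cases "t \<le> s")
      case True
      have "ennreal (t powr \<epsilon> * a t) \<le> ennreal K * ennreal (s powr \<epsilon> * a s)"
        using True st by (intro K(2) monotone_onD[OF h(1)]) auto
      then have "t powr \<epsilon> * a t \<le> K * (s powr \<epsilon> * a s)"
        using pos K(1) by (simp add: ennreal_mult[symmetric] ennreal_le_iff)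
      then have "kern \<epsilon> (t / s) * a t \<le> K * a s"
        using pos True e by (simp add: kern_eq_powr powr_divide field_simps)
      then show ?thesis using pos by (smt (verit) max.cobounded1 mult_right_mono)
    next
      case False
      have "ennreal (t powr (- \<epsilon>) * a t) \<le> ennreal K' * ennreal (s powr (- \<epsilon>) * a s)"
        using False st by (intro K'(2) monotone_onD[OF h'(1)]) auto
      then have "t powr (- \<epsilon>) * a t \<le> K' * (s powr (- \<epsilon>) * a s)"
        using pos K'(1) by (simp add: ennreal_mult[symmetric] ennreal_le_iff)
      then have "kern \<epsilon> (t / s) * a t \<le> K' * a s"
        using pos False e by (simp add: kern_eq_powr_minus powr_divide field_simps)
      then show ?thesis using pos by (smt (verit) max.cobounded2 mult_right_mono)
    qed
  qed
  then show ?thesis using that[of "max K K'"] K by auto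
qed

lemma equiv_on_cong:
  "(\<And>x. x \<in> S \<Longrightarrow> F x = F' x) \<Longrightarrow> equiv_on S F G \<longleftrightarrow> equiv_on S F' G"
  by (simp add: equiv_on_def cong: ball_cong)

lemma equiv_on_mult:
  assumes "equiv_on S F G" "equiv_on S F' G'"
  shows "equiv_on S (\<lambda>x. F x * F' x) (\<lambda>x. G x * G' x)"
proof -
  obtain c C where c: "0 < c" "c \<le> C" "\<And>x. x \<in> S \<Longrightarrow> ennreal c * G x \<le> F x"
    "\<And>x. x \<in> S \<Longrightarrow> F x \<le> ennreal C * G x"
    using assms(1) unfolding equiv_on_def by blast
  obtain d D where d: "0 < d" "d \<le> D" "\<And>x. x \<in> S \<Longrightarrow> ennreal d * G' x \<le> F' x"
    "\<And>x. x \<in> S \<Longrightarrow> F' x \<le> ennreal D * G' x"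
    using assms(2) unfolding equiv_on_def by blast
  have "ennreal (c * d) * (G x * G' x) \<le> F x * F' x" if "x \<in> S" for x
    using mult_mono[OF c(3) d(3), OF that that] c(1) d(1) by (simp add: ennreal_mult mult_ac)
  moreover have "F x * F' x \<le> ennreal (C * D) * (G x * G' x)" if "x \<in> S" for x
    using mult_mono[OF c(4) d(4), OF that that] c(1,2) d(1,2) by (simp add: ennreal_mult mult_ac)
  moreover have "0 < c * d" "c * d \<le> C * D"
    using c(1,2) d(1,2) by (auto intro: mult_mono)
  ultimately show ?thesis unfolding equiv_on_def by blast
qed

text \<open>Halving \<epsilon> gives each factor its own monotone comparison function, and products
  of these are monotone. The product \<open>a * b\<close> appears as the slowly varying part of the
  weight whenever inner norms are replaced by their values at the end point.\<close>

lemma SV_mult: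
  assumes a: "a \<in> SV L" and b: "b \<in> SV L"
  shows "(\<lambda>t. a t * b t) \<in> SV L"
proof -
  let ?I = "einterval 0 L"
  have split: "ennreal (t powr \<epsilon> * (a t * b t)) = ennreal (t powr (\<epsilon> / 2) * a t) * ennreal (t powr (\<epsilon> / 2) * b t)"
    if "t \<in> ?I" for t \<epsilon>
    using that SV_pos[OF a that] SV_pos[OF b that]
    by (simp add: ennreal_mult[symmetric] powr_add[symmetric])
  have eq: "equiv_on ?I (\<lambda>t. ennreal (t powr \<epsilon> * (a t * b t))) (\<lambda>t. h t * k t)"
    if h: "equiv_on ?I (\<lambda>t. ennreal (t powr (\<epsilon> / 2) * a t)) h"
      and k: "equiv_on ?I (\<lambda>t. ennreal (t powr (\<epsilon> / 2) * b t)) k"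
    for h k \<epsilon>
    using equiv_on_mult[OF h k] by (subst equiv_on_cong[OF split])
  have "\<exists>h. mono_on ?I h \<and> equiv_on ?I (\<lambda>t. ennreal (t powr \<epsilon> * (a t * b t))) h" if e: "0 < \<epsilon>" for \<epsilon>
  proof -
    obtain h where h: "mono_on ?I h" "equiv_on ?I (\<lambda>t. ennreal (t powr (\<epsilon> / 2) * a t)) h"
      using SV_mono_on[OF a half_gt_zero[OF e]] .
    obtain k where k: "mono_on ?I k" "equiv_on ?I (\<lambda>t. ennreal (t powr (\<epsilon> / 2) * b t)) k"
      using SV_mono_on[OF b half_gt_zero[OF e]] .
    have "mono_on ?I (\<lambda>t. h t * k t)"
      by (intro mono_onI mult_mono mono_onD[OF h(1)] mono_onD[OF k(1)]) simp_all
    then show ?thesis using eq[OF h(2) k(2)] by blast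
  qed
  moreover have "\<exists>h. antimono_on ?I h \<and> equiv_on ?I (\<lambda>t. ennreal (t powr (- \<epsilon>) * (a t * b t))) h" if e: "0 < \<epsilon>" for \<epsilon>
  proof -
    obtain h where h: "antimono_on ?I h" "equiv_on ?I (\<lambda>t. ennreal (t powr (- (\<epsilon> / 2)) * a t)) h"
      using SV_antimono_on[OF a half_gt_zero[OF e]] .
    obtain k where k: "antimono_on ?I k" "equiv_on ?I (\<lambda>t. ennreal (t powr (- (\<epsilon> / 2)) * b t)) k"
      using SV_antimono_on[OF b half_gt_zero[OF e]] .
    have "antimono_on ?I (\<lambda>t. h t * k t)"
      by (intro monotone_onI mult_mono monotone_onD[OF h(1)] monotone_onD[OF k(1)]) simp_all
    moreover have "equiv_on ?I (\<lambda>t. ennreal (t powr (- \<epsilon>) * (a t * b t))) (\<lambda>t. h t * k t)"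
      by (rule eq) (use h(2) k(2) in simp_all)
    ultimately show ?thesis by blast
  qed
  moreover have "(\<lambda>t. a t * b t) \<in> borel_measurable (lebesgue_on ?I)"
    using SV_measurable[OF a] SV_measurable[OF b] by measurable
  moreover have "\<forall>t\<in>?I. 0 < a t * b t"
    using SV_pos[OF a] SV_pos[OF b] by simp
  ultimately show ?thesis
    unfolding SV_def mem_Collect_eq by blast
qed

text \<open>The norm of \<open>w * g\<close> in \<open>L\<^sub>q\<close> with respect to the invariant measure \<open>du/u\<close>.\<close>

definition wnorm :: "ereal \<Rightarrow> real set \<Rightarrow> (real \<Rightarrow> real) \<Rightarrow> (real \<Rightarrow> ennreal) \<Rightarrow> ennreal" where
  "wnorm q A w g = Lnorm q A (\<lambda>u. ennreal (u powr (- rcp q) * w u) * g u)"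

lemma wnorm_mono:
  assumes "0 < q" and [measurable]: "w \<in> borel_measurable (lebesgue_on A)" "g \<in> borel_measurable (lebesgue_on A)"
    and "\<And>u. u \<in> A \<Longrightarrow> ennreal (w u) * g u \<le> ennreal (w' u) * g' u" "\<And>u. u \<in> A \<Longrightarrow> 0 \<le> w u"
      "\<And>u. u \<in> A \<Longrightarrow> 0 \<le> w' u"
  shows "wnorm q A w g \<le> wnorm q A w' g'"
  unfolding wnorm_def
proof (rule Lnorm_mono[OF assms(1)])
  show "(\<lambda>u. ennreal (u powr (- rcp q) * w u) * g u) \<in> borel_measurable (lebesgue_on A)"
    by measurable
  show "ennreal (x powr (- rcp q) * w x) * g x \<le> ennreal (x powr (- rcp q) * w' x) * g' x" if "x \<in> A" for x
    using that mult_left_mono[OF assms(4)[OF that], of "ennreal (x powr (- rcp q))"] assms(5,6)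
    by (simp add: ennreal_mult mult.assoc)
qed

lemma wnorm_cong:
  assumes "\<And>u. u \<in> A \<Longrightarrow> ennreal (w u) * g u = ennreal (w' u) * g' u" "\<And>u. u \<in> A \<Longrightarrow> 0 \<le> w u"
      "\<And>u. u \<in> A \<Longrightarrow> 0 \<le> w' u"
  shows "wnorm q A w g = wnorm q A w' g'"
  unfolding wnorm_def using assms by (intro Lnorm_cong) (simp add: ennreal_mult mult.assoc)

lemma wnorm_subset:
  assumes "0 < q" and [measurable]: "w \<in> borel_measurable (lebesgue_on B)" "g \<in> borel_measurable (lebesgue_on B)"
    and "A \<subseteq> B" "A \<in> sets borel" "B \<in> sets borel"
  shows "wnorm q A w g \<le> wnorm q B w g"
  unfolding wnorm_def using assms by (intro Lnorm_subset) auto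

lemma wnorm_cmult:
  assumes "0 < q" and [measurable]: "w \<in> borel_measurable (lebesgue_on A)" "g \<in> borel_measurable (lebesgue_on A)"
  shows "wnorm q A w (\<lambda>u. c * g u) = c * wnorm q A w g"
proof -
  have "wnorm q A w (\<lambda>u. c * g u) = Lnorm q A (\<lambda>u. c * (ennreal (u powr (- rcp q) * w u) * g u))"
    unfolding wnorm_def by (simp add: mult_ac)
  also have "\<dots> = c * wnorm q A w g"
    unfolding wnorm_def by (rule Lnorm_cmult[OF assms(1)]) measurable
  finally show ?thesis .
qed

lemma wnorm_add:
  assumes "0 < q" and [measurable]: "w \<in> borel_measurable (lebesgue_on A)"
    "g \<in> borel_measurable (lebesgue_on A)" "h \<in> borel_measurable (lebesgue_on A)"
  shows "wnorm q A w (\<lambda>u. g u + h u) \<le> ennreal (2 * 2 powr rcp q) * (wnorm q A w g + wnorm q A w h)"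
  using Lnorm_add[OF assms(1), of "\<lambda>u. ennreal (u powr (- rcp q) * w u) * g u" A
      "\<lambda>u. ennreal (u powr (- rcp q) * w u) * h u"]
  unfolding wnorm_def by (simp add: distrib_left)

lemma Lnorm_ge_const:
  assumes "0 < q" "A \<in> sets borel" and [measurable]: "F \<in> borel_measurable (lebesgue_on A)"
    and "0 < x" "x < y" "{x<..<y} \<subseteq> A" "\<And>s. s \<in> {x<..<y} \<Longrightarrow> c \<le> F s"
  shows "ennreal (ln (y / x) powr rcp q) * c \<le> Lnorm q A (\<lambda>s. ennreal (s powr (- rcp q)) * F s)"
proof -
  have "ennreal (ln (y / x) powr rcp q) * c = Lnorm q {x<..<y} (\<lambda>s. c * ennreal (s powr (- rcp q)))"
    using assms by (subst Lnorm_cmult) (auto simp: Lnorm_inverse_Ioo mult.commute)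
  also have "\<dots> \<le> Lnorm q {x<..<y} (\<lambda>s. ennreal (s powr (- rcp q)) * F s)"
    by (intro Lnorm_mono[OF assms(1)]) (auto simp: mult.commute[of c] intro!: mult_left_mono assms(7))
  also have "\<dots> \<le> Lnorm q A (\<lambda>s. ennreal (s powr (- rcp q)) * F s)"
    using assms by (intro Lnorm_subset) auto
  finally show ?thesis .
qed

lemma wnorm_ge_const:
  assumes "0 < q" "A \<in> sets borel" and [measurable]: "w \<in> borel_measurable (lebesgue_on A)"
      "g \<in> borel_measurable (lebesgue_on A)" and "\<And>s. s \<in> A \<Longrightarrow> 0 \<le> w s"
    and "0 < x" "x < y" "{x<..<y} \<subseteq> A" "\<And>s. s \<in> {x<..<y} \<Longrightarrow> c \<le> ennreal (w s) * g s"
  shows "ennreal (ln (y / x) powr rcp q) * c \<le> wnorm q A w g"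
proof -
  have "ennreal (ln (y / x) powr rcp q) * c \<le> Lnorm q A (\<lambda>s. ennreal (s powr (- rcp q)) * (ennreal (w s) * g s))"
    using assms by (intro Lnorm_ge_const) auto
  also have "\<dots> = wnorm q A w g"
    unfolding wnorm_def using assms(5) by (intro Lnorm_cong) (simp add: ennreal_mult mult_ac)
  finally show ?thesis .
qed

text \<open>A value \<open>g v\<close> of a non-increasing function is at most each value on \<open>(v/2, v)\<close>; averaging over
  this interval turns the supremum into a convolution with \<^const>\<open>kern\<close>.\<close>

lemma wnorm_sup_le:
  assumes "0 < q" "0 < \<beta>"
  obtains K :: real where "0 < K"
    "\<And>T g w w' m h M. antimono_on (einterval 0 T) g \<Longrightarrow>
      w \<in> borel_measurable (lebesgue_on (einterval 0 T)) \<Longrightarrow>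
      w' \<in> borel_measurable (lebesgue_on (einterval 0 T)) \<Longrightarrow>
      h \<in> borel_measurable (lebesgue_on (einterval 0 T)) \<Longrightarrow>
      (\<And>u. u \<in> einterval 0 T \<Longrightarrow> 0 \<le> w u) \<Longrightarrow> (\<And>u. u \<in> einterval 0 T \<Longrightarrow> 0 \<le> w' u) \<Longrightarrow> 0 \<le> M \<Longrightarrow>
      (\<And>u v s. u \<in> einterval 0 T \<Longrightarrow> v \<in> einterval 0 T \<Longrightarrow> v / 2 < s \<Longrightarrow> s < v \<Longrightarrow>
        m u v \<le> M * (kern \<beta> (u / s) * w s)) \<Longrightarrow>
      (\<And>u. u \<in> einterval 0 T \<Longrightarrow> ennreal (w' u) * h u \<le> (SUP v\<in>einterval 0 T. ennreal (m u v) * g v)) \<Longrightarrow>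
      wnorm q (einterval 0 T) w' h \<le> ennreal (K * M) * wnorm q (einterval 0 T) w g"
proof -
  obtain K where K: "0 < K"
    "\<And>A F \<Phi>. A \<in> sets borel \<Longrightarrow> A \<subseteq> {0<..} \<Longrightarrow>
      F \<in> borel_measurable (lebesgue_on A) \<Longrightarrow> \<Phi> \<in> borel_measurable (lebesgue_on A) \<Longrightarrow>
      (\<And>u. u \<in> A \<Longrightarrow> \<Phi> u \<le> Lnorm q A (\<lambda>s. ennreal (s powr (- rcp q) * kern \<beta> (u / s)) * F s)) \<Longrightarrow>
      Lnorm q A (\<lambda>u. ennreal (u powr (- rcp q)) * \<Phi> u)
        \<le> ennreal K * Lnorm q A (\<lambda>s. ennreal (s powr (- rcp q)) * F s)"
    using Lnorm_kern_convolution[OF assms] by blast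
  \<comment> \<open>The norm of the constant 1 on (v/2, v) with respect to ds/s, the same for every
    v. Dividing by it turns a lower bound on that interval into a bound for the value at v.\<close>
  define l where "l = ln 2 powr rcp q"
  have l: "0 < l" unfolding l_def by simp
  show ?thesis
  proof (rule that[of "K / l"])
    show "0 < K / l" using K l by simp
    fix T and g h :: "real \<Rightarrow> ennreal" and w w' m and M :: real
    assume g: "antimono_on (einterval 0 T) g"
      and w [measurable]: "w \<in> borel_measurable (lebesgue_on (einterval 0 T))"
      and w' [measurable]: "w' \<in> borel_measurable (lebesgue_on (einterval 0 T))"
      and h [measurable]: "h \<in> borel_measurable (lebesgue_on (einterval 0 T))"
      and pos: "\<And>u. u \<in> einterval 0 T \<Longrightarrow> 0 \<le> w u" "\<And>u. u \<in> einterval 0 T \<Longrightarrow> 0 \<le> w' u" "0 \<le> M"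
      and m: "\<And>u v s. u \<in> einterval 0 T \<Longrightarrow> v \<in> einterval 0 T \<Longrightarrow> v / 2 < s \<Longrightarrow> s < v \<Longrightarrow>
        m u v \<le> M * (kern \<beta> (u / s) * w s)"
      and sup: "\<And>u. u \<in> einterval 0 T \<Longrightarrow>
        ennreal (w' u) * h u \<le> (SUP v\<in>einterval 0 T. ennreal (m u v) * g v)"
    let ?A = "einterval 0 T"
    have [measurable]: "g \<in> borel_measurable (lebesgue_on ?A)"
      using g is_interval_einterval by (rule borel_measurable_antimono_on)
    define F where "F = (\<lambda>s. ennreal (M / l) * (ennreal (w s) * g s))"
    have [measurable]: "F \<in> borel_measurable (lebesgue_on ?A)" unfolding F_def by measurable
    have A: "?A \<in> sets borel" "?A \<subseteq> {0<..}" by (auto simp: einterval_iff)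
    have "ennreal (w' u) * h u \<le> Lnorm q ?A (\<lambda>s. ennreal (s powr (- rcp q) * kern \<beta> (u / s)) * F s)"
      if u: "u \<in> ?A" for u
    proof -
      have "ennreal (m u v) * g v \<le> Lnorm q ?A (\<lambda>s. ennreal (s powr (- rcp q) * kern \<beta> (u / s)) * F s)"
        if v: "v \<in> ?A" for v
      proof -
        have v0: "0 < v" using v A by auto
        have sub: "{v / 2<..<v} \<subseteq> ?A"
        proof
          fix s assume "s \<in> {v / 2<..<v}"
          then have "0 < s" "ereal s < ereal v" using v0 by auto
          moreover from this(2) have "ereal s < T"
            by (rule less_trans) (use v in \<open>simp add: einterval_iff\<close>)
          ultimately show "s \<in> ?A" by (simp add: einterval_iff)
        qed
        have "ennreal (m u v) * g v = ennreal l * (ennreal (1 / l) * (ennreal (m u v) * g v))"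
          using l by (simp add: mult.assoc[symmetric] ennreal_mult[symmetric])
        also have "\<dots> = ennreal (ln (v / (v / 2)) powr rcp q) * (ennreal (1 / l) * (ennreal (m u v) * g v))"
          using v0 by (simp add: l_def)
        also have "\<dots> \<le> Lnorm q ?A (\<lambda>s. ennreal (s powr (- rcp q)) * (ennreal (kern \<beta> (u / s)) * F s))"
        proof (rule Lnorm_ge_const[OF assms(1)])
          fix s assume s: "s \<in> {v / 2<..<v}"
          then have sA: "s \<in> ?A" using sub by auto
          have "ennreal (1 / l) * (ennreal (m u v) * g v)
              \<le> ennreal (1 / l) * (ennreal (M * (kern \<beta> (u / s) * w s)) * g s)"
            using s u v sA monotone_onD[OF g sA v]
            by (intro mult_left_mono mult_mono ennreal_leI m) auto
          also have "\<dots> = ennreal (kern \<beta> (u / s)) * F s"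
            using pos sA l by (simp add: F_def ennreal_mult divide_inverse mult_ac)
          finally show "ennreal (1 / l) * (ennreal (m u v) * g v) \<le> ennreal (kern \<beta> (u / s)) * F s" .
        qed (use v0 sub in auto)
        also have "\<dots> = Lnorm q ?A (\<lambda>s. ennreal (s powr (- rcp q) * kern \<beta> (u / s)) * F s)"
          by (simp add: ennreal_mult mult.assoc)
        finally show ?thesis .
      qed
      then have "(SUP v\<in>?A. ennreal (m u v) * g v)
          \<le> Lnorm q ?A (\<lambda>s. ennreal (s powr (- rcp q) * kern \<beta> (u / s)) * F s)"
        by (rule SUP_least)
      then show ?thesis using sup[OF u] by (rule order_trans[rotated])
    qed
    then have "Lnorm q ?A (\<lambda>u. ennreal (u powr (- rcp q)) * (ennreal (w' u) * h u))
        \<le> ennreal K * Lnorm q ?A (\<lambda>s. ennreal (s powr (- rcp q)) * F s)"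
      by (intro K(2)[OF A]) auto
    also have "Lnorm q ?A (\<lambda>u. ennreal (u powr (- rcp q)) * (ennreal (w' u) * h u)) = wnorm q ?A w' h"
      unfolding wnorm_def using pos by (intro Lnorm_cong) (simp add: ennreal_mult mult_ac)
    also have "Lnorm q ?A (\<lambda>s. ennreal (s powr (- rcp q)) * F s)
        = Lnorm q ?A (\<lambda>s. ennreal (M / l) * (ennreal (s powr (- rcp q) * w s) * g s))"
      unfolding F_def using pos by (intro Lnorm_cong) (simp add: ennreal_mult mult_ac)
    also have "\<dots> = ennreal (M / l) * wnorm q ?A w g"
      unfolding wnorm_def by (rule Lnorm_cmult[OF assms(1)]) measurable
    finally show "wnorm q ?A w' h \<le> ennreal (K / l * M) * wnorm q ?A w g"
      using K l pos by (simp add: mult.assoc[symmetric] ennreal_mult[symmetric])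
  qed
qed

section \<open>Hardy-type inequalities\<close>

lemma einterval_0_mem: "t \<in> einterval 0 L \<longleftrightarrow> 0 < t \<and> ereal t < L"
  by (simp add: einterval_iff)

lemma einterval_0_ereal: "einterval 0 (ereal t) = {0<..<t}"
  by (simp add: zero_ereal_def)

lemma einterval_0_down: "t \<in> einterval 0 L \<Longrightarrow> 0 < s \<Longrightarrow> s \<le> t \<Longrightarrow> s \<in> einterval 0 L"
  by (auto simp: einterval_iff intro: le_less_trans[of "ereal s" "ereal t"])

lemma Ioo_subset_einterval_0: "t \<in> einterval 0 L \<Longrightarrow> 0 \<le> s \<Longrightarrow> {s<..<t} \<subseteq> einterval 0 L"
  by (auto intro: einterval_0_down)

text \<open>Beyond 1 the kernel decays instead of growing, which on (1, 2] costs at most x powr (2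
  \<epsilon>) \<le> 4 powr \<epsilon>. The case arises because a point s of (v/2, v) may lie below u
  even if \<open>u \<le> v\<close>, though only by a factor less than 2.\<close>

lemma powr_le_kern:
  assumes "0 < \<epsilon>" "0 < x" "x \<le> 2"
  shows "x powr \<epsilon> \<le> 4 powr \<epsilon> * kern \<epsilon> x"
proof (cases "x \<le> 1")
  case True
  then show ?thesis using assms ge_one_powr_ge_zero[of 4 \<epsilon>] by (simp add: kern_eq_powr)
next
  case False
  have "x powr \<epsilon> * x powr \<epsilon> = (x * x) powr \<epsilon>"
    by (simp add: powr_mult)
  also have "\<dots> \<le> (2 * 2) powr \<epsilon>"
    using assms by (intro powr_mono2 mult_mono) auto
  finally show ?thesis
    using False assms by (simp add: kern_eq_powr_minus powr_minus_divide field_simps)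
qed

text \<open>By the kernel bound, the slowly varying factor grows at most like the power \<epsilon>,
  up to a constant.\<close>

lemma powr_times_SV_up:
  assumes "c \<in> SV L" "0 < \<epsilon>"
  obtains C where "0 < C"
    "\<And>s u. s \<in> einterval 0 L \<Longrightarrow> u \<in> einterval 0 L \<Longrightarrow> s \<le> u \<Longrightarrow>
      u powr \<rho> * c u \<le> C * (u / s) powr (\<rho> + \<epsilon>) * (s powr \<rho> * c s)"
proof -
  obtain C where C: "0 < C"
    "\<And>s t. s \<in> einterval 0 L \<Longrightarrow> t \<in> einterval 0 L \<Longrightarrow> kern \<epsilon> (t / s) * c t \<le> C * c s"
    using SV_kern[OF assms] by blast
  show ?thesis
  proof (rule that[OF C(1)])
    fix s u assume su: "s \<in> einterval 0 L" "u \<in> einterval 0 L" "s \<le> u"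
    then have pos: "0 < s" "0 < u" by (auto simp: einterval_0_mem)
    have "(u / s) powr (- \<epsilon>) * c u \<le> C * c s"
      using C(2)[OF su(1,2)] pos su(3) assms(2) by (simp add: kern_eq_powr_minus)
    then have "c u \<le> C * (u / s) powr \<epsilon> * c s"
      using pos by (simp add: powr_minus_divide field_simps)
    then have "u powr \<rho> * c u \<le> u powr \<rho> * (C * (u / s) powr \<epsilon> * c s)"
      by (intro mult_left_mono) auto
    also have "\<dots> = C * (u / s) powr (\<rho> + \<epsilon>) * (s powr \<rho> * c s)"
      using pos by (simp add: powr_add powr_divide)
    finally show "u powr \<rho> * c u \<le> C * (u / s) powr (\<rho> + \<epsilon>) * (s powr \<rho> * c s)" .
  qed
qed

text \<open>Towards smaller arguments the slowly varying factor lowers the exponent by \<epsilon>.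
  The range reaches up to \<open>2 * s\<close> in order to cover points s of (v/2, v) with
  \<open>u \<le> v\<close>.\<close>

lemma powr_times_SV_down:
  assumes "c \<in> SV L" "0 < \<epsilon>"
  obtains C where "0 < C"
    "\<And>s u. s \<in> einterval 0 L \<Longrightarrow> u \<in> einterval 0 L \<Longrightarrow> u \<le> 2 * s \<Longrightarrow>
      u powr \<rho> * c u \<le> C * (u / s) powr (\<rho> - \<epsilon>) * (s powr \<rho> * c s)"
proof -
  obtain C where C: "0 < C"
    "\<And>s t. s \<in> einterval 0 L \<Longrightarrow> t \<in> einterval 0 L \<Longrightarrow> kern \<epsilon> (t / s) * c t \<le> C * c s"
    using SV_kern[OF assms] by blast
  show ?thesis
  proof (rule that[of "4 powr \<epsilon> * C"])
    fix s u assume su: "s \<in> einterval 0 L" "u \<in> einterval 0 L" "u \<le> 2 * s"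
    then have pos: "0 < s" "0 < u" by (auto simp: einterval_0_mem)
    have k: "(u / s) powr \<epsilon> \<le> 4 powr \<epsilon> * kern \<epsilon> (u / s)"
      using su pos assms(2) by (intro powr_le_kern) (auto simp: field_simps)
    have cs: "0 < c s" "0 < c u" using SV_pos[OF assms(1)] su by auto
    have "(u / s) powr \<epsilon> * c u \<le> 4 powr \<epsilon> * (kern \<epsilon> (u / s) * c u)"
      using mult_right_mono[OF k, of "c u"] cs by (simp add: mult.assoc)
    also have "\<dots> \<le> 4 powr \<epsilon> * (C * c s)"
      using C(2)[OF su(1,2)] by (intro mult_left_mono) auto
    finally have "(u / s) powr \<epsilon> * c u \<le> 4 powr \<epsilon> * (C * c s)" .
    then have "(u / s) powr (\<rho> - \<epsilon>) * ((u / s) powr \<epsilon> * c u)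
        \<le> (u / s) powr (\<rho> - \<epsilon>) * (4 powr \<epsilon> * (C * c s))"
      by (intro mult_left_mono) auto
    then have "(u / s) powr \<rho> * c u \<le> (u / s) powr (\<rho> - \<epsilon>) * (4 powr \<epsilon> * (C * c s))"
      by (simp add: mult.assoc[symmetric] powr_add[symmetric])
    then have "s powr \<rho> * ((u / s) powr \<rho> * c u) \<le> s powr \<rho> * ((u / s) powr (\<rho> - \<epsilon>) * (4 powr \<epsilon> * (C * c s)))"
      by (intro mult_left_mono) auto
    then show "u powr \<rho> * c u \<le> 4 powr \<epsilon> * C * (u / s) powr (\<rho> - \<epsilon>) * (s powr \<rho> * c s)"
      using pos by (simp add: powr_divide[of u s \<rho>] mult_ac)
  qed (use C in auto)
qed

lemma SUP_cmult_le:
  fixes c :: ennreal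
  assumes "\<And>v. v \<in> V \<Longrightarrow> v \<in> A \<and> c * f v \<le> g v"
  shows "c * (SUP v\<in>V. f v) \<le> (SUP v\<in>A. g v)"
  unfolding SUP_mult_left_ennreal using assms by (intro SUP_mono) auto

lemma powr_times_SV_measurable:
  "c \<in> SV L \<Longrightarrow> (\<lambda>u. u powr \<rho> * c u) \<in> borel_measurable (lebesgue_on (einterval 0 L))"
proof -
  assume "c \<in> SV L"
  then have [measurable]: "c \<in> borel_measurable (lebesgue_on (einterval 0 L))" by (rule SV_measurable)
  show ?thesis by measurable
qed

lemma einterval_0_mono: "T \<le> L \<Longrightarrow> einterval 0 T \<subseteq> einterval 0 L"
  by (auto simp: einterval_iff)

text \<open>The gap between \<rho> and \<alpha> is halved: one \<epsilon> absorbs the slowly varying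
  factor, the other remains as the decay (u / s) powr (- \<epsilon>) of the kernel. The constant
  does not depend on \<open>T\<close>, so the inequality is available on all intervals (0, t) at
  once.\<close>

lemma wnorm_sup_below:
  assumes "0 < q" "c \<in> SV L" "\<rho> < \<alpha>" "0 < \<alpha>"
  obtains K :: real where "0 < K"
    "\<And>T g h. T \<le> L \<Longrightarrow> antimono_on (einterval 0 T) g \<Longrightarrow>
      h \<in> borel_measurable (lebesgue_on (einterval 0 T)) \<Longrightarrow>
      (\<And>u. u \<in> einterval 0 T \<Longrightarrow> h u \<le> (SUP v\<in>{0<..<u}. ennreal ((v / u) powr \<alpha>) * g v)) \<Longrightarrow>
      wnorm q (einterval 0 T) (\<lambda>u. u powr \<rho> * c u) h
        \<le> ennreal K * wnorm q (einterval 0 T) (\<lambda>u. u powr \<rho> * c u) g"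
proof -
  define \<epsilon> where "\<epsilon> = (\<alpha> - \<rho>) / 2"
  have e: "0 < \<epsilon>" using assms by (simp add: \<epsilon>_def)
  obtain K where K: "0 < K" "\<And>T g w w' m h M. antimono_on (einterval 0 T) g \<Longrightarrow>
      w \<in> borel_measurable (lebesgue_on (einterval 0 T)) \<Longrightarrow>
      w' \<in> borel_measurable (lebesgue_on (einterval 0 T)) \<Longrightarrow>
      h \<in> borel_measurable (lebesgue_on (einterval 0 T)) \<Longrightarrow>
      (\<And>u. u \<in> einterval 0 T \<Longrightarrow> 0 \<le> w u) \<Longrightarrow> (\<And>u. u \<in> einterval 0 T \<Longrightarrow> 0 \<le> w' u) \<Longrightarrow> 0 \<le> M \<Longrightarrow>
      (\<And>u v s. u \<in> einterval 0 T \<Longrightarrow> v \<in> einterval 0 T \<Longrightarrow> v / 2 < s \<Longrightarrow> s < v \<Longrightarrow>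
        m u v \<le> M * (kern \<epsilon> (u / s) * w s)) \<Longrightarrow>
      (\<And>u. u \<in> einterval 0 T \<Longrightarrow> ennreal (w' u) * h u \<le> (SUP v\<in>einterval 0 T. ennreal (m u v) * g v)) \<Longrightarrow>
      wnorm q (einterval 0 T) w' h \<le> ennreal (K * M) * wnorm q (einterval 0 T) w g"
    using wnorm_sup_le[OF assms(1) e] by blast
  obtain C where C: "0 < C"
    "\<And>s u. s \<in> einterval 0 L \<Longrightarrow> u \<in> einterval 0 L \<Longrightarrow> s \<le> u \<Longrightarrow>
      u powr \<rho> * c u \<le> C * (u / s) powr (\<rho> + \<epsilon>) * (s powr \<rho> * c s)"
    using powr_times_SV_up[OF assms(2) e] by blast
  let ?w = "\<lambda>u. u powr \<rho> * c u"
  \<comment> \<open>Extended by 0 to \<open>v \<ge> u\<close>, so that the supremum may run over the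
    whole interval.\<close>
  define m where "m = (\<lambda>u v. if v < u then ?w u * (v / u) powr \<alpha> else 0)"
  show ?thesis
  proof (rule that[of "K * (C * 2 powr \<alpha>)"])
    show "0 < K * (C * 2 powr \<alpha>)" using K C by simp
    fix T and g h :: "real \<Rightarrow> ennreal"
    assume T: "T \<le> L" and g: "antimono_on (einterval 0 T) g"
      and h: "h \<in> borel_measurable (lebesgue_on (einterval 0 T))"
      and le: "\<And>u. u \<in> einterval 0 T \<Longrightarrow> h u \<le> (SUP v\<in>{0<..<u}. ennreal ((v / u) powr \<alpha>) * g v)"
    have TL: "u \<in> einterval 0 L" if "u \<in> einterval 0 T" for u
      using einterval_0_mono[OF T] that by auto
    have w: "?w \<in> borel_measurable (lebesgue_on (einterval 0 T))"
      using measurable_lebesgue_on_subset[OF powr_times_SV_measurable[OF assms(2)] einterval_0_mono[OF T]] .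
    have wpos: "0 \<le> ?w u" if "u \<in> einterval 0 T" for u
      using SV_pos[OF assms(2) TL[OF that]] by simp
    show "wnorm q (einterval 0 T) ?w h \<le> ennreal (K * (C * 2 powr \<alpha>)) * wnorm q (einterval 0 T) ?w g"
    proof (rule K(2)[OF g w w h wpos wpos, of _ m])
      show "0 \<le> C * 2 powr \<alpha>" using C by simp
      fix u v s assume uvs: "u \<in> einterval 0 T" "v \<in> einterval 0 T" "v / 2 < s" "s < v"
      then have pos: "0 < u" "0 < v" "0 < s" by (auto simp: einterval_0_mem)
      have sT: "s \<in> einterval 0 T" using uvs pos by (auto intro: einterval_0_down)
      show "m u v \<le> C * 2 powr \<alpha> * (kern \<epsilon> (u / s) * ?w s)"
      proof (cases "v < u")
        case True
        have "m u v = ?w u * (v / u) powr \<alpha>" using True by (simp add: m_def)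
        \<comment> \<open>On the interval in question v is less than 2 s, whence the factor 2 powr
          \<alpha>.\<close>
        also have "\<dots> \<le> (C * (u / s) powr (\<rho> + \<epsilon>) * ?w s) * (2 * (s / u)) powr \<alpha>"
          using uvs pos True C(1) assms(4) SV_pos[OF assms(2) TL[OF sT]]
          by (intro mult_mono[OF C(2)[OF TL[OF sT] TL[OF uvs(1)]] powr_mono2]) (auto simp: field_simps)
        also have "(2 * (s / u)) powr \<alpha> = 2 powr \<alpha> * (u / s) powr (- \<alpha>)"
          using pos by (simp add: powr_mult powr_divide powr_minus_divide)
        also have "(C * (u / s) powr (\<rho> + \<epsilon>) * ?w s) * (2 powr \<alpha> * (u / s) powr (- \<alpha>))
            = C * 2 powr \<alpha> * ((u / s) powr (\<rho> + \<epsilon> - \<alpha>) * ?w s)"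
          by (simp add: diff_conv_add_uminus powr_add del: add_uminus_conv_diff)
        also have "\<rho> + \<epsilon> - \<alpha> = - \<epsilon>" by (simp add: \<epsilon>_def field_simps)
        also have "(u / s) powr (- \<epsilon>) = kern \<epsilon> (u / s)"
          using pos True uvs e by (simp add: kern_eq_powr_minus)
        finally show ?thesis .
      next
        case False
        then show ?thesis using wpos[OF sT] C(1) by (simp add: m_def)
      qed
    next
      fix u assume u: "u \<in> einterval 0 T"
      have "ennreal (?w u) * h u \<le> ennreal (?w u) * (SUP v\<in>{0<..<u}. ennreal ((v / u) powr \<alpha>) * g v)"
        using le[OF u] by (intro mult_left_mono) auto
      also have "\<dots> \<le> (SUP v\<in>einterval 0 T. ennreal (m u v) * g v)"
      proof (rule SUP_cmult_le)
        fix v assume "v \<in> {0<..<u}"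
        then show "v \<in> einterval 0 T \<and> ennreal (?w u) * (ennreal ((v / u) powr \<alpha>) * g v) \<le> ennreal (m u v) * g v"
          using u wpos[OF u] by (auto simp: m_def ennreal_mult[symmetric] mult.assoc[symmetric] intro: einterval_0_down)
      qed
      finally show "ennreal (?w u) * h u \<le> (SUP v\<in>einterval 0 T. ennreal (m u v) * g v)" .
    qed auto
  qed
qed

text \<open>Half of \<rho> - \<alpha> is again spent on \<open>c\<close>; the other half leaves (u /
  s) powr \<epsilon>. Because s may be slightly below u, this power is not yet the kernel, and
  \<open>powr_le_kern\<close> makes the comparison.\<close>

lemma wnorm_sup_above:
  assumes "0 < q" "c \<in> SV L" "\<alpha> < \<rho>" "0 < \<alpha>"
  obtains K :: real where "0 < K"
    "\<And>T g h. T \<le> L \<Longrightarrow> antimono_on (einterval 0 T) g \<Longrightarrow>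
      h \<in> borel_measurable (lebesgue_on (einterval 0 T)) \<Longrightarrow>
      (\<And>u. u \<in> einterval 0 T \<Longrightarrow> h u \<le> (SUP v\<in>einterval 0 T \<inter> {u..}. ennreal ((v / u) powr \<alpha>) * g v)) \<Longrightarrow>
      wnorm q (einterval 0 T) (\<lambda>u. u powr \<rho> * c u) h
        \<le> ennreal K * wnorm q (einterval 0 T) (\<lambda>u. u powr \<rho> * c u) g"
proof -
  define \<epsilon> where "\<epsilon> = (\<rho> - \<alpha>) / 2"
  have e: "0 < \<epsilon>" using assms by (simp add: \<epsilon>_def)
  obtain K where K: "0 < K" "\<And>T g w w' m h M. antimono_on (einterval 0 T) g \<Longrightarrow>
      w \<in> borel_measurable (lebesgue_on (einterval 0 T)) \<Longrightarrow>
      w' \<in> borel_measurable (lebesgue_on (einterval 0 T)) \<Longrightarrow>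
      h \<in> borel_measurable (lebesgue_on (einterval 0 T)) \<Longrightarrow>
      (\<And>u. u \<in> einterval 0 T \<Longrightarrow> 0 \<le> w u) \<Longrightarrow> (\<And>u. u \<in> einterval 0 T \<Longrightarrow> 0 \<le> w' u) \<Longrightarrow> 0 \<le> M \<Longrightarrow>
      (\<And>u v s. u \<in> einterval 0 T \<Longrightarrow> v \<in> einterval 0 T \<Longrightarrow> v / 2 < s \<Longrightarrow> s < v \<Longrightarrow>
        m u v \<le> M * (kern \<epsilon> (u / s) * w s)) \<Longrightarrow>
      (\<And>u. u \<in> einterval 0 T \<Longrightarrow> ennreal (w' u) * h u \<le> (SUP v\<in>einterval 0 T. ennreal (m u v) * g v)) \<Longrightarrow>
      wnorm q (einterval 0 T) w' h \<le> ennreal (K * M) * wnorm q (einterval 0 T) w g"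
    using wnorm_sup_le[OF assms(1) e] by blast
  obtain C where C: "0 < C"
    "\<And>s u. s \<in> einterval 0 L \<Longrightarrow> u \<in> einterval 0 L \<Longrightarrow> u \<le> 2 * s \<Longrightarrow>
      u powr \<rho> * c u \<le> C * (u / s) powr (\<rho> - \<epsilon>) * (s powr \<rho> * c s)"
    using powr_times_SV_down[OF assms(2) e] by blast
  let ?w = "\<lambda>u. u powr \<rho> * c u"
  define m where "m = (\<lambda>u v. if u \<le> v then ?w u * (v / u) powr \<alpha> else 0)"
  show ?thesis
  proof (rule that[of "K * (C * 2 powr \<alpha> * 4 powr \<epsilon>)"])
    show "0 < K * (C * 2 powr \<alpha> * 4 powr \<epsilon>)" using K C by simp
    fix T and g h :: "real \<Rightarrow> ennreal"
    assume T: "T \<le> L" and g: "antimono_on (einterval 0 T) g"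
      and h: "h \<in> borel_measurable (lebesgue_on (einterval 0 T))"
      and le: "\<And>u. u \<in> einterval 0 T \<Longrightarrow>
        h u \<le> (SUP v\<in>einterval 0 T \<inter> {u..}. ennreal ((v / u) powr \<alpha>) * g v)"
    have TL: "u \<in> einterval 0 L" if "u \<in> einterval 0 T" for u
      using einterval_0_mono[OF T] that by auto
    have w: "?w \<in> borel_measurable (lebesgue_on (einterval 0 T))"
      using measurable_lebesgue_on_subset[OF powr_times_SV_measurable[OF assms(2)] einterval_0_mono[OF T]] .
    have wpos: "0 \<le> ?w u" if "u \<in> einterval 0 T" for u
      using SV_pos[OF assms(2) TL[OF that]] by simp
    show "wnorm q (einterval 0 T) ?w h
        \<le> ennreal (K * (C * 2 powr \<alpha> * 4 powr \<epsilon>)) * wnorm q (einterval 0 T) ?w g"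
    proof (rule K(2)[OF g w w h wpos wpos, of _ m])
      show "0 \<le> C * 2 powr \<alpha> * 4 powr \<epsilon>" using C by simp
      fix u v s assume uvs: "u \<in> einterval 0 T" "v \<in> einterval 0 T" "v / 2 < s" "s < v"
      then have pos: "0 < u" "0 < v" "0 < s" by (auto simp: einterval_0_mem)
      have sT: "s \<in> einterval 0 T" using uvs pos by (auto intro: einterval_0_down)
      show "m u v \<le> C * 2 powr \<alpha> * 4 powr \<epsilon> * (kern \<epsilon> (u / s) * ?w s)"
      proof (cases "u \<le> v")
        case True
        have k: "(u / s) powr \<epsilon> \<le> 4 powr \<epsilon> * kern \<epsilon> (u / s)"
          using uvs True pos e by (intro powr_le_kern) (auto simp: field_simps)
        have "m u v = ?w u * (v / u) powr \<alpha>" using True by (simp add: m_def)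
        also have "\<dots> \<le> (C * (u / s) powr (\<rho> - \<epsilon>) * ?w s) * (2 * (s / u)) powr \<alpha>"
          using uvs pos True C(1) assms(4) SV_pos[OF assms(2) TL[OF sT]]
          by (intro mult_mono[OF C(2)[OF TL[OF sT] TL[OF uvs(1)]] powr_mono2]) (auto simp: field_simps)
        also have "(2 * (s / u)) powr \<alpha> = 2 powr \<alpha> * (u / s) powr (- \<alpha>)"
          using pos by (simp add: powr_mult powr_divide powr_minus_divide)
        also have "(C * (u / s) powr (\<rho> - \<epsilon>) * ?w s) * (2 powr \<alpha> * (u / s) powr (- \<alpha>))
            = C * 2 powr \<alpha> * ?w s * (u / s) powr (\<rho> - \<epsilon> - \<alpha>)"
          by (simp add: diff_conv_add_uminus powr_add del: add_uminus_conv_diff)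
        also have "\<rho> - \<epsilon> - \<alpha> = \<epsilon>" by (simp add: \<epsilon>_def field_simps)
        also have "C * 2 powr \<alpha> * ?w s * (u / s) powr \<epsilon>
            \<le> C * 2 powr \<alpha> * ?w s * (4 powr \<epsilon> * kern \<epsilon> (u / s))"
          using k C(1) wpos[OF sT] by (intro mult_left_mono) auto
        finally show ?thesis by (simp add: mult_ac)
      next
        case False
        then show ?thesis using wpos[OF sT] C(1) by (simp add: m_def)
      qed
    next
      fix u assume u: "u \<in> einterval 0 T"
      have "ennreal (?w u) * h u
          \<le> ennreal (?w u) * (SUP v\<in>einterval 0 T \<inter> {u..}. ennreal ((v / u) powr \<alpha>) * g v)"
        using le[OF u] by (intro mult_left_mono) auto
      also have "\<dots> \<le> (SUP v\<in>einterval 0 T. ennreal (m u v) * g v)"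
      proof (rule SUP_cmult_le)
        fix v assume "v \<in> einterval 0 T \<inter> {u..}"
        then show "v \<in> einterval 0 T \<and> ennreal (?w u) * (ennreal ((v / u) powr \<alpha>) * g v) \<le> ennreal (m u v) * g v"
          using u wpos[OF u] by (auto simp: m_def ennreal_mult[symmetric] mult.assoc[symmetric])
      qed
      finally show "ennreal (?w u) * h u \<le> (SUP v\<in>einterval 0 T. ennreal (m u v) * g v)" .
    qed auto
  qed
qed

section \<open>The upper averaging operator\<close>

text \<open>Half of \<rho> absorbs the slowly varying factor, and the remaining (u / t) powr (\<rho>
  / 2) has a norm on (0, t) that is bounded independently of t. Thus the weight is governed by its
  value at the right end point.\<close>

lemma wnorm_powr_times_SV_le:
  assumes "0 < q" "c \<in> SV L" "0 < \<rho>"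
  obtains K :: real where "0 < K"
    "\<And>t. t \<in> einterval 0 L \<Longrightarrow>
      wnorm q {0<..<t} (\<lambda>u. u powr \<rho> * c u) (\<lambda>_. 1) \<le> ennreal (K * (t powr \<rho> * c t))"
proof -
  define \<epsilon> where "\<epsilon> = \<rho> / 2"
  have e: "0 < \<epsilon>" using assms by (simp add: \<epsilon>_def)
  obtain C where C: "0 < C"
    "\<And>s u. s \<in> einterval 0 L \<Longrightarrow> u \<in> einterval 0 L \<Longrightarrow> u \<le> 2 * s \<Longrightarrow>
      u powr \<rho> * c u \<le> C * (u / s) powr (\<rho> - \<epsilon>) * (s powr \<rho> * c s)"
    using powr_times_SV_down[OF assms(2) e] by blast
  obtain K where K: "0 < K" "\<And>A s. A \<in> sets borel \<Longrightarrow> A \<subseteq> {0<..} \<Longrightarrow> 0 < s \<Longrightarrow>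
      Lnorm q A (\<lambda>u. ennreal (u powr (- rcp q) * kern \<epsilon> (u / s))) \<le> ennreal K"
    using Lnorm_kern[OF assms(1) e] by blast
  show ?thesis
  proof (rule that[of "K * C"])
    show "0 < K * C" using K C by simp
    fix t assume t: "t \<in> einterval 0 L"
    then have t0: "0 < t" by (simp add: einterval_0_mem)
    let ?w = "\<lambda>u. u powr \<rho> * c u"
    have wt: "0 < ?w t" using SV_pos[OF assms(2) t] t0 by simp
    have [measurable]: "?w \<in> borel_measurable (lebesgue_on {0<..<t})"
      using measurable_lebesgue_on_subset[OF powr_times_SV_measurable[OF assms(2)] Ioo_subset_einterval_0[OF t]] by simp
    have "wnorm q {0<..<t} ?w (\<lambda>_. 1)
        \<le> Lnorm q {0<..<t} (\<lambda>u. ennreal (C * ?w t) * ennreal (u powr (- rcp q) * kern \<epsilon> (u / t)))"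
      unfolding wnorm_def
    proof (rule Lnorm_mono[OF assms(1)])
      fix u assume u: "u \<in> {0<..<t}"
      have "?w u \<le> C * (u / t) powr (\<rho> - \<epsilon>) * ?w t"
        using u t by (intro C(2)) (auto intro: einterval_0_down)
      also have "\<rho> - \<epsilon> = \<epsilon>" by (simp add: \<epsilon>_def)
      also have "(u / t) powr \<epsilon> = kern \<epsilon> (u / t)"
        using u e by (simp add: kern_eq_powr)
      finally have "u powr (- rcp q) * ?w u \<le> u powr (- rcp q) * (C * kern \<epsilon> (u / t) * ?w t)"
        by (intro mult_left_mono) auto
      then show "ennreal (u powr (- rcp q) * ?w u) * 1
          \<le> ennreal (C * ?w t) * ennreal (u powr (- rcp q) * kern \<epsilon> (u / t))"
        using C wt by (simp add: ennreal_mult[symmetric] ennreal_leI mult_ac)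
    qed measurable
    also have "\<dots> = ennreal (C * ?w t) * Lnorm q {0<..<t} (\<lambda>u. ennreal (u powr (- rcp q) * kern \<epsilon> (u / t)))"
      by (rule Lnorm_cmult[OF assms(1)]) measurable
    also have "\<dots> \<le> ennreal (C * ?w t) * ennreal K"
      using t0 by (intro mult_left_mono K(2)) auto
    also have "\<dots> = ennreal (K * C * ?w t)"
      using C K wt by (simp add: ennreal_mult[symmetric] mult_ac)
    finally show "wnorm q {0<..<t} ?w (\<lambda>_. 1) \<le> ennreal (K * C * ?w t)" .
  qed
qed

text \<open>On (t/2, t) a non-increasing \<open>g\<close> is at least \<open>g t\<close>, and the
  weight there is at least a multiple of its value at t. The estimate leads from pointwise values
  back to inner norms.\<close>

lemma pointwise_le_wnorm:
  assumes "0 < q" "c \<in> SV L" "0 \<le> \<rho>"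
  obtains K :: real where "0 < K"
    "\<And>t g. t \<in> einterval 0 L \<Longrightarrow> antimono_on (einterval 0 L) g \<Longrightarrow>
      ennreal (t powr \<rho> * c t) * g t \<le> ennreal K * wnorm q {0<..<t} (\<lambda>u. u powr \<rho> * c u) g"
proof -
  \<comment> \<open>The loss 1 in the exponent is arbitrary: only points within a factor of 2 of
    each other are compared.\<close>
  obtain C where C: "0 < C"
    "\<And>s u. s \<in> einterval 0 L \<Longrightarrow> u \<in> einterval 0 L \<Longrightarrow> s \<le> u \<Longrightarrow>
      u powr \<rho> * c u \<le> C * (u / s) powr (\<rho> + 1) * (s powr \<rho> * c s)"
    using powr_times_SV_up[OF assms(2), of 1] by auto
  define l where "l = ln 2 powr rcp q"
  have l: "0 < l" unfolding l_def by simp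
  define M where "M = C * 2 powr (\<rho> + 1)"
  have M: "0 < M" using C by (simp add: M_def)
  show ?thesis
  proof (rule that[of "M / l"])
    show "0 < M / l" using M l by simp
    fix t and g :: "real \<Rightarrow> ennreal" assume t: "t \<in> einterval 0 L" and g: "antimono_on (einterval 0 L) g"
    then have t0: "0 < t" by (simp add: einterval_0_mem)
    let ?w = "\<lambda>u. u powr \<rho> * c u"
    have sub: "{0<..<t} \<subseteq> einterval 0 L" using Ioo_subset_einterval_0[OF t] by simp
    have wt: "0 < ?w t" using SV_pos[OF assms(2) t] t0 by simp
    have [measurable]: "?w \<in> borel_measurable (lebesgue_on {0<..<t})"
      using measurable_lebesgue_on_subset[OF powr_times_SV_measurable[OF assms(2)] sub] .
    have [measurable]: "g \<in> borel_measurable (lebesgue_on {0<..<t})"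
      using measurable_lebesgue_on_subset[OF borel_measurable_antimono_on[OF g is_interval_einterval] sub] .
    have "ennreal (ln (t / (t / 2)) powr rcp q) * (ennreal (?w t / M) * g t) \<le> wnorm q {0<..<t} ?w g"
    proof (rule wnorm_ge_const[OF assms(1)])
      fix s assume s: "s \<in> {t / 2<..<t}"
      then have sL: "s \<in> einterval 0 L" "0 < s" using sub t0 by auto
      have "?w t \<le> C * (t / s) powr (\<rho> + 1) * ?w s"
        using s sL t by (intro C(2)) auto
      also have "\<dots> \<le> C * 2 powr (\<rho> + 1) * ?w s"
        using s sL t0 assms(3) C(1) SV_pos[OF assms(2) sL(1)]
        by (intro mult_right_mono mult_left_mono powr_mono2) (auto simp: field_simps)
      finally have "?w t / M \<le> ?w s" using M by (simp add: M_def field_simps)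
      then show "ennreal (?w t / M) * g t \<le> ennreal (?w s) * g s"
        using s monotone_onD[OF g sL(1) t] by (intro mult_mono ennreal_leI) auto
    qed (use t0 sub SV_pos[OF assms(2)] in \<open>auto simp: less_imp_le subset_iff\<close>)
    then have "ennreal l * (ennreal (?w t / M) * g t) \<le> wnorm q {0<..<t} ?w g"
      using t0 by (simp add: l_def)
    then have "ennreal (M / l) * (ennreal l * (ennreal (?w t / M) * g t)) \<le> ennreal (M / l) * wnorm q {0<..<t} ?w g"
      by (rule mult_left_mono) simp
    moreover have "ennreal (M / l) * (ennreal l * (ennreal (y / M) * z)) = ennreal y * z" if "0 < y" for y z
      using M l that by (simp add: mult.assoc[symmetric] ennreal_mult[symmetric])
    ultimately show "ennreal (?w t) * g t \<le> ennreal (M / l) * wnorm q {0<..<t} ?w g" using wt by metis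
  qed
qed

section \<open>Rearrangements, and the norms and averages written with respect to du/u\<close>

lemma rearr_antimono: "s \<le> t \<Longrightarrow> rearr L f t \<le> rearr L f s"
  unfolding rearr_def by (intro Inf_superset_mono image_mono Collect_mono) (auto intro: order_trans ennreal_leI)

lemma rearr_antimono_on: "antimono_on A (rearr L f)"
  by (intro monotone_onI rearr_antimono)

lemma rearr_measurable: "is_interval A \<Longrightarrow> rearr L f \<in> borel_measurable (lebesgue_on A)"
  by (rule borel_measurable_antimono_on[OF rearr_antimono_on])

lemma B_norm_eq_wnorm:
  "B_norm L p r b q a g =
    wnorm r (einterval 0 L) b (\<lambda>t. wnorm q {0<..<t} (\<lambda>u. u powr rcp p * a u) g)"
  unfolding B_norm_def wnorm_def
  by (simp add: diff_conv_add_uminus powr_add mult_ac del: add_uminus_conv_diff)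

lemma H_upper_eq_wnorm:
  "H_upper L U W f t = ennreal (t powr (- rcp U)) * wnorm W {0<..<t} (\<lambda>v. v powr rcp U) (rearr L f)"
  unfolding H_upper_def wnorm_def
  by (simp add: diff_conv_add_uminus powr_add mult_ac del: add_uminus_conv_diff)

lemma H_lower_eq_wnorm:
  "H_lower L V W f t =
    ennreal (t powr (- rcp V)) * wnorm W (einterval (ereal t) L) (\<lambda>v. v powr rcp V) (rearr L f)"
  unfolding H_lower_def wnorm_def
  by (simp add: diff_conv_add_uminus powr_add mult_ac del: add_uminus_conv_diff)

text \<open>The intervals (0, t) grow with t, so the norm is a monotone function of t.\<close>

lemma wnorm_Ioo_measurable:
  assumes "0 < q" "w \<in> borel_measurable (lebesgue_on (einterval 0 L))"
    "g \<in> borel_measurable (lebesgue_on (einterval 0 L))"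
  shows "(\<lambda>t. wnorm q {0<..<t} w g) \<in> borel_measurable (lebesgue_on (einterval 0 L))"
proof (rule borel_measurable_mono_on[OF mono_onI is_interval_einterval])
  fix s t assume st: "s \<in> einterval 0 L" "t \<in> einterval 0 L" "s \<le> t"
  have sub: "{0<..<t} \<subseteq> einterval 0 L" using Ioo_subset_einterval_0[OF st(2)] by simp
  show "wnorm q {0<..<s} w g \<le> wnorm q {0<..<t} w g"
    by (rule wnorm_subset[OF assms(1) assms(2,3)[THEN measurable_lebesgue_on_subset, OF sub]])
      (use st(3) in auto)
qed

lemma H_upper_measurable:
  assumes "0 < W"
  shows "H_upper L U W f \<in> borel_measurable (lebesgue_on (einterval 0 L))"
proof -
  have [measurable]: "(\<lambda>t. wnorm W {0<..<t} (\<lambda>v. v powr rcp U) (rearr L f)) \<in> borel_measurable (lebesgue_on (einterval 0 L))"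
    using assms rearr_measurable[OF is_interval_einterval] by (intro wnorm_Ioo_measurable) auto
  show ?thesis unfolding H_upper_eq_wnorm[abs_def] by measurable
qed

text \<open>The interval (t, L) shrinks and 1/V is nonnegative, so neither factor increases. Besides
  measurability, this allows \<open>H_lower\<close> itself to take the place of the non-increasing
  function in the supremum inequality.\<close>

lemma H_lower_antimono_on:
  assumes "0 < W" "0 < V"
  shows "antimono_on (einterval 0 T) (H_lower L V W f)"
proof (rule monotone_onI)
  fix s t assume st: "s \<in> einterval 0 T" "t \<in> einterval 0 T" "s \<le> t"
  have "wnorm W (einterval (ereal t) L) (\<lambda>v. v powr rcp V) (rearr L f)
      \<le> wnorm W (einterval (ereal s) L) (\<lambda>v. v powr rcp V) (rearr L f)"
    using assms st rearr_measurable[OF is_interval_einterval]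
    by (intro wnorm_subset) (auto simp: einterval_iff intro: le_less_trans[of "ereal s" "ereal t"])
  moreover have "t powr (- rcp V) \<le> s powr (- rcp V)"
    using st rcp_nonneg[OF assms(2)] by (intro powr_mono2') (auto simp: einterval_0_mem)
  ultimately show "H_lower L V W f s \<ge> H_lower L V W f t"
    unfolding H_lower_eq_wnorm by (intro mult_mono ennreal_leI) auto
qed

lemma B_norm_mono:
  assumes "0 < r" "0 < q" "a \<in> SV L" "b \<in> SV L" "0 \<le> K"
    and [measurable]: "g \<in> borel_measurable (lebesgue_on (einterval 0 L))"
      "h \<in> borel_measurable (lebesgue_on (einterval 0 L))"
    and le: "\<And>t. t \<in> einterval 0 L \<Longrightarrow> wnorm q {0<..<t} (\<lambda>u. u powr rcp p * a u) h
      \<le> ennreal K * wnorm q {0<..<t} (\<lambda>u. u powr rcp p * a u) g"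
  shows "B_norm L p r b q a h \<le> ennreal K * B_norm L p r b q a g"
proof -
  let ?I = "\<lambda>g t. wnorm q {0<..<t} (\<lambda>u. u powr rcp p * a u) g"
  have [measurable]: "b \<in> borel_measurable (lebesgue_on (einterval 0 L))"
    using assms by (intro SV_measurable)
  have [measurable]: "?I g \<in> borel_measurable (lebesgue_on (einterval 0 L))"
      "?I h \<in> borel_measurable (lebesgue_on (einterval 0 L))"
    using assms by (intro wnorm_Ioo_measurable powr_times_SV_measurable; simp)+
  have "B_norm L p r b q a h \<le> wnorm r (einterval 0 L) b (\<lambda>t. ennreal K * ?I g t)"
    unfolding B_norm_eq_wnorm using le SV_pos[OF assms(4)] assms(1)
    by (intro wnorm_mono mult_left_mono) (auto simp: less_imp_le)
  also have "\<dots> = ennreal K * B_norm L p r b q a g"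
    unfolding B_norm_eq_wnorm using assms(1) by (intro wnorm_cmult) auto
  finally show ?thesis .
qed

lemma B_norm_mono_fun:
  assumes "0 < r" "0 < q" "a \<in> SV L" "b \<in> SV L" "0 \<le> K"
    and g: "g \<in> borel_measurable (lebesgue_on (einterval 0 L))"
    and h: "h \<in> borel_measurable (lebesgue_on (einterval 0 L))"
    and le: "\<And>u. u \<in> einterval 0 L \<Longrightarrow> h u \<le> ennreal K * g u"
  shows "B_norm L p r b q a h \<le> ennreal K * B_norm L p r b q a g"
proof (rule B_norm_mono[OF assms(1-5) g h])
  fix t assume t: "t \<in> einterval 0 L"
  let ?w = "\<lambda>u. u powr rcp p * a u"
  have sub: "{0<..<t} \<subseteq> einterval 0 L" using Ioo_subset_einterval_0[OF t] by simp
  note meas = powr_times_SV_measurable[OF assms(3), of "rcp p"] g h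
  note meas' = meas[THEN measurable_lebesgue_on_subset, OF sub]
  have "wnorm q {0<..<t} ?w h \<le> wnorm q {0<..<t} ?w (\<lambda>u. ennreal K * g u)"
  proof (rule wnorm_mono[OF assms(2) meas'(1,3)])
    fix u assume u: "u \<in> {0<..<t}"
    then have uL: "u \<in> einterval 0 L" using sub by auto
    show "0 \<le> ?w u" "0 \<le> ?w u" using SV_pos[OF assms(3) uL] by auto
    show "ennreal (?w u) * h u \<le> ennreal (?w u) * (ennreal K * g u)"
      by (intro mult_left_mono le uL) simp
  qed
  also have "\<dots> = ennreal K * wnorm q {0<..<t} ?w g"
    by (rule wnorm_cmult[OF assms(2) meas'(1,2)])
  finally show "wnorm q {0<..<t} ?w h \<le> ennreal K * wnorm q {0<..<t} ?w g" .
qed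

lemma equiv_onI:
  assumes "0 < K" "0 < K'" "\<And>x. x \<in> S \<Longrightarrow> F x \<le> ennreal K * G x" "\<And>x. x \<in> S \<Longrightarrow> G x \<le> ennreal K' * F x"
  shows "equiv_on S F G"
  unfolding equiv_on_def
proof (intro exI conjI ballI)
  \<comment> \<open>The maximum secures \<open>c \<le> C\<close>, which the two inequalities do not
    imply when all values are 0 or \<infinity>.\<close>
  show "0 < 1 / K'" "1 / K' \<le> max K (1 / K')" using assms by auto
  fix x assume x: "x \<in> S"
  have "ennreal (1 / K') * G x \<le> ennreal (1 / K') * (ennreal K' * F x)"
    using assms(4)[OF x] by (intro mult_left_mono) auto
  also have "\<dots> = F x" using assms(2) by (simp add: mult.assoc[symmetric] ennreal_mult[symmetric])
  finally show "ennreal (1 / K') * G x \<le> F x" .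
  show "F x \<le> ennreal (max K (1 / K')) * G x"
    using assms(3)[OF x] by (rule order_trans) (intro mult_right_mono ennreal_leI, auto)
qed

text \<open>Pulling v powr (1/U - \<epsilon>) times the rearrangement out as a supremum leaves v
  powr \<epsilon>, whose norm over (0, u) with respect to dv/v is u powr \<epsilon> times
  (\<epsilon> W) powr (- 1/W). From here on \<open>W\<close> enters only through a constant.\<close>

lemma H_upper_le:
  assumes "0 < W" "W < \<infinity>" "0 < \<epsilon>"
  obtains K :: real where "0 < K"
    "\<And>L U f u. 0 < u \<Longrightarrow>
      H_upper L U W f u \<le> ennreal K * (SUP v\<in>{0<..<u}. ennreal ((v / u) powr (rcp U - \<epsilon>)) * rearr L f v)"
proof -
  obtain W' where W: "W = ereal W'" "0 < W'" using assms by (cases W) auto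
  define K where "K = (\<epsilon> * W') powr (- 1 / W')"
  show ?thesis
  proof (rule that[of K])
    show "0 < K" using assms W by (simp add: K_def)
    fix L U f and u :: real assume u: "0 < u"
    let ?g = "rearr L f" and ?\<alpha> = "rcp U - \<epsilon>"
    let ?S = "SUP v\<in>{0<..<u}. ennreal ((v / u) powr ?\<alpha>) * ?g v"
    have "wnorm W {0<..<u} (\<lambda>v. v powr rcp U) ?g
        \<le> Lnorm W {0<..<u} (\<lambda>v. (ennreal (u powr ?\<alpha>) * ?S) * ennreal (v powr (\<epsilon> - 1 / W')))"
      unfolding wnorm_def
    proof (rule Lnorm_mono[OF assms(1)])
      show "(\<lambda>v. ennreal (v powr (- rcp W) * v powr rcp U) * ?g v) \<in> borel_measurable (lebesgue_on {0<..<u})"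
        using rearr_measurable[of "{0<..<u}" L f] is_interval_einterval[of 0 "ereal u"]
        by (auto simp: einterval_0_ereal)
      fix v assume v: "v \<in> {0<..<u}"
      have "v powr (- rcp W) * v powr rcp U = u powr ?\<alpha> * (v powr (\<epsilon> - 1 / W') * (v / u) powr ?\<alpha>)"
        using v W by (simp add: powr_divide rcp_ereal powr_add[symmetric])
      then have "ennreal (v powr (- rcp W) * v powr rcp U) * ?g v
          = (ennreal (u powr ?\<alpha>) * (ennreal ((v / u) powr ?\<alpha>) * ?g v)) * ennreal (v powr (\<epsilon> - 1 / W'))"
        by (simp add: ennreal_mult mult_ac)
      also have "\<dots> \<le> (ennreal (u powr ?\<alpha>) * ?S) * ennreal (v powr (\<epsilon> - 1 / W'))"
        using v by (intro mult_right_mono mult_left_mono SUP_upper) auto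
      finally show "ennreal (v powr (- rcp W) * v powr rcp U) * ?g v
          \<le> (ennreal (u powr ?\<alpha>) * ?S) * ennreal (v powr (\<epsilon> - 1 / W'))" .
    qed
    also have "\<dots> = (ennreal (u powr ?\<alpha>) * ?S) * ennreal (u powr \<epsilon> * K)"
      using assms W u by (subst Lnorm_cmult) (auto simp: Lnorm_powr_from_0 K_def)
    finally have "H_upper L U W f u
        \<le> ennreal (u powr (- rcp U)) * ((ennreal (u powr ?\<alpha>) * ?S) * ennreal (u powr \<epsilon> * K))"
      unfolding H_upper_eq_wnorm by (intro mult_left_mono) auto
    also have "\<dots> = ennreal (u powr (- rcp U) * u powr ?\<alpha> * u powr \<epsilon> * K) * ?S"
      by (simp add: ennreal_mult mult_ac K_def)
    also have "u powr (- rcp U) * u powr ?\<alpha> * u powr \<epsilon> = 1"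
      using u by (simp add: powr_add[symmetric])
    finally show "H_upper L U W f u \<le> ennreal K * ?S" by simp
  qed
qed

text \<open>Replacing the rearrangement on (0, u) by its smaller value at u leaves the norm of v
  powr (1/U), an explicit multiple of u powr (1/U) because 1/U is positive.\<close>

lemma rearr_le_H_upper:
  assumes "0 < W" "W < \<infinity>" "0 < U" "U < \<infinity>"
  obtains K :: real where "0 < K" "\<And>L f u. 0 < u \<Longrightarrow> rearr L f u \<le> ennreal K * H_upper L U W f u"
proof -
  obtain W' where W: "W = ereal W'" "0 < W'" using assms by (cases W) auto
  obtain U' where U: "U = ereal U'" "0 < U'" using assms by (cases U) auto
  have rU: "0 < rcp U" using U by (simp add: rcp_ereal)
  define k where "k = (rcp U * W') powr (- 1 / W')"
  have k: "0 < k" using rU W by (simp add: k_def)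
  show ?thesis
  proof (rule that[of "1 / k"])
    show "0 < 1 / k" using k by simp
    fix L f and u :: real assume u: "0 < u"
    let ?g = "rearr L f"
    have "ennreal (u powr rcp U * k) * ?g u = Lnorm W {0<..<u} (\<lambda>v. ?g u * ennreal (v powr (rcp U - 1 / W')))"
      using assms W u rU by (subst Lnorm_cmult) (auto simp: Lnorm_powr_from_0 k_def mult.commute)
    also have "\<dots> \<le> wnorm W {0<..<u} (\<lambda>v. v powr rcp U) ?g"
      unfolding wnorm_def
    proof (rule Lnorm_mono[OF assms(1)])
      fix v assume v: "v \<in> {0<..<u}"
      have "v powr (- rcp W) * v powr rcp U = v powr (rcp U - 1 / W')"
        using W by (simp add: rcp_ereal powr_add[symmetric])
      then show "?g u * ennreal (v powr (rcp U - 1 / W')) \<le> ennreal (v powr (- rcp W) * v powr rcp U) * ?g v"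
        using v by (simp add: mult.commute[of "ennreal _" "?g v"] mult_right_mono rearr_antimono)
    qed auto
    finally have "ennreal (u powr (- rcp U)) * (ennreal (u powr rcp U * k) * ?g u) \<le> H_upper L U W f u"
      unfolding H_upper_eq_wnorm by (intro mult_left_mono) auto
    then have "ennreal k * ?g u \<le> H_upper L U W f u"
      using u k by (simp add: mult.assoc[symmetric] ennreal_mult[symmetric] powr_add[symmetric])
    then have "ennreal (1 / k) * (ennreal k * ?g u) \<le> ennreal (1 / k) * H_upper L U W f u"
      by (rule mult_left_mono) simp
    then show "?g u \<le> ennreal (1 / k) * H_upper L U W f u"
      using k by (simp add: mult.assoc[symmetric] ennreal_mult[symmetric])
  qed
qed

lemma equiv_H_upper:
  assumes "0 < p" "0 < r" "0 < q" "a \<in> SV L" "b \<in> SV L" "0 < W" "W < \<infinity>" "0 < U" "U < p"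
  shows "equiv_on (Mfun L) (LL_norm L p r b q a) (\<lambda>f. B_norm L p r b q a (H_upper L U W f))"
proof -
  let ?w = "\<lambda>u. u powr rcp p * a u"
  have Ufin: "U < \<infinity>" using assms(9) by (rule less_le_trans) simp
  have rU: "rcp p < rcp U" using assms by (intro rcp_strict_antimono)
  \<comment> \<open>This makes 1/U - \<epsilon> the midpoint of 1/p and 1/U, which is positive even
    for \<open>p = \<infinity>\<close>.\<close>
  define \<epsilon> where "\<epsilon> = (rcp U - rcp p) / 2"
  have e: "0 < \<epsilon>" "rcp p < rcp U - \<epsilon>" "0 < rcp U - \<epsilon>"
    using rU rcp_nonneg[OF assms(1)] by (auto simp: \<epsilon>_def field_simps)
  obtain K1 where K1: "0 < K1" "\<And>L f u. 0 < u \<Longrightarrow> rearr L f u \<le> ennreal K1 * H_upper L U W f u"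
    using rearr_le_H_upper[OF assms(6-8) Ufin] by metis
  obtain K2 where K2: "0 < K2" "\<And>L U f u. 0 < u \<Longrightarrow>
      H_upper L U W f u \<le> ennreal K2 * (SUP v\<in>{0<..<u}. ennreal ((v / u) powr (rcp U - \<epsilon>)) * rearr L f v)"
    using H_upper_le[OF assms(6,7) e(1)] by metis
  obtain K3 where K3: "0 < K3" "\<And>T g h. T \<le> L \<Longrightarrow> antimono_on (einterval 0 T) g \<Longrightarrow>
      h \<in> borel_measurable (lebesgue_on (einterval 0 T)) \<Longrightarrow>
      (\<And>u. u \<in> einterval 0 T \<Longrightarrow> h u \<le> (SUP v\<in>{0<..<u}. ennreal ((v / u) powr (rcp U - \<epsilon>)) * g v)) \<Longrightarrow>
      wnorm q (einterval 0 T) ?w h \<le> ennreal K3 * wnorm q (einterval 0 T) ?w g"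
    using wnorm_sup_below[OF assms(3,4) e(2,3)] by blast
  show ?thesis
  proof (rule equiv_onI)
    show "0 < K1" "0 < K3 * K2" using K1(1) K2(1) K3(1) by auto
    fix f
    have [measurable]: "H_upper L U W f \<in> borel_measurable (lebesgue_on (einterval 0 L))"
        "rearr L f \<in> borel_measurable (lebesgue_on (einterval 0 L))"
      using assms by (auto intro: H_upper_measurable rearr_measurable is_interval_einterval)
    have meas: "?w \<in> borel_measurable (lebesgue_on {0<..<t})"
        "H_upper L U W f \<in> borel_measurable (lebesgue_on {0<..<t})" if "t \<in> einterval 0 L" for t
    proof -
      have sub: "{0<..<t} \<subseteq> einterval 0 L" using Ioo_subset_einterval_0[OF that] by simp
      show "?w \<in> borel_measurable (lebesgue_on {0<..<t})"
        "H_upper L U W f \<in> borel_measurable (lebesgue_on {0<..<t})"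
        by (rule measurable_lebesgue_on_subset[OF _ sub], simp add: powr_times_SV_measurable[OF assms(4)])+
    qed
    show "LL_norm L p r b q a f \<le> ennreal K1 * B_norm L p r b q a (H_upper L U W f)"
      unfolding LL_norm_def using K1(1)
      by (intro B_norm_mono_fun[OF assms(2-5)] K1(2)) (auto simp: einterval_0_mem)
    show "B_norm L p r b q a (H_upper L U W f) \<le> ennreal (K3 * K2) * LL_norm L p r b q a f"
      unfolding LL_norm_def
    proof (rule B_norm_mono[OF assms(2-5)])
      fix t assume t: "t \<in> einterval 0 L"
      have i: "{0<..<t} = einterval 0 (ereal t)" by (simp add: einterval_0_ereal)
      \<comment> \<open>The supremum inequality expects a function bounded by the supremum without a
        factor, so \<open>K2\<close> is divided out here and restored afterwards.\<close>
      have "wnorm q {0<..<t} ?w (\<lambda>u. ennreal (1 / K2) * H_upper L U W f u)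
          = ennreal (1 / K2) * wnorm q {0<..<t} ?w (H_upper L U W f)"
        by (rule wnorm_cmult[OF assms(3) meas(1,2)[OF t]])
      then have "wnorm q {0<..<t} ?w (H_upper L U W f)
          = ennreal K2 * wnorm q {0<..<t} ?w (\<lambda>u. ennreal (1 / K2) * H_upper L U W f u)"
        using K2(1) by (simp add: mult.assoc[symmetric] ennreal_mult[symmetric])
      also have "\<dots> \<le> ennreal K2 * (ennreal K3 * wnorm q {0<..<t} ?w (rearr L f))"
        unfolding i
      proof (intro mult_left_mono K3(2) rearr_antimono_on)
        show "ereal t \<le> L" using t unfolding einterval_0_mem by (rule less_imp_le[OF conjunct2])
        show "(\<lambda>u. ennreal (1 / K2) * H_upper L U W f u) \<in> borel_measurable (lebesgue_on (einterval 0 (ereal t)))"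
          unfolding i[symmetric] using meas(2)[OF t] by measurable
        fix u assume "u \<in> einterval 0 (ereal t)"
        then have "ennreal (1 / K2) * H_upper L U W f u
            \<le> ennreal (1 / K2) * (ennreal K2 * (SUP v\<in>{0<..<u}. ennreal ((v / u) powr (rcp U - \<epsilon>)) * rearr L f v))"
          by (intro mult_left_mono K2(2)) (auto simp: einterval_0_mem)
        then show "ennreal (1 / K2) * H_upper L U W f u
            \<le> (SUP v\<in>{0<..<u}. ennreal ((v / u) powr (rcp U - \<epsilon>)) * rearr L f v)"
          using K2(1) by (simp add: mult.assoc[symmetric] ennreal_mult[symmetric])
      qed simp
      finally show "wnorm q {0<..<t} ?w (H_upper L U W f)
          \<le> ennreal (K3 * K2) * wnorm q {0<..<t} ?w (rearr L f)"
        using K2(1) K3(1) by (simp add: ennreal_mult mult_ac)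
    qed (use K2(1) K3(1) in auto)
  qed
qed

section \<open>The lower averaging operator\<close>

text \<open>For v > u the surplus (v / u) powr \<epsilon> inside the supremum leaves (v / u) powr (-
  \<epsilon>) under the norm. This is the kernel itself, bounded on every interval (u, L) by the
  same constant.\<close>

lemma H_lower_le:
  assumes "0 < W" "W < \<infinity>" "0 < \<epsilon>"
  obtains K :: real where "0 < K"
    "\<And>L V f u. 0 < u \<Longrightarrow> H_lower L V W f u
      \<le> ennreal K * (SUP v\<in>einterval (ereal u) L. ennreal ((v / u) powr (rcp V + \<epsilon>)) * rearr L f v)"
proof -
  obtain K where K: "0 < K" "\<And>A s. A \<in> sets borel \<Longrightarrow> A \<subseteq> {0<..} \<Longrightarrow> 0 < s \<Longrightarrow>
      Lnorm W A (\<lambda>u. ennreal (u powr (- rcp W) * kern \<epsilon> (u / s))) \<le> ennreal K"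
    using Lnorm_kern[OF assms(1,3)] by blast
  show ?thesis
  proof (rule that[OF K(1)])
    fix L V f and u :: real assume u: "0 < u"
    let ?g = "rearr L f" and ?\<alpha> = "rcp V + \<epsilon>" and ?A = "einterval (ereal u) L"
    let ?S = "SUP v\<in>?A. ennreal ((v / u) powr ?\<alpha>) * ?g v"
    have "wnorm W ?A (\<lambda>v. v powr rcp V) ?g
        \<le> Lnorm W ?A (\<lambda>v. (ennreal (u powr rcp V) * ?S) * ennreal (v powr (- rcp W) * kern \<epsilon> (v / u)))"
      unfolding wnorm_def
    proof (rule Lnorm_mono[OF assms(1)])
      show "(\<lambda>v. ennreal (v powr (- rcp W) * v powr rcp V) * ?g v) \<in> borel_measurable (lebesgue_on ?A)"
        using rearr_measurable[OF is_interval_einterval, of L f] by measurable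
      fix v assume v: "v \<in> ?A"
      then have uv: "u < v" by (simp add: einterval_iff)
      have "v powr (- rcp W) * v powr rcp V
          = u powr rcp V * ((v / u) powr ?\<alpha> * (v powr (- rcp W) * (v / u) powr (- \<epsilon>)))"
        using uv u by (simp add: powr_divide powr_add powr_minus_divide)
      also have "(v / u) powr (- \<epsilon>) = kern \<epsilon> (v / u)"
        using uv u assms by (simp add: kern_eq_powr_minus)
      finally have eq: "v powr (- rcp W) * v powr rcp V
          = u powr rcp V * ((v / u) powr ?\<alpha> * (v powr (- rcp W) * kern \<epsilon> (v / u)))" .
      have "ennreal (v powr (- rcp W) * v powr rcp V) * ?g v
          = (ennreal (u powr rcp V) * (ennreal ((v / u) powr ?\<alpha>) * ?g v)) * ennreal (v powr (- rcp W) * kern \<epsilon> (v / u))"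
        unfolding eq by (simp add: ennreal_mult mult_ac)
      also have "\<dots> \<le> (ennreal (u powr rcp V) * ?S) * ennreal (v powr (- rcp W) * kern \<epsilon> (v / u))"
        using v by (intro mult_right_mono mult_left_mono SUP_upper) auto
      finally show "ennreal (v powr (- rcp W) * v powr rcp V) * ?g v
          \<le> (ennreal (u powr rcp V) * ?S) * ennreal (v powr (- rcp W) * kern \<epsilon> (v / u))" .
    qed
    also have "\<dots> = (ennreal (u powr rcp V) * ?S) * Lnorm W ?A (\<lambda>v. ennreal (v powr (- rcp W) * kern \<epsilon> (v / u)))"
      by (rule Lnorm_cmult[OF assms(1)]) measurable
    also have "\<dots> \<le> (ennreal (u powr rcp V) * ?S) * ennreal K"
      using u by (intro mult_left_mono K(2)) (auto simp: einterval_iff)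
    finally have "H_lower L V W f u
        \<le> ennreal (u powr (- rcp V)) * ((ennreal (u powr rcp V) * ?S) * ennreal K)"
      unfolding H_lower_eq_wnorm by (intro mult_left_mono) auto
    also have "\<dots> = ennreal (u powr (- rcp V) * u powr rcp V) * (ennreal K * ?S)"
      by (simp add: ennreal_mult mult_ac)
    also have "u powr (- rcp V) * u powr rcp V = 1"
      using u by (simp add: powr_add[symmetric])
    finally show "H_lower L V W f u \<le> ennreal K * ?S" by simp
  qed
qed

text \<open>The interval (u/2, L) contains (u/2, u), whose measure with respect to dv/v is ln 2 and
  on which the rearrangement is at least its value at u. The interval (u, L) may be too short for
  such a bound.\<close>

lemma rearr_le_H_lower:
  assumes "0 < W" "0 < V"
  obtains K :: real where "0 < K"
    "\<And>L f u. u \<in> einterval 0 L \<Longrightarrow> rearr L f u \<le> ennreal K * H_lower L V W f (u / 2)"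
proof -
  define l where "l = ln 2 powr rcp W"
  have l: "0 < l" unfolding l_def by simp
  show ?thesis
  proof (rule that[of "1 / l"])
    show "0 < 1 / l" using l by simp
    fix L f and u :: real assume u: "u \<in> einterval 0 L"
    then have u0: "0 < u" "ereal u < L" by (auto simp: einterval_0_mem)
    let ?g = "rearr L f" and ?A = "einterval (ereal (u / 2)) L"
    have sub: "{u / 2<..<u} \<subseteq> ?A"
    proof
      fix s assume s: "s \<in> {u / 2<..<u}"
      then have "ereal s < ereal u" by simp
      then have "ereal s < L" using u0(2) by (rule less_trans)
      then show "s \<in> ?A" using s by (simp add: einterval_iff)
    qed
    have "ennreal (ln (u / (u / 2)) powr rcp W) * (ennreal ((u / 2) powr rcp V) * ?g u)
        \<le> wnorm W ?A (\<lambda>v. v powr rcp V) ?g"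
    proof (rule wnorm_ge_const[OF assms(1)])
      show "?g \<in> borel_measurable (lebesgue_on ?A)"
        by (rule rearr_measurable[OF is_interval_einterval])
      fix s assume s: "s \<in> {u / 2<..<u}"
      have "(u / 2) powr rcp V \<le> s powr rcp V"
        using s u0 rcp_nonneg[OF assms(2)] by (intro powr_mono2) auto
      then show "ennreal ((u / 2) powr rcp V) * ?g u \<le> ennreal (s powr rcp V) * ?g s"
        using s by (intro mult_mono ennreal_leI rearr_antimono) auto
    qed (use u0 sub in auto)
    then have "ennreal ((u / 2) powr (- rcp V)) * (ennreal l * (ennreal ((u / 2) powr rcp V) * ?g u))
        \<le> H_lower L V W f (u / 2)"
      unfolding H_lower_eq_wnorm using u0 by (intro mult_left_mono) (auto simp: l_def)
    also have "ennreal ((u / 2) powr (- rcp V)) * (ennreal l * (ennreal ((u / 2) powr rcp V) * ?g u))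
        = ennreal ((u / 2) powr (- rcp V) * (u / 2) powr rcp V) * (ennreal l * ?g u)"
      by (simp only: ennreal_mult powr_ge_zero mult_ac)
    also have "(u / 2) powr (- rcp V) * (u / 2) powr rcp V = 1"
      using u0 by (simp add: powr_add[symmetric] del: powr_divide)
    finally have "ennreal (1 / l) * (ennreal l * ?g u) \<le> ennreal (1 / l) * H_lower L V W f (u / 2)"
      by (intro mult_left_mono) simp_all
    then show "?g u \<le> ennreal (1 / l) * H_lower L V W f (u / 2)"
      using l by (simp add: mult.assoc[symmetric] ennreal_mult[symmetric])
  qed
qed

text \<open>The end point \<open>T\<close> is separate from \<open>L\<close> because the supremum is
  needed twice: up to t for the inner norm on (0, t), and up to \<open>L\<close> for the values
  beyond t.\<close>

definition sup_above :: "ereal \<Rightarrow> real \<Rightarrow> (real \<Rightarrow> ennreal) \<Rightarrow> real \<Rightarrow> ennreal" where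
  "sup_above T \<alpha> g u = (SUP v\<in>einterval 0 T \<inter> {u..}. ennreal ((v / u) powr \<alpha>) * g v)"

text \<open>When u grows, the range of v shrinks and every coefficient decreases; \<open>g\<close>
  itself is arbitrary.\<close>

lemma sup_above_antimono_on:
  assumes "0 \<le> \<alpha>" shows "antimono_on (einterval 0 T) (sup_above T \<alpha> g)"
proof (rule monotone_onI)
  fix s t assume st: "s \<in> einterval 0 T" "t \<in> einterval 0 T" "s \<le> t"
  then have "0 < s" "0 < t" by (auto simp: einterval_0_mem)
  then show "sup_above T \<alpha> g s \<ge> sup_above T \<alpha> g t"
    unfolding sup_above_def using st assms
    by (intro SUP_mono) (auto intro!: bexI mult_right_mono ennreal_leI powr_mono2 divide_left_mono simp: einterval_0_mem)
qed

lemma sup_above_measurable: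
  "0 \<le> \<alpha> \<Longrightarrow> sup_above T \<alpha> g \<in> borel_measurable (lebesgue_on (einterval 0 T))"
  by (rule borel_measurable_antimono_on[OF sup_above_antimono_on is_interval_einterval])

text \<open>Since v / u = (t / u) (v / t), the terms with \<open>v \<ge> t\<close> depend on u only
  through the common factor (t / u) powr \<alpha>.\<close>

lemma SUP_le_sup_above:
  assumes "t \<in> einterval 0 L" "0 < u" "u \<le> t"
  shows "(SUP v\<in>einterval (ereal u) L. ennreal ((v / u) powr \<alpha>) * g v)
    \<le> sup_above (ereal t) \<alpha> g u + ennreal ((t / u) powr \<alpha>) * sup_above L \<alpha> g t"
proof (rule SUP_least)
  fix v assume "v \<in> einterval (ereal u) L"
  then have v: "u < v" "ereal v < L" by (auto simp: einterval_iff)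
  have t0: "0 < t" using assms by (simp add: einterval_0_mem)
  show "ennreal ((v / u) powr \<alpha>) * g v
      \<le> sup_above (ereal t) \<alpha> g u + ennreal ((t / u) powr \<alpha>) * sup_above L \<alpha> g t"
  proof (cases "v < t")
    case True
    then have "ennreal ((v / u) powr \<alpha>) * g v \<le> sup_above (ereal t) \<alpha> g u"
      unfolding sup_above_def using v assms by (intro SUP_upper) (auto simp: einterval_0_mem)
    then show ?thesis by (rule order_trans) simp
  next
    case False
    have "ennreal ((v / t) powr \<alpha>) * g v \<le> sup_above L \<alpha> g t"
      unfolding sup_above_def using v assms False by (intro SUP_upper) (auto simp: einterval_0_mem)
    then have "ennreal ((t / u) powr \<alpha>) * (ennreal ((v / t) powr \<alpha>) * g v)
        \<le> ennreal ((t / u) powr \<alpha>) * sup_above L \<alpha> g t"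
      by (rule mult_left_mono) simp
    moreover have "(t / u) powr \<alpha> * (v / t) powr \<alpha> = (v / u) powr \<alpha>"
      using t0 v assms by (simp add: powr_mult[symmetric])
    ultimately have "ennreal ((v / u) powr \<alpha>) * g v \<le> ennreal ((t / u) powr \<alpha>) * sup_above L \<alpha> g t"
      by (simp add: mult.assoc[symmetric] ennreal_mult[symmetric])
    then show ?thesis by (rule order_trans) simp
  qed
qed

text \<open>On (0, t) the tail beyond t acts as a constant times (t / u) powr \<alpha>. As \<alpha>
  is smaller than \<rho>, the norm of u powr (\<rho> - \<alpha>) * a u is governed by the end point,
  so the tail contributes the weight at t times the supremum at t.\<close>

lemma wnorm_H_lower_le:
  assumes "0 < q" "a \<in> SV L" "0 < W" "W < \<infinity>" "0 < \<epsilon>" "0 < rcp V + \<epsilon>" "rcp V + \<epsilon> < \<rho>" "0 < V"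
  obtains K :: real where "0 < K"
    "\<And>t f. t \<in> einterval 0 L \<Longrightarrow>
      wnorm q {0<..<t} (\<lambda>u. u powr \<rho> * a u) (H_lower L V W f)
        \<le> ennreal K * (wnorm q {0<..<t} (\<lambda>u. u powr \<rho> * a u) (rearr L f)
            + ennreal (t powr \<rho> * a t) * sup_above L (rcp V + \<epsilon>) (rearr L f) t)"
proof -
  let ?w = "\<lambda>u. u powr \<rho> * a u" and ?\<alpha> = "rcp V + \<epsilon>"
  obtain K2 where K2: "0 < K2" "\<And>L V f u. 0 < u \<Longrightarrow> H_lower L V W f u
      \<le> ennreal K2 * (SUP v\<in>einterval (ereal u) L. ennreal ((v / u) powr (rcp V + \<epsilon>)) * rearr L f v)"
    using H_lower_le[OF assms(3-5)] by metis
  obtain K3 where K3: "0 < K3" "\<And>T g h. T \<le> L \<Longrightarrow> antimono_on (einterval 0 T) g \<Longrightarrow>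
      h \<in> borel_measurable (lebesgue_on (einterval 0 T)) \<Longrightarrow>
      (\<And>u. u \<in> einterval 0 T \<Longrightarrow> h u \<le> (SUP v\<in>einterval 0 T \<inter> {u..}. ennreal ((v / u) powr ?\<alpha>) * g v)) \<Longrightarrow>
      wnorm q (einterval 0 T) ?w h \<le> ennreal K3 * wnorm q (einterval 0 T) ?w g"
    using wnorm_sup_above[OF assms(1,2,7,6)] by blast
  obtain K4 where K4: "0 < K4" "\<And>t. t \<in> einterval 0 L \<Longrightarrow>
      wnorm q {0<..<t} (\<lambda>u. u powr (\<rho> - ?\<alpha>) * a u) (\<lambda>_. 1) \<le> ennreal (K4 * (t powr (\<rho> - ?\<alpha>) * a t))"
    using wnorm_powr_times_SV_le[OF assms(1,2), of "\<rho> - ?\<alpha>"] assms(7) by auto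
  define C where "C = 2 * 2 powr rcp q"
  have C: "0 < C" by (simp add: C_def)
  show ?thesis
  proof (rule that[of "K2 * C * max K3 K4"])
    show "0 < K2 * C * max K3 K4" using K2(1) K3(1) K4(1) C by (simp add: less_max_iff_disj)
    fix t f assume t: "t \<in> einterval 0 L"
    then have t0: "0 < t" by (simp add: einterval_0_mem)
    let ?g = "rearr L f"
    define G where "G = sup_above L ?\<alpha> ?g t"
    define P where "P = sup_above (ereal t) ?\<alpha> ?g"
    define R where "R = (\<lambda>u. ennreal ((t / u) powr ?\<alpha>) * G)"
    have i: "{0<..<t} = einterval 0 (ereal t)" by (simp add: einterval_0_ereal)
    have sub: "{0<..<t} \<subseteq> einterval 0 L" using Ioo_subset_einterval_0[OF t] by simp
    have P: "P \<in> borel_measurable (lebesgue_on {0<..<t})"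
      unfolding P_def i using assms(6) by (intro sup_above_measurable) simp
    have R: "R \<in> borel_measurable (lebesgue_on {0<..<t})"
      unfolding R_def by measurable
    have w: "?w \<in> borel_measurable (lebesgue_on {0<..<t})"
      by (rule measurable_lebesgue_on_subset[OF powr_times_SV_measurable[OF assms(2)] sub])
    have w': "(\<lambda>u. u powr (\<rho> - ?\<alpha>) * a u) \<in> borel_measurable (lebesgue_on {0<..<t})"
      by (rule measurable_lebesgue_on_subset[OF powr_times_SV_measurable[OF assms(2)] sub])
    have H: "H_lower L V W f \<in> borel_measurable (lebesgue_on {0<..<t})"
      unfolding i by (rule borel_measurable_antimono_on[OF H_lower_antimono_on[OF assms(3,8)] is_interval_einterval])
    have wpos: "0 \<le> ?w u" "0 \<le> a u" if "u \<in> {0<..<t}" for u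
      using SV_pos[OF assms(2), of u] sub that by (auto simp: less_imp_le subset_iff)
    have at: "0 < a t" by (rule SV_pos[OF assms(2) t])
    have "wnorm q {0<..<t} ?w (H_lower L V W f) \<le> wnorm q {0<..<t} ?w (\<lambda>u. ennreal K2 * (P u + R u))"
    proof (rule wnorm_mono[OF assms(1) w H])
      fix u assume u: "u \<in> {0<..<t}"
      have "H_lower L V W f u \<le> ennreal K2 * (P u + R u)"
        unfolding P_def R_def G_def using u
        by (intro order_trans[OF K2(2)] mult_left_mono SUP_le_sup_above[OF t]) auto
      then show "ennreal (?w u) * H_lower L V W f u \<le> ennreal (?w u) * (ennreal K2 * (P u + R u))"
        by (rule mult_left_mono) simp
    qed (rule wpos(1), assumption)+
    also have "\<dots> = ennreal K2 * wnorm q {0<..<t} ?w (\<lambda>u. P u + R u)"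
      by (rule wnorm_cmult[OF assms(1) w borel_measurable_add[OF P R]])
    also have "\<dots> \<le> ennreal K2 * (ennreal C * (wnorm q {0<..<t} ?w P + wnorm q {0<..<t} ?w R))"
      unfolding C_def by (intro mult_left_mono wnorm_add[OF assms(1) w P R]) simp
    also have "\<dots> \<le> ennreal K2 * (ennreal C * (ennreal K3 * wnorm q {0<..<t} ?w ?g + ennreal K4 * (ennreal (?w t) * G)))"
    proof (intro mult_left_mono add_mono)
      show "wnorm q {0<..<t} ?w P \<le> ennreal K3 * wnorm q {0<..<t} ?w ?g"
        unfolding i
      proof (rule K3(2)[OF _ rearr_antimono_on])
        show "ereal t \<le> L" using t unfolding einterval_0_mem by (rule less_imp_le[OF conjunct2])
        show "P \<in> borel_measurable (lebesgue_on (einterval 0 (ereal t)))" using P by (simp only: i)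
      qed (simp add: P_def sup_above_def)
      have "wnorm q {0<..<t} ?w R
          = wnorm q {0<..<t} (\<lambda>u. u powr (\<rho> - ?\<alpha>) * a u) (\<lambda>_. (ennreal (t powr ?\<alpha>) * G) * 1)"
      proof (rule wnorm_cong)
        fix u assume u: "u \<in> {0<..<t}"
        have "?w u * (t / u) powr ?\<alpha> = (u powr (\<rho> - ?\<alpha>) * a u) * t powr ?\<alpha>"
          using u t0 by (simp add: powr_divide powr_diff)
        then have "ennreal (?w u) * ennreal ((t / u) powr ?\<alpha>) = ennreal (u powr (\<rho> - ?\<alpha>) * a u) * ennreal (t powr ?\<alpha>)"
          using wpos[OF u] by (simp add: ennreal_mult[symmetric])
        then show "ennreal (?w u) * R u = ennreal (u powr (\<rho> - ?\<alpha>) * a u) * ((ennreal (t powr ?\<alpha>) * G) * 1)"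
          by (simp add: R_def mult.assoc[symmetric])
      qed (simp_all add: wpos)
      also have "\<dots> = (ennreal (t powr ?\<alpha>) * G) * wnorm q {0<..<t} (\<lambda>u. u powr (\<rho> - ?\<alpha>) * a u) (\<lambda>_. 1)"
        by (rule wnorm_cmult[OF assms(1) w']) simp
      also have "\<dots> \<le> (ennreal (t powr ?\<alpha>) * G) * ennreal (K4 * (t powr (\<rho> - ?\<alpha>) * a t))"
        by (rule mult_left_mono[OF K4(2)[OF t]]) simp
      also have "\<dots> = ennreal (K4 * (t powr ?\<alpha> * t powr (\<rho> - ?\<alpha>) * a t)) * G"
        using K4(1) at by (simp add: ennreal_mult mult_ac)
      also have "t powr ?\<alpha> * t powr (\<rho> - ?\<alpha>) = t powr \<rho>"
        using t0 by (simp add: powr_add[symmetric])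
      finally show "wnorm q {0<..<t} ?w R \<le> ennreal K4 * (ennreal (?w t) * G)"
        using K4(1) at by (simp add: ennreal_mult mult.assoc)
    qed simp_all
    also have "\<dots> \<le> ennreal K2 * (ennreal C * (ennreal (max K3 K4) * wnorm q {0<..<t} ?w ?g
        + ennreal (max K3 K4) * (ennreal (?w t) * G)))"
      by (intro mult_left_mono add_mono mult_right_mono ennreal_leI) simp_all
    also have "\<dots> = ennreal (K2 * C * max K3 K4) * (wnorm q {0<..<t} ?w ?g + ennreal (?w t) * G)"
      using K2(1) K3(1) C by (simp only: distrib_left[symmetric] ennreal_mult less_imp_le less_max_iff_disj mult_pos_pos mult.assoc simp_thms)
    finally show "wnorm q {0<..<t} ?w (H_lower L V W f)
        \<le> ennreal (K2 * C * max K3 K4) * (wnorm q {0<..<t} ?w ?g + ennreal (?w t) * sup_above L ?\<alpha> ?g t)"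
      unfolding G_def .
  qed
qed

lemma B_norm_H_lower_le:
  assumes "0 < p" "0 < r" "0 < q" "a \<in> SV L" "b \<in> SV L" "0 < W" "W < \<infinity>" "0 < V" "p < V"
  obtains K :: real where "0 < K" "\<And>f. B_norm L p r b q a (H_lower L V W f) \<le> ennreal K * LL_norm L p r b q a f"
proof -
  let ?w = "\<lambda>u. u powr rcp p * a u" and ?A = "einterval 0 L"
  let ?I = "\<lambda>g t. wnorm q {0<..<t} ?w g"
  define \<epsilon> where "\<epsilon> = (rcp p - rcp V) / 2"
  have rV: "rcp V < rcp p" using assms by (intro rcp_strict_antimono)
  define \<alpha> where "\<alpha> = rcp V + \<epsilon>"
  have e: "0 < \<epsilon>" "0 < rcp V + \<epsilon>" "rcp V + \<epsilon> < rcp p"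
    using rV rcp_nonneg[OF assms(8)] by (auto simp: \<epsilon>_def field_simps)
  have ab: "(\<lambda>t. a t * b t) \<in> SV L" by (rule SV_mult[OF assms(4,5)])
  obtain K1 where K1: "0 < K1" "\<And>t f. t \<in> ?A \<Longrightarrow> ?I (H_lower L V W f) t
      \<le> ennreal K1 * (?I (rearr L f) t + ennreal (?w t) * sup_above L \<alpha> (rearr L f) t)"
    using wnorm_H_lower_le[OF assms(3,4,6,7) e assms(8)] unfolding \<alpha>_def by blast
  obtain K5 where K5: "0 < K5" "\<And>T g h. T \<le> L \<Longrightarrow> antimono_on (einterval 0 T) g \<Longrightarrow>
      h \<in> borel_measurable (lebesgue_on (einterval 0 T)) \<Longrightarrow>
      (\<And>u. u \<in> einterval 0 T \<Longrightarrow> h u \<le> (SUP v\<in>einterval 0 T \<inter> {u..}. ennreal ((v / u) powr \<alpha>) * g v)) \<Longrightarrow>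
      wnorm r (einterval 0 T) (\<lambda>u. u powr rcp p * (a u * b u)) h
        \<le> ennreal K5 * wnorm r (einterval 0 T) (\<lambda>u. u powr rcp p * (a u * b u)) g"
    using wnorm_sup_above[OF assms(2) ab e(3,2)] unfolding \<alpha>_def by blast
  obtain K6 where K6: "0 < K6" "\<And>t g. t \<in> einterval 0 L \<Longrightarrow> antimono_on (einterval 0 L) g \<Longrightarrow>
      ennreal (?w t) * g t \<le> ennreal K6 * ?I g t"
    using pointwise_le_wnorm[OF assms(3,4) rcp_nonneg[OF assms(1)]] by blast
  define C where "C = 2 * 2 powr rcp r"
  have C: "0 < C" by (simp add: C_def)
  show ?thesis
  proof (rule that[of "K1 * C * (1 + K5 * K6)"])
    show "0 < K1 * C * (1 + K5 * K6)" using K1(1) K5(1) K6(1) C by (simp add: add_pos_pos)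
    fix f
    let ?g = "rearr L f"
    define S where "S = (\<lambda>t. ennreal (?w t) * sup_above L \<alpha> ?g t)"
    have b: "b \<in> borel_measurable (lebesgue_on ?A)" by (rule SV_measurable[OF assms(5)])
    have w: "?w \<in> borel_measurable (lebesgue_on ?A)" by (rule powr_times_SV_measurable[OF assms(4)])
    have g: "?g \<in> borel_measurable (lebesgue_on ?A)" by (rule rearr_measurable[OF is_interval_einterval])
    have H: "H_lower L V W f \<in> borel_measurable (lebesgue_on ?A)"
      by (rule borel_measurable_antimono_on[OF H_lower_antimono_on[OF assms(6,8)] is_interval_einterval])
    have IH: "?I (H_lower L V W f) \<in> borel_measurable (lebesgue_on ?A)"
      by (rule wnorm_Ioo_measurable[OF assms(3) w H])
    have Ig: "?I ?g \<in> borel_measurable (lebesgue_on ?A)"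
      by (rule wnorm_Ioo_measurable[OF assms(3) w g])
    have sa: "sup_above L \<alpha> ?g \<in> borel_measurable (lebesgue_on ?A)"
      using e by (intro sup_above_measurable) (simp add: \<alpha>_def)
    have S: "S \<in> borel_measurable (lebesgue_on ?A)"
      unfolding S_def using w sa by measurable
    have pos: "0 \<le> a u" "0 \<le> b u" "0 \<le> ?w u" "0 \<le> u powr rcp p * (a u * b u)" if "u \<in> ?A" for u
      using SV_pos[OF assms(4) that] SV_pos[OF assms(5) that] by auto
    have "B_norm L p r b q a (H_lower L V W f) \<le> wnorm r ?A b (\<lambda>t. ennreal K1 * (?I ?g t + S t))"
      unfolding B_norm_eq_wnorm S_def
      by (rule wnorm_mono[OF assms(2) b IH]) (auto intro!: mult_left_mono K1(2) pos)
    also have "\<dots> = ennreal K1 * wnorm r ?A b (\<lambda>t. ?I ?g t + S t)"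
      by (rule wnorm_cmult[OF assms(2) b borel_measurable_add[OF Ig S]])
    also have "\<dots> \<le> ennreal K1 * (ennreal C * (wnorm r ?A b (?I ?g) + wnorm r ?A b S))"
      unfolding C_def by (intro mult_left_mono wnorm_add[OF assms(2) b Ig S]) simp
    also have "\<dots> \<le> ennreal K1 * (ennreal C * (wnorm r ?A b (?I ?g) + ennreal K5 * (ennreal K6 * wnorm r ?A b (?I ?g))))"
    proof (intro mult_left_mono add_left_mono)
      have "wnorm r ?A b S = wnorm r ?A (\<lambda>u. u powr rcp p * (a u * b u)) (sup_above L \<alpha> ?g)"
        unfolding S_def by (rule wnorm_cong) (simp_all add: pos ennreal_mult mult_ac)
      also have "\<dots> \<le> ennreal K5 * wnorm r ?A (\<lambda>u. u powr rcp p * (a u * b u)) ?g"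
        by (rule K5(2)[OF order_refl rearr_antimono_on sa]) (simp add: sup_above_def)
      \<comment> \<open>The return from the single weight to the double norm: the inner weight times
        the value at u is dominated by the inner norm on (0, u).\<close>
      also have "wnorm r ?A (\<lambda>u. u powr rcp p * (a u * b u)) ?g \<le> wnorm r ?A b (\<lambda>t. ennreal K6 * ?I ?g t)"
      proof (rule wnorm_mono[OF assms(2) powr_times_SV_measurable[OF ab] g])
        fix u assume u: "u \<in> ?A"
        have "ennreal (u powr rcp p * (a u * b u)) * ?g u = ennreal (b u) * (ennreal (?w u) * ?g u)"
          using pos[OF u] by (simp add: ennreal_mult mult_ac)
        also have "\<dots> \<le> ennreal (b u) * (ennreal K6 * ?I ?g u)"
          by (intro mult_left_mono K6(2)[OF u rearr_antimono_on]) simp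
        finally show "ennreal (u powr rcp p * (a u * b u)) * ?g u \<le> ennreal (b u) * (ennreal K6 * ?I ?g u)" .
      qed (simp_all add: pos)
      also have "wnorm r ?A b (\<lambda>t. ennreal K6 * ?I ?g t) = ennreal K6 * wnorm r ?A b (?I ?g)"
        by (rule wnorm_cmult[OF assms(2) b Ig])
      finally show "wnorm r ?A b S \<le> ennreal K5 * (ennreal K6 * wnorm r ?A b (?I ?g))"
        by (simp add: mult_left_mono)
    qed simp_all
    also have "\<dots> = ennreal (K1 * C * (1 + K5 * K6)) * wnorm r ?A b (?I ?g)"
      using K1(1) K5(1) K6(1) C by (simp add: ennreal_mult distrib_left distrib_right mult.assoc)
    finally show "B_norm L p r b q a (H_lower L V W f) \<le> ennreal (K1 * C * (1 + K5 * K6)) * LL_norm L p r b q a f"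
      unfolding LL_norm_def B_norm_eq_wnorm .
  qed
qed

text \<open>The average at u/2 is one term of the supremum over v < u of (v / u) powr \<alpha> times
  the average at v, so the dilation by 2 is a case of \<open>wnorm_sup_below\<close>. Any positive
  \<alpha> above 1/p serves; 1/p + 1 is one choice.\<close>

lemma LL_norm_le_B_norm_H_lower:
  assumes "0 < p" "0 < r" "0 < q" "a \<in> SV L" "b \<in> SV L" "0 < W" "0 < V"
  obtains K :: real where "0 < K" "\<And>f. LL_norm L p r b q a f \<le> ennreal K * B_norm L p r b q a (H_lower L V W f)"
proof -
  let ?w = "\<lambda>u. u powr rcp p * a u" and ?\<alpha> = "rcp p + 1"
  have al: "rcp p < ?\<alpha>" "0 < ?\<alpha>" using rcp_nonneg[OF assms(1)] by auto
  obtain K1 where K1: "0 < K1"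
    "\<And>L f u. u \<in> einterval 0 L \<Longrightarrow> rearr L f u \<le> ennreal K1 * H_lower L V W f (u / 2)"
    using rearr_le_H_lower[OF assms(6,7)] by metis
  obtain K3 where K3: "0 < K3" "\<And>T g h. T \<le> L \<Longrightarrow> antimono_on (einterval 0 T) g \<Longrightarrow>
      h \<in> borel_measurable (lebesgue_on (einterval 0 T)) \<Longrightarrow>
      (\<And>u. u \<in> einterval 0 T \<Longrightarrow> h u \<le> (SUP v\<in>{0<..<u}. ennreal ((v / u) powr ?\<alpha>) * g v)) \<Longrightarrow>
      wnorm q (einterval 0 T) ?w h \<le> ennreal K3 * wnorm q (einterval 0 T) ?w g"
    using wnorm_sup_below[OF assms(3,4) al] by blast
  \<comment> \<open>Chosen so that \<open>k * K1\<close> is the coefficient of the term v =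
    u/2.\<close>
  define k where "k = (1 / 2) powr ?\<alpha> / K1"
  have k: "0 < k" using K1(1) by (simp add: k_def)
  show ?thesis
  proof (rule that[of "K3 / k"])
    show "0 < K3 / k" using K3(1) k by simp
    fix f
    have g: "rearr L f \<in> borel_measurable (lebesgue_on (einterval 0 T))" for T
      by (rule rearr_measurable[OF is_interval_einterval])
    have H: "H_lower L V W f \<in> borel_measurable (lebesgue_on (einterval 0 T))" for T
      by (rule borel_measurable_antimono_on[OF H_lower_antimono_on[OF assms(6,7)] is_interval_einterval])
    show "LL_norm L p r b q a f \<le> ennreal (K3 / k) * B_norm L p r b q a (H_lower L V W f)"
      unfolding LL_norm_def
    proof (rule B_norm_mono[OF assms(2-5) _ H g])
      fix t assume t: "t \<in> einterval 0 L"
      have i: "{0<..<t} = einterval 0 (ereal t)" by (simp add: einterval_0_ereal)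
      have tL: "ereal t \<le> L" using t unfolding einterval_0_mem by (rule less_imp_le[OF conjunct2])
      have sub: "{0<..<t} \<subseteq> einterval 0 L" using Ioo_subset_einterval_0[OF t] by simp
      have w: "?w \<in> borel_measurable (lebesgue_on {0<..<t})"
        by (rule measurable_lebesgue_on_subset[OF powr_times_SV_measurable[OF assms(4)] sub])
      have "ennreal k * wnorm q {0<..<t} ?w (rearr L f) = wnorm q {0<..<t} ?w (\<lambda>u. ennreal k * rearr L f u)"
        by (rule wnorm_cmult[OF assms(3) w, symmetric]) (simp only: i g)
      also have "\<dots> \<le> ennreal K3 * wnorm q {0<..<t} ?w (H_lower L V W f)"
        unfolding i
      proof (rule K3(2)[OF tL H_lower_antimono_on[OF assms(6,7)]])
        show "(\<lambda>u. ennreal k * rearr L f u) \<in> borel_measurable (lebesgue_on (einterval 0 (ereal t)))"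
          using g by measurable
        fix u assume u: "u \<in> einterval 0 (ereal t)"
        then have uL: "u \<in> einterval 0 L" and u0: "0 < u"
          using sub i by (auto simp: einterval_0_mem)
        have "ennreal k * rearr L f u \<le> ennreal k * (ennreal K1 * H_lower L V W f (u / 2))"
          by (intro mult_left_mono K1(2)[OF uL]) simp
        also have "\<dots> = ennreal (((u / 2) / u) powr ?\<alpha>) * H_lower L V W f (u / 2)"
          using K1(1) u0 by (simp add: k_def mult.assoc[symmetric] ennreal_mult[symmetric])
        also have "\<dots> \<le> (SUP v\<in>{0<..<u}. ennreal ((v / u) powr ?\<alpha>) * H_lower L V W f v)"
          using u0 by (intro SUP_upper) auto
        finally show "ennreal k * rearr L f u \<le> (SUP v\<in>{0<..<u}. ennreal ((v / u) powr ?\<alpha>) * H_lower L V W f v)" .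
      qed
      finally have "ennreal (1 / k) * (ennreal k * wnorm q {0<..<t} ?w (rearr L f))
          \<le> ennreal (1 / k) * (ennreal K3 * wnorm q {0<..<t} ?w (H_lower L V W f))"
        by (rule mult_left_mono) simp
      then show "wnorm q {0<..<t} ?w (rearr L f) \<le> ennreal (K3 / k) * wnorm q {0<..<t} ?w (H_lower L V W f)"
        using k K3(1) by (simp add: mult.assoc[symmetric] ennreal_mult[symmetric])
    qed (use K3(1) k in simp)
  qed
qed

lemma equiv_H_lower:
  assumes "0 < p" "0 < r" "0 < q" "a \<in> SV L" "b \<in> SV L" "0 < W" "W < \<infinity>" "0 < V" "p < V"
  shows "equiv_on (Mfun L) (LL_norm L p r b q a) (\<lambda>f. B_norm L p r b q a (H_lower L V W f))"
proof -
  obtain K where K: "0 < K" "\<And>f. LL_norm L p r b q a f \<le> ennreal K * B_norm L p r b q a (H_lower L V W f)"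
    using LL_norm_le_B_norm_H_lower[OF assms(1-6,8)] by metis
  obtain K' where K': "0 < K'" "\<And>f. B_norm L p r b q a (H_lower L V W f) \<le> ennreal K' * LL_norm L p r b q a f"
    using B_norm_H_lower_le[OF assms] by metis
  show ?thesis by (rule equiv_onI[OF K(1) K'(1) K(2) K'(2)])
qed

section \<open>Test functions\<close>

text \<open>If y < h t is still exceeded at some t' > t, the set where \<open>h\<close> exceeds y
  contains (0, t') and has measure greater than t, so y is not admissible in the infimum. Such a
  condition from the right is unavoidable, because the infimum admits sets of measure equal to
  t.\<close>

lemma rearr_eq:
  fixes h :: "real \<Rightarrow> real"
  assumes [measurable]: "h \<in> borel_measurable borel"
    and h: "antimono_on (einterval 0 L) h" "\<And>x. 0 \<le> h x"
    and t: "t \<in> einterval 0 L"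
    and right: "\<And>y. y < h t \<Longrightarrow> \<exists>t'>t. t' \<in> einterval 0 L \<and> y < h t'"
  shows "rearr L (\<lambda>x. complex_of_real (h x)) t = ennreal (h t)"
proof (rule antisym)
  have t0: "0 < t" using t by (simp add: einterval_0_mem)
  show "rearr L (\<lambda>x. complex_of_real (h x)) t \<le> ennreal (h t)"
  proof (rule ennreal_le_epsilon)
    fix e :: real assume e: "0 < e"
    define y where "y = h t + e"
    have "{x \<in> einterval 0 L. cmod (complex_of_real (h x)) > y} \<subseteq> {0<..<t}"
    proof
      fix x assume x: "x \<in> {x \<in> einterval 0 L. cmod (complex_of_real (h x)) > y}"
      then have "h t < h x" using h(2)[of x] e by (simp add: y_def)
      then have "\<not> t \<le> x" using monotone_onD[OF h(1) t, of x] x by auto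
      then show "x \<in> {0<..<t}" using x by (simp add: einterval_0_mem)
    qed
    then have "emeasure lebesgue {x \<in> einterval 0 L. cmod (complex_of_real (h x)) > y} \<le> emeasure lebesgue {0<..<t}"
      by (rule emeasure_mono) simp
    then have "emeasure lebesgue {x \<in> einterval 0 L. cmod (complex_of_real (h x)) > y} \<le> ennreal t"
      using t0 by simp
    moreover have "0 < y" using h(2)[of t] e by (simp add: y_def)
    ultimately have "rearr L (\<lambda>x. complex_of_real (h x)) t \<le> ennreal y"
      unfolding rearr_def by (intro Inf_lower) blast
    also have "ennreal y = ennreal (h t) + ennreal e"
      using h(2)[of t] e by (simp add: y_def)
    finally show "rearr L (\<lambda>x. complex_of_real (h x)) t \<le> ennreal (h t) + ennreal e" .
  qed
  show "ennreal (h t) \<le> rearr L (\<lambda>x. complex_of_real (h x)) t"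
    unfolding rearr_def
  proof (rule Inf_greatest, clarify)
    fix y :: real assume y: "0 < y"
      and le: "emeasure lebesgue {x \<in> einterval 0 L. cmod (complex_of_real (h x)) > y} \<le> ennreal t"
    show "ennreal (h t) \<le> ennreal y"
    proof (rule ccontr)
      assume "\<not> ?thesis"
      then have "y < h t" by (meson ennreal_leI not_le)
      then obtain t' where t': "t < t'" "t' \<in> einterval 0 L" "y < h t'" using right by blast
      have "{0<..<t'} \<subseteq> {x \<in> einterval 0 L. cmod (complex_of_real (h x)) > y}"
      proof
        fix x assume x: "x \<in> {0<..<t'}"
        then have xL: "x \<in> einterval 0 L" using Ioo_subset_einterval_0[OF t'(2), of 0] by auto
        have "h t' \<le> h x" using monotone_onD[OF h(1) xL t'(2)] x by simp
        then show "x \<in> {x \<in> einterval 0 L. cmod (complex_of_real (h x)) > y}"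
          using xL t'(3) h(2)[of x] by simp
      qed
      moreover have "{x \<in> einterval 0 L. cmod (complex_of_real (h x)) > y} \<in> sets lebesgue"
      proof -
        have "{x \<in> space borel. x \<in> einterval 0 L \<and> cmod (complex_of_real (h x)) > y} \<in> sets borel"
          by measurable
        then show ?thesis by simp
      qed
      ultimately have "emeasure lebesgue {0<..<t'} \<le> ennreal t"
        by (rule order_trans[OF emeasure_mono le])
      then show False using t' t0 by (simp add: ennreal_le_iff)
    qed
  qed
qed

text \<open>One family for all test functions: on (0, L), \<open>\<theta> = \<delta> = 0\<close>
  gives the indicator of (0, d), \<open>\<delta> = 0\<close> the pure power cut off at d, and
  \<open>\<delta> > 0\<close> this power frozen at its value in \<delta> for smaller arguments (if
  \<open>\<delta> < d\<close>).\<close>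

definition cut_power :: "real \<Rightarrow> real \<Rightarrow> real \<Rightarrow> real \<Rightarrow> real" where
  "cut_power \<theta> \<delta> d x = (if x < d then max x \<delta> powr (- \<theta>) else 0)"

lemma cut_power_nonneg [simp]: "0 \<le> cut_power \<theta> \<delta> d x"
  by (simp add: cut_power_def)

lemma cut_power_measurable [measurable]: "cut_power \<theta> \<delta> d \<in> borel_measurable borel"
  unfolding cut_power_def by measurable

lemma cut_power_antimono:
  assumes "0 \<le> \<theta>" "0 < x" "x \<le> y"
  shows "cut_power \<theta> \<delta> d y \<le> cut_power \<theta> \<delta> d x"
  using assms by (auto simp: cut_power_def intro!: powr_mono2')

lemma cut_power_in_Mfun: "(\<lambda>x. complex_of_real (cut_power \<theta> \<delta> d x)) \<in> Mfun L"
  unfolding Mfun_def by (rule borel_measurable_lebesgue_on) measurable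

lemma rearr_cut_power:
  assumes "0 \<le> \<theta>" "d \<in> einterval 0 L" "t \<in> einterval 0 L"
  shows "rearr L (\<lambda>x. complex_of_real (cut_power \<theta> \<delta> d x)) t = ennreal (cut_power \<theta> \<delta> d t)"
proof (rule rearr_eq[OF _ _ _ assms(3)])
  show "antimono_on (einterval 0 L) (cut_power \<theta> \<delta> d)"
    using assms(1) by (intro monotone_onI cut_power_antimono) (auto simp: einterval_0_mem)
  fix y assume y: "y < cut_power \<theta> \<delta> d t"
  have t0: "0 < t" using assms(3) by (simp add: einterval_0_mem)
  show "\<exists>t'>t. t' \<in> einterval 0 L \<and> y < cut_power \<theta> \<delta> d t'"
  proof (cases "t < d")
    case True
    have "((\<lambda>x. max x \<delta> powr (- \<theta>)) \<longlongrightarrow> max t \<delta> powr (- \<theta>)) (at_right t)"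
      using t0 by (intro tendsto_intros) auto
    then have "\<forall>\<^sub>F x in at_right t. y < max x \<delta> powr (- \<theta>)"
      by (rule order_tendstoD(1)) (use y True in \<open>simp add: cut_power_def\<close>)
    moreover have "\<forall>\<^sub>F x in at_right t. x \<in> {t<..<d}"
      by (rule eventually_at_right_real[OF True])
    ultimately have "\<forall>\<^sub>F x in at_right t. x \<in> {t<..<d} \<and> y < max x \<delta> powr (- \<theta>)"
      by eventually_elim simp
    then obtain t' where "t' \<in> {t<..<d}" "y < max t' \<delta> powr (- \<theta>)"
      using eventually_happens by force
    then show ?thesis
      using t0 einterval_0_down[OF assms(2), of t'] by (intro exI[of _ t']) (auto simp: cut_power_def)
  next
    case False
    \<comment> \<open>From d on the function vanishes, so any later point of the open interval
      serves.\<close>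
    then have "y < 0" using y by (simp add: cut_power_def)
    obtain z where z: "ereal t < z" "z < L"
      using dense[of "ereal t" L] assms(3) by (auto simp: einterval_0_mem)
    then obtain t' where "z = ereal t'" by (cases z) auto
    then show ?thesis using z t0 \<open>y < 0\<close> cut_power_nonneg[of \<theta> \<delta> d t']
      by (intro exI[of _ t']) (auto simp: einterval_0_mem intro: less_le_trans)
  qed
qed auto

lemma rearr_null_fun:
  assumes "f \<in> null_funs L" shows "rearr L f t = 0"
proof -
  have "rearr L f t \<le> 0"
  proof (rule ennreal_le_epsilon)
    fix e :: real assume e: "0 < e"
    have "AE x in lebesgue_on (einterval 0 L). f x = 0"
      using assms by (simp add: null_funs_def)
    then have "AE x in lebesgue. \<not> (x \<in> einterval 0 L \<and> cmod (f x) > e)"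
      by (subst (asm) AE_restrict_space_iff) (use e in \<open>auto elim!: eventually_mono\<close>)
    then obtain N where N: "N \<in> null_sets lebesgue" "{x \<in> einterval 0 L. cmod (f x) > e} \<subseteq> N"
      unfolding eventually_ae_filter by auto
    have "emeasure lebesgue {x \<in> einterval 0 L. cmod (f x) > e} \<le> emeasure lebesgue N"
      using N by (intro emeasure_mono) auto
    also have "\<dots> = 0" using N by auto
    finally have "emeasure lebesgue {x \<in> einterval 0 L. cmod (f x) > e} \<le> ennreal t" by simp
    then have "rearr L f t \<le> ennreal e"
      unfolding rearr_def using e by (intro Inf_lower) blast
    then show "rearr L f t \<le> 0 + ennreal e" by simp
  qed
  then show ?thesis by simp
qed

section \<open>Quasi-triangle inequality and positivity for the double norm\<close>

lemma B_norm_add: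
  assumes "0 < r" "0 < q" "a \<in> SV L" "b \<in> SV L"
    and g: "g \<in> borel_measurable (lebesgue_on (einterval 0 L))"
    and h: "h \<in> borel_measurable (lebesgue_on (einterval 0 L))"
  shows "B_norm L p r b q a (\<lambda>x. g x + h x)
    \<le> ennreal (2 * 2 powr rcp q * (2 * 2 powr rcp r)) * (B_norm L p r b q a g + B_norm L p r b q a h)"
proof -
  let ?w = "\<lambda>u. u powr rcp p * a u" and ?A = "einterval 0 L"
  let ?I = "\<lambda>g t. wnorm q {0<..<t} ?w g"
  have w: "?w \<in> borel_measurable (lebesgue_on ?A)" by (rule powr_times_SV_measurable[OF assms(3)])
  have b: "b \<in> borel_measurable (lebesgue_on ?A)" by (rule SV_measurable[OF assms(4)])
  note I = wnorm_Ioo_measurable[OF assms(2) w]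
  have bpos: "0 \<le> b u" if "u \<in> ?A" for u using SV_pos[OF assms(4) that] by simp
  have "B_norm L p r b q a (\<lambda>x. g x + h x)
      \<le> wnorm r ?A b (\<lambda>t. ennreal (2 * 2 powr rcp q) * (?I g t + ?I h t))"
    unfolding B_norm_eq_wnorm
  proof (rule wnorm_mono[OF assms(1) b I[OF borel_measurable_add[OF g h]]])
    fix t assume t: "t \<in> ?A"
    have sub: "{0<..<t} \<subseteq> ?A" using Ioo_subset_einterval_0[OF t] by simp
    show "0 \<le> b t" "0 \<le> b t" using bpos[OF t] by auto
    show "ennreal (b t) * ?I (\<lambda>x. g x + h x) t \<le> ennreal (b t) * (ennreal (2 * 2 powr rcp q) * (?I g t + ?I h t))"
      by (intro mult_left_mono wnorm_add[OF assms(2)] measurable_lebesgue_on_subset[OF _ sub] w g h) simp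
  qed
  also have "\<dots> = ennreal (2 * 2 powr rcp q) * wnorm r ?A b (\<lambda>t. ?I g t + ?I h t)"
    by (rule wnorm_cmult[OF assms(1) b borel_measurable_add[OF I[OF g] I[OF h]]])
  also have "\<dots> \<le> ennreal (2 * 2 powr rcp q) * (ennreal (2 * 2 powr rcp r) * (wnorm r ?A b (?I g) + wnorm r ?A b (?I h)))"
    by (intro mult_left_mono wnorm_add[OF assms(1) b I[OF g] I[OF h]]) simp
  finally show ?thesis
    unfolding B_norm_eq_wnorm by (simp only: ennreal_mult mult.assoc zero_le_mult_iff zero_le_numeral powr_ge_zero simp_thms)
qed

lemma wnorm_pos:
  assumes "0 < q" and [measurable]: "w \<in> borel_measurable (lebesgue_on {x<..<y})" "g \<in> borel_measurable (lebesgue_on {x<..<y})"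
    and "0 \<le> x" "x < y" "\<And>u. u \<in> {x<..<y} \<Longrightarrow> 0 < w u" "\<And>u. u \<in> {x<..<y} \<Longrightarrow> 0 < g u"
  shows "0 < wnorm q {x<..<y} w g"
  unfolding wnorm_def
proof (rule Lnorm_pos[OF assms(1) _ _ assms(5)])
  show "(\<lambda>u. ennreal (u powr (- rcp q) * w u) * g u) \<in> borel_measurable (lebesgue_on {x<..<y})"
    by measurable
  fix u assume u: "u \<in> {x<..<y}"
  then have "0 < u powr (- rcp q) * w u" using assms(4) assms(6)[OF u] by auto
  then show "0 < ennreal (u powr (- rcp q) * w u) * g u"
    using assms(7)[OF u] by (simp add: ennreal_zero_less_mult_iff)
qed

text \<open>Every inner interval starts at 0, so positivity of \<open>g\<close> near 0 makes all
  inner norms with t < d positive. This is half of what is needed to cancel the norm of a test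
  function.\<close>

lemma B_norm_pos:
  assumes "0 < r" "0 < q" "a \<in> SV L" "b \<in> SV L" "d \<in> einterval 0 L"
    and g: "g \<in> borel_measurable (lebesgue_on (einterval 0 L))" "\<And>u. u \<in> {0<..<d} \<Longrightarrow> 0 < g u"
  shows "0 < B_norm L p r b q a g"
proof -
  let ?w = "\<lambda>u. u powr rcp p * a u" and ?A = "einterval 0 L"
  have d: "0 < d" "{0<..<d} \<subseteq> ?A"
    using assms(5) Ioo_subset_einterval_0[OF assms(5)] by (auto simp: einterval_0_mem)
  have w: "?w \<in> borel_measurable (lebesgue_on ?A)" by (rule powr_times_SV_measurable[OF assms(3)])
  have b: "b \<in> borel_measurable (lebesgue_on ?A)" by (rule SV_measurable[OF assms(4)])
  note I = wnorm_Ioo_measurable[OF assms(2) w g(1)]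
  have "0 < wnorm r {0<..<d} b (\<lambda>t. wnorm q {0<..<t} ?w g)"
  proof (rule wnorm_pos[OF assms(1) _ _ _ d(1)])
    fix t assume t: "t \<in> {0<..<d}"
    then have sub: "{0<..<t} \<subseteq> ?A" using d by auto
    show "0 < b t" using SV_pos[OF assms(4)] t d by auto
    show "0 < wnorm q {0<..<t} ?w g"
    proof (rule wnorm_pos[OF assms(2)])
      show "?w \<in> borel_measurable (lebesgue_on {0<..<t})" "g \<in> borel_measurable (lebesgue_on {0<..<t})"
        by (rule measurable_lebesgue_on_subset[OF _ sub], fact)+
      show "0 < ?w u" if "u \<in> {0<..<t}" for u
        using SV_pos[OF assms(3), of u] that sub by auto
      show "0 < g u" if "u \<in> {0<..<t}" for u
        using that t g(2)[of u] by auto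
    qed (use t in auto)
  qed (use measurable_lebesgue_on_subset[OF b d(2)] measurable_lebesgue_on_subset[OF I d(2)] in auto)
  also have "\<dots> \<le> wnorm r ?A b (\<lambda>t. wnorm q {0<..<t} ?w g)"
    by (rule wnorm_subset[OF assms(1) b I d(2)]) simp_all
  finally show ?thesis unfolding B_norm_eq_wnorm .
qed

text \<open>A function that does not vanish almost everywhere exceeds some y > 0 on a set of measure
  at least some d > 0. Its rearrangement is then at least y on (0, d) and dominates a multiple of
  the indicator of that interval.\<close>

lemma nontrivial_cut_power:
  assumes "L = 1 \<or> L = \<infinity>" "0 < r" "0 < q" "a \<in> SV L" "b \<in> SV L" "LL_space L p r b q a \<noteq> null_funs L"
  obtains d where "d \<in> einterval 0 L" "B_norm L p r b q a (\<lambda>x. ennreal (cut_power 0 0 d x)) < \<infinity>"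
proof -
  \<comment> \<open>Null functions always belong to the space, so the two sets can differ only by an
    element that is not a null function.\<close>
  have "null_funs L \<subseteq> LL_space L p r b q a"
  proof
    fix f assume f: "f \<in> null_funs L"
    have "rearr L f = (\<lambda>_. 0)"
      by (rule ext, rule rearr_null_fun[OF f])
    then have "LL_norm L p r b q a f = B_norm L p r b q a (\<lambda>_. 0)"
      unfolding LL_norm_def by simp
    also have "\<dots> = 0" unfolding B_norm_def using assms by (simp add: Lnorm_zero)
    finally show "f \<in> LL_space L p r b q a" using f by (simp add: LL_space_def null_funs_def)
  qed
  then obtain f where f: "f \<in> LL_space L p r b q a" "f \<notin> null_funs L" using assms(6) by blast
  then have fM: "f \<in> borel_measurable (lebesgue_on (einterval 0 L))" and fin: "LL_norm L p r b q a f < \<infinity>"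
    by (auto simp: LL_space_def Mfun_def)
  have nAE: "\<not> (AE x in lebesgue_on (einterval 0 L). f x = 0)"
    using f fM by (simp add: null_funs_def Mfun_def)
  define S where "S = (\<lambda>y. {x \<in> einterval 0 L. cmod (f x) > y})"
  have S: "S y \<in> sets lebesgue" for y
  proof -
    have "{x \<in> space (lebesgue_on (einterval 0 L)). cmod (f x) > y} \<in> sets (lebesgue_on (einterval 0 L))"
      using fM by measurable
    then show ?thesis by (simp add: S_def sets_restrict_space_iff)
  qed
  have "\<exists>n. emeasure lebesgue (S (1 / Suc n)) \<noteq> 0"
  proof (rule ccontr)
    assume "\<not> ?thesis"
    then have "AE x in lebesgue. x \<notin> S (1 / Suc n)" for n
      using S by (intro AE_not_in) (auto simp: null_sets_def)
    then have "AE x in lebesgue. \<forall>n. x \<notin> S (1 / Suc n)"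
      by (simp add: AE_all_countable)
    then have "AE x in lebesgue. x \<in> einterval 0 L \<longrightarrow> f x = 0"
    proof eventually_elim
      case (elim x)
      show ?case
      proof (rule impI, rule ccontr)
        assume x: "x \<in> einterval 0 L" "f x \<noteq> 0"
        then obtain n where "inverse (real (Suc n)) < cmod (f x)"
          using reals_Archimedean[of "cmod (f x)"] by auto
        then show False using elim x by (auto simp: S_def inverse_eq_divide)
      qed
    qed
    then show False using nAE by (simp add: AE_restrict_space_iff)
  qed
  then obtain y where y: "0 < y" "emeasure lebesgue (S y) \<noteq> 0"
    by (metis of_nat_0_less_iff zero_less_Suc zero_less_divide_1_iff)
  \<comment> \<open>The bound 1/2 puts d inside (0, L) for both values of \<open>L\<close>, and it
    also covers a level set of infinite measure.\<close>
  obtain d where d: "0 < d" "d \<le> 1 / 2" "ennreal d \<le> emeasure lebesgue (S y)"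
  proof (cases "emeasure lebesgue (S y)")
    case (real x)
    then show ?thesis using y(2) by (intro that[of "min (1 / 2) x"]) (auto intro: ennreal_leI)
  qed (auto intro: that[of "1 / 2"])
  have dL: "d \<in> einterval 0 L"
    using d(1,2) assms(1) by (auto simp: einterval_0_mem one_ereal_def)
  have ge: "ennreal y \<le> rearr L f t" if t: "0 < t" "t < d" for t
    unfolding rearr_def
  proof (rule Inf_greatest, clarify)
    fix z :: real assume z: "0 < z" "emeasure lebesgue {x \<in> einterval 0 L. cmod (f x) > z} \<le> ennreal t"
    show "ennreal y \<le> ennreal z"
    proof (rule ccontr)
      assume "\<not> ?thesis"
      then have "z < y" by (meson ennreal_leI not_le)
      then have "emeasure lebesgue (S y) \<le> emeasure lebesgue (S z)"
        using S by (intro emeasure_mono) (auto simp: S_def)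
      then have "ennreal d \<le> ennreal t" using d(3) z(2) unfolding S_def by (meson order_trans)
      then show False using t by (simp add: ennreal_le_iff)
    qed
  qed
  have "B_norm L p r b q a (\<lambda>x. ennreal (cut_power 0 0 d x)) \<le> ennreal (1 / y) * B_norm L p r b q a (rearr L f)"
  proof (rule B_norm_mono_fun[OF assms(2-5)])
    fix u assume u: "u \<in> einterval 0 L"
    show "ennreal (cut_power 0 0 d u) \<le> ennreal (1 / y) * rearr L f u"
    proof (cases "u < d")
      case True
      then have u0: "0 < u" using u by (simp add: einterval_0_mem)
      have "ennreal (1 / y) * ennreal y \<le> ennreal (1 / y) * rearr L f u"
        by (rule mult_left_mono[OF ge[OF u0 True]]) simp
      then show ?thesis using y(1) True u0 by (simp add: cut_power_def ennreal_mult[symmetric])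
    qed (simp add: cut_power_def)
  qed (use y(1) rearr_measurable[OF is_interval_einterval] in \<open>auto intro: borel_measurable_lebesgue_on\<close>)
  also have "\<dots> < \<infinity>"
    using fin unfolding LL_norm_def by (simp add: ennreal_mult_less_top)
  finally show ?thesis using that dL by blast
qed

section \<open>Sharpness of the ranges\<close>

lemma Lnorm_le_zero_outside:
  assumes "0 < q" "A \<in> sets borel" "B \<in> sets borel" "A \<subseteq> B"
    and F: "F \<in> borel_measurable (lebesgue_on B)" "\<And>x. x \<in> B - A \<Longrightarrow> F x = 0"
  shows "Lnorm q B F \<le> Lnorm q A F"
  using assms(1)
proof (cases rule: ereal_pos_cases)
  case 1
  have sA: "A \<inter> space lebesgue \<in> sets lebesgue" and sB: "B \<inter> space lebesgue \<in> sets lebesgue"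
    using assms(2,3) by auto
  have "AE x in lebesgue_on A. F x \<le> esssup (lebesgue_on A) F"
    by (rule esssup_AE)
  then have "AE x in lebesgue. x \<in> A \<longrightarrow> F x \<le> esssup (lebesgue_on A) F"
    by (simp only: AE_restrict_space_iff[OF sA])
  then have "AE x in lebesgue. x \<in> B \<longrightarrow> F x \<le> esssup (lebesgue_on A) F"
  proof (rule eventually_mono)
    fix x assume "x \<in> A \<longrightarrow> F x \<le> esssup (lebesgue_on A) F"
    then show "x \<in> B \<longrightarrow> F x \<le> esssup (lebesgue_on A) F"
      using F(2)[of x] by (cases "x \<in> A") auto
  qed
  then have "AE x in lebesgue_on B. F x \<le> esssup (lebesgue_on A) F"
    by (simp only: AE_restrict_space_iff[OF sB])
  then have "esssup (lebesgue_on B) F \<le> esssup (lebesgue_on A) F"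
    by (rule esssup_I[OF F(1)])
  then show ?thesis by (simp only: 1 Lnorm_infinity)
next
  case (2 Q)
  have "(\<integral>\<^sup>+ x. epow (F x) Q * indicator B x \<partial>lebesgue) \<le> (\<integral>\<^sup>+ x. epow (F x) Q * indicator A x \<partial>lebesgue)"
    using F(2) by (intro nn_integral_mono) (auto split: split_indicator)
  then have "(\<integral>\<^sup>+ x. epow (F x) Q \<partial>lebesgue_on B) \<le> (\<integral>\<^sup>+ x. epow (F x) Q \<partial>lebesgue_on A)"
    using assms(2,3) by (simp add: nn_integral_restrict_space)
  then show ?thesis
    using 2 by (auto simp: Lnorm_ereal intro!: epow_mono)
qed

lemma wnorm_le_zero_outside:
  assumes "0 < q" "A \<in> sets borel" "B \<in> sets borel" "A \<subseteq> B"
    and [measurable]: "w \<in> borel_measurable (lebesgue_on B)" "g \<in> borel_measurable (lebesgue_on B)"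
    and "\<And>x. x \<in> B - A \<Longrightarrow> g x = 0"
  shows "wnorm q B w g \<le> wnorm q A w g"
  unfolding wnorm_def using assms(7) by (intro Lnorm_le_zero_outside[OF assms(1-4)]) auto

text \<open>Stands in for division by \<open>x\<close>, which may be infinite.\<close>

lemma ex_real_mult_ge:
  fixes x :: ennreal
  assumes "0 < x" shows "\<exists>K>0. ennreal k \<le> ennreal K * x"
proof (cases x)
  case (real y)
  then have "0 < y" using assms by simp
  have "ennreal k \<le> ennreal ((\<bar>k\<bar> + 1) / y * y)"
    using \<open>0 < y\<close> by (intro ennreal_leI) simp
  also have "\<dots> = ennreal ((\<bar>k\<bar> + 1) / y) * x"
    unfolding real using \<open>0 < y\<close> by (intro ennreal_mult) auto
  finally have "ennreal k \<le> ennreal ((\<bar>k\<bar> + 1) / y) * x" .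
  then show ?thesis using \<open>0 < y\<close> by (intro exI[of _ "(\<bar>k\<bar> + 1) / y"]) (auto intro: divide_pos_pos)
next
  case top
  then show ?thesis by (intro exI[of _ 1]) simp
qed

lemma ennreal_one_le_if_le_mult:
  assumes "x \<le> ennreal k * x" "0 < x" "x < \<infinity>"
  shows "1 \<le> k"
proof (cases x)
  case (real y)
  then have y: "0 < y" using assms(2) by simp
  show ?thesis
  proof (rule ccontr)
    assume "\<not> ?thesis"
    \<comment> \<open>\<open>ennreal\<close> sends negative numbers to 0, hence the truncation
      \<open>max k 0\<close>.\<close>
    then have "ennreal k * x \<le> ennreal (max k 0) * x" "max k 0 * y < y"
      using y by (auto intro!: mult_right_mono ennreal_leI)
    then have "ennreal y \<le> ennreal (max k 0 * y)"
      using assms(1) real by (simp add: ennreal_mult)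
    then show False using y \<open>max k 0 * y < y\<close> by (simp add: ennreal_le_iff)
  qed
qed (use assms in auto)

lemma cut_power_measurable_on:
  "(\<lambda>x. ennreal (cut_power \<theta> \<delta> d x)) \<in> borel_measurable (lebesgue_on A)"
  by (rule borel_measurable_lebesgue_on) measurable

text \<open>Up to d the inner norm is at most a multiple of t powr \<eta> * a t, and the outer norm
  of t powr \<eta> * (a t * b t) on (0, d) is finite because \<eta> is positive. Beyond d the inner
  norm no longer grows and is at most a multiple of that of the indicator of (0, d), whose double
  norm is finite by assumption; this controls \<open>b\<close> up to \<open>L\<close>.\<close>

lemma B_norm_cut_power_finite:
  assumes "0 < r" "0 < q" "a \<in> SV L" "b \<in> SV L" "d \<in> einterval 0 L"
    and fin: "B_norm L p r b q a (\<lambda>x. ennreal (cut_power 0 0 d x)) < \<infinity>"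
    and \<theta>: "0 \<le> \<theta>" "\<theta> < rcp p"
  shows "B_norm L p r b q a (\<lambda>x. ennreal (cut_power \<theta> 0 d x)) < \<infinity>"
proof -
  let ?w = "\<lambda>u. u powr rcp p * a u" and ?A = "einterval 0 L"
  let ?I = "\<lambda>g t. wnorm q {0<..<t} ?w g"
  let ?F = "\<lambda>x. ennreal (cut_power \<theta> 0 d x)" and ?E = "\<lambda>x. ennreal (cut_power 0 0 d x)"
  define \<eta> where "\<eta> = rcp p - \<theta>"
  have \<eta>: "0 < \<eta>" using \<theta> by (simp add: \<eta>_def)
  have d0: "0 < d" using assms(5) by (simp add: einterval_0_mem)
  have ab: "(\<lambda>t. a t * b t) \<in> SV L" by (rule SV_mult[OF assms(3,4)])
  have w: "?w \<in> borel_measurable (lebesgue_on ?A)" by (rule powr_times_SV_measurable[OF assms(3)])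
  have b: "b \<in> borel_measurable (lebesgue_on ?A)" by (rule SV_measurable[OF assms(4)])
  have a: "a \<in> borel_measurable (lebesgue_on ?A)" by (rule SV_measurable[OF assms(3)])
  have subd: "{0<..<d} \<subseteq> ?A" using Ioo_subset_einterval_0[OF assms(5)] by simp
  obtain K where K: "0 < K" "\<And>t. t \<in> ?A \<Longrightarrow>
      wnorm q {0<..<t} (\<lambda>u. u powr \<eta> * a u) (\<lambda>_. 1) \<le> ennreal (K * (t powr \<eta> * a t))"
    using wnorm_powr_times_SV_le[OF assms(2,3) \<eta>] by blast
  obtain K' where K': "0 < K'" "\<And>t. t \<in> ?A \<Longrightarrow>
      wnorm r {0<..<t} (\<lambda>u. u powr \<eta> * (a u * b u)) (\<lambda>_. 1) \<le> ennreal (K' * (t powr \<eta> * (a t * b t)))"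
    using wnorm_powr_times_SV_le[OF assms(1) ab \<eta>] by blast
  have I1: "?I ?F t \<le> ennreal (K * (t powr \<eta> * a t))" if t: "t \<in> ?A" "t \<le> d" for t
  proof -
    have sub: "{0<..<t} \<subseteq> ?A" using Ioo_subset_einterval_0[OF t(1)] by simp
    have "?I ?F t = wnorm q {0<..<t} (\<lambda>u. u powr \<eta> * a u) (\<lambda>_. 1)"
    proof (rule wnorm_cong)
      fix u assume u: "u \<in> {0<..<t}"
      then have au: "0 < a u" using sub SV_pos[OF assms(3), of u] by auto
      then show "0 \<le> ?w u" "0 \<le> u powr \<eta> * a u" by auto
      have "?w u * cut_power \<theta> 0 d u = u powr \<eta> * a u"
        using u t(2) by (simp add: cut_power_def \<eta>_def powr_diff powr_minus_divide)
      then show "ennreal (?w u) * ?F u = ennreal (u powr \<eta> * a u) * 1"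
        using au by (simp add: ennreal_mult[symmetric])
    qed
    then show ?thesis using K(2)[OF t(1)] by simp
  qed
  have i_pos: "0 < ?I ?E d"
  proof (rule wnorm_pos[OF assms(2) measurable_lebesgue_on_subset[OF w subd] cut_power_measurable_on _ d0])
    fix u assume u: "u \<in> {0<..<d}"
    then show "0 < ?w u" using subd SV_pos[OF assms(3), of u] by auto
    show "0 < ?E u" using u by (simp add: cut_power_def)
  qed simp
  obtain k where k: "0 < k" "ennreal (K * (d powr \<eta> * a d)) \<le> ennreal k * ?I ?E d"
    using ex_real_mult_ge[OF i_pos] by metis
  have I2: "?I ?F t \<le> ennreal k * ?I ?E t" if t: "t \<in> ?A" "d < t" for t
  proof -
    have sub: "{0<..<t} \<subseteq> ?A" using Ioo_subset_einterval_0[OF t(1)] by simp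
    have "?I ?F t \<le> ?I ?F d"
      by (rule wnorm_le_zero_outside[OF assms(2)])
        (use t measurable_lebesgue_on_subset[OF w sub] cut_power_measurable_on in \<open>auto simp: cut_power_def\<close>)
    also have "\<dots> \<le> ennreal k * ?I ?E d"
      using I1[OF assms(5)] k(2) by (meson order_refl order_trans)
    also have "?I ?E d \<le> ?I ?E t"
      by (rule wnorm_subset[OF assms(2) measurable_lebesgue_on_subset[OF w sub] cut_power_measurable_on])
        (use t in auto)
    finally show ?thesis by (simp add: mult_left_mono)
  qed
  define G where "G = (\<lambda>t. ennreal (K * (t powr \<eta> * a t)) * ?E t)"
  have G: "G \<in> borel_measurable (lebesgue_on ?A)"
    unfolding G_def using a cut_power_measurable_on[of 0 0 d ?A] by measurable
  have IE: "?I ?E \<in> borel_measurable (lebesgue_on ?A)"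
    by (rule wnorm_Ioo_measurable[OF assms(2) w cut_power_measurable_on])
  have IE': "(\<lambda>t. ennreal k * ?I ?E t) \<in> borel_measurable (lebesgue_on ?A)"
    using IE by measurable
  have bpos: "0 \<le> b u" if "u \<in> ?A" for u using SV_pos[OF assms(4) that] by simp
  have le: "?I ?F t \<le> G t + ennreal k * ?I ?E t" if t: "t \<in> ?A" for t
  proof (cases "t < d")
    case True
    then have "?E t = 1" using t by (simp add: cut_power_def einterval_0_mem)
    then have "?I ?F t \<le> G t" using I1[OF t] True by (simp add: G_def)
    then show ?thesis by (rule order_trans) simp
  next
    case False
    \<comment> \<open>The cut is strict, so \<open>?E d = 0\<close> and the summand \<open>G\<close>
      vanishes at \<open>t = d\<close>; there the second summand has to carry the bound.\<close>
    show ?thesis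
    proof (cases "t = d")
      case True
      then have "?I ?F t \<le> ennreal k * ?I ?E t" using I1[OF assms(5)] k(2) by (meson order_refl order_trans)
      then show ?thesis by (rule order_trans) simp
    next
      case F: False
      then have "?I ?F t \<le> ennreal k * ?I ?E t" using I2[OF t] False by simp
      then show ?thesis by (rule order_trans) simp
    qed
  qed
  have "B_norm L p r b q a ?F \<le> wnorm r ?A b (\<lambda>t. G t + ennreal k * ?I ?E t)"
    unfolding B_norm_eq_wnorm
    by (rule wnorm_mono[OF assms(1) b wnorm_Ioo_measurable[OF assms(2) w cut_power_measurable_on]])
      (auto intro!: mult_left_mono le bpos)
  also have "\<dots> \<le> ennreal (2 * 2 powr rcp r) * (wnorm r ?A b G + wnorm r ?A b (\<lambda>t. ennreal k * ?I ?E t))"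
    by (rule wnorm_add[OF assms(1) b G IE'])
  also have "\<dots> < \<infinity>"
  proof -
    have "wnorm r ?A b G \<le> wnorm r {0<..<d} b G"
      by (rule wnorm_le_zero_outside[OF assms(1) _ _ subd b G]) (auto simp: G_def cut_power_def einterval_0_mem)
    also have "\<dots> = wnorm r {0<..<d} (\<lambda>u. u powr \<eta> * (a u * b u)) (\<lambda>_. ennreal K * 1)"
    proof (rule wnorm_cong)
      fix u assume u: "u \<in> {0<..<d}"
      then have ab0: "0 < a u" "0 < b u" using subd SV_pos[OF assms(3), of u] SV_pos[OF assms(4), of u] by auto
      then show "0 \<le> b u" "0 \<le> u powr \<eta> * (a u * b u)" by auto
      have "?E u = 1" using u by (simp add: cut_power_def)
      then show "ennreal (b u) * G u = ennreal (u powr \<eta> * (a u * b u)) * (ennreal K * 1)"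
        using ab0 K(1) by (simp add: G_def ennreal_mult[symmetric] mult_ac)
    qed
    also have "\<dots> = ennreal K * wnorm r {0<..<d} (\<lambda>u. u powr \<eta> * (a u * b u)) (\<lambda>_. 1)"
      by (rule wnorm_cmult[OF assms(1) measurable_lebesgue_on_subset[OF powr_times_SV_measurable[OF ab] subd]]) simp
    also have "\<dots> \<le> ennreal K * ennreal (K' * (d powr \<eta> * (a d * b d)))"
      by (rule mult_left_mono[OF K'(2)[OF assms(5)]]) simp
    also have "\<dots> < \<infinity>" by (simp add: ennreal_mult_less_top)
    finally have 1: "wnorm r ?A b G < \<infinity>" .
    have "wnorm r ?A b (\<lambda>t. ennreal k * ?I ?E t) = ennreal k * wnorm r ?A b (?I ?E)"
      by (rule wnorm_cmult[OF assms(1) b IE])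
    also have "\<dots> < \<infinity>"
      using fin unfolding B_norm_eq_wnorm by (simp add: ennreal_mult_less_top)
    finally show ?thesis using 1 by (simp add: ennreal_mult_less_top)
  qed
  finally show ?thesis .
qed

text \<open>For v < u < d the integrand is v powr (1/U - \<rho>) * v powr \<eta>, and the first
  factor is at least its value at u since 1/U is at most \<rho>. The norm of v powr \<eta> over (0,
  u) with respect to dv/v is u powr \<eta> times the constant shown. For u from d on the left side
  is 0.\<close>

lemma H_upper_cut_power_ge:
  assumes "0 < W'" "0 < \<eta>" "\<eta> \<le> \<rho>" "rcp U \<le> \<rho>" "d \<in> einterval 0 L" "u \<in> einterval 0 L"
  shows "ennreal ((\<eta> * W') powr (- 1 / W')) * ennreal (cut_power (\<rho> - \<eta>) 0 d u)
    \<le> H_upper L U (ereal W') (\<lambda>x. complex_of_real (cut_power (\<rho> - \<eta>) 0 d x)) u"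
proof (cases "u < d")
  case True
  have u: "0 < u" using assms(6) by (simp add: einterval_0_mem)
  let ?f = "\<lambda>x. complex_of_real (cut_power (\<rho> - \<eta>) 0 d x)" and ?W = "ereal W'"
  have sub: "{0<..<u} \<subseteq> einterval 0 L" using Ioo_subset_einterval_0[OF assms(6)] by simp
  have "ennreal (u powr (rcp U - \<rho>)) * ennreal (u powr \<eta> * (\<eta> * W') powr (- 1 / W'))
      = Lnorm ?W {0<..<u} (\<lambda>v. ennreal (u powr (rcp U - \<rho>)) * ennreal (v powr (\<eta> - 1 / W')))"
    using assms(1,2) u by (subst Lnorm_cmult) (auto simp: Lnorm_powr_from_0)
  also have "\<dots> \<le> wnorm ?W {0<..<u} (\<lambda>v. v powr rcp U) (rearr L ?f)"
    unfolding wnorm_def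
  proof (rule Lnorm_mono)
    fix v assume v: "v \<in> {0<..<u}"
    then have vL: "v \<in> einterval 0 L" using sub by auto
    have "u powr (rcp U - \<rho>) \<le> v powr (rcp U - \<rho>)"
      using v assms(4) by (intro powr_mono2') auto
    then have "u powr (rcp U - \<rho>) * v powr (\<eta> - 1 / W') \<le> v powr (rcp U - \<rho>) * v powr (\<eta> - 1 / W')"
      by (rule mult_right_mono) simp
    also have "\<dots> = (v powr (- rcp ?W) * v powr rcp U) * cut_power (\<rho> - \<eta>) 0 d v"
      using v True assms(1) by (simp add: cut_power_def rcp_ereal powr_add[symmetric] algebra_simps)
    finally have "ennreal (u powr (rcp U - \<rho>) * v powr (\<eta> - 1 / W'))
        \<le> ennreal ((v powr (- rcp ?W) * v powr rcp U) * cut_power (\<rho> - \<eta>) 0 d v)"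
      by (rule ennreal_leI)
    then show "ennreal (u powr (rcp U - \<rho>)) * ennreal (v powr (\<eta> - 1 / W'))
        \<le> ennreal (v powr (- rcp ?W) * v powr rcp U) * rearr L ?f v"
      using assms(3) by (simp add: rearr_cut_power[OF _ assms(5) vL] ennreal_mult)
  qed (use assms(1) in auto)
  finally have le: "ennreal (u powr (- rcp U)) *
      (ennreal (u powr (rcp U - \<rho>)) * ennreal (u powr \<eta> * (\<eta> * W') powr (- 1 / W')))
      \<le> H_upper L U ?W ?f u"
    unfolding H_upper_eq_wnorm by (rule mult_left_mono) simp
  have eq: "(\<eta> * W') powr (- 1 / W') * cut_power (\<rho> - \<eta>) 0 d u
      = u powr (- rcp U) * (u powr (rcp U - \<rho>) * (u powr \<eta> * (\<eta> * W') powr (- 1 / W')))"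
    using u True by (simp add: cut_power_def mult.assoc[symmetric] powr_add[symmetric])
  show ?thesis
    unfolding ennreal_mult[symmetric, OF powr_ge_zero cut_power_nonneg] eq using le
    by (simp only: ennreal_mult powr_ge_zero mult_nonneg_nonneg)
qed (simp add: cut_power_def)

lemma equiv_on_ge:
  assumes "equiv_on S F G"
  obtains c :: real where "0 < c" "\<And>x. x \<in> S \<Longrightarrow> G x \<le> ennreal c * F x"
proof -
  obtain c where c: "0 < c" "\<And>x. x \<in> S \<Longrightarrow> ennreal c * G x \<le> F x"
    using assms unfolding equiv_on_def by blast
  have "G x \<le> ennreal (1 / c) * F x" if "x \<in> S" for x
  proof -
    have "ennreal (1 / c) * (ennreal c * G x) \<le> ennreal (1 / c) * F x"
      by (rule mult_left_mono[OF c(2)[OF that]]) simp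
    then show ?thesis using c(1) by (simp add: mult.assoc[symmetric] ennreal_mult[symmetric])
  qed
  then show ?thesis using c(1) by (intro that[of "1 / c"]) auto
qed

lemma not_equiv_H_upper:
  assumes "L = 1 \<or> L = \<infinity>" "0 < p" "0 < r" "0 < q" "a \<in> SV L" "b \<in> SV L"
    "LL_space L p r b q a \<noteq> null_funs L" "0 < W" "W < \<infinity>" "U < \<infinity>" "p \<le> U"
  shows "\<not> equiv_on (Mfun L) (LL_norm L p r b q a) (\<lambda>f. B_norm L p r b q a (H_upper L U W f))"
proof
  assume "equiv_on (Mfun L) (LL_norm L p r b q a) (\<lambda>f. B_norm L p r b q a (H_upper L U W f))"
  then obtain c where c: "0 < c"
    "\<And>f. f \<in> Mfun L \<Longrightarrow> B_norm L p r b q a (H_upper L U W f) \<le> ennreal c * LL_norm L p r b q a f"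
    by (rule equiv_on_ge) blast
  obtain d where d: "d \<in> einterval 0 L" "B_norm L p r b q a (\<lambda>x. ennreal (cut_power 0 0 d x)) < \<infinity>"
    using nontrivial_cut_power[OF assms(1,3-7)] .
  obtain W' where W: "W = ereal W'" "0 < W'" using assms(8,9) by (cases W) auto
  have "p < \<infinity>" using assms(11,10) by (rule le_less_trans)
  then have p: "0 < rcp p" using assms(2) by (cases p) (auto simp: rcp_ereal)
  have pU: "rcp U \<le> rcp p" by (rule rcp_antimono[OF assms(2,11)])
  \<comment> \<open>The second entry makes the gain (\<eta> W) powr (- 1/W) at least
    \<open>2 * c\<close>; the first keeps the exponent 1/p - \<eta> nonnegative.\<close>
  define \<eta> where "\<eta> = min (rcp p) ((1 / (2 * c)) powr W' / W')"
  have \<eta>: "0 < \<eta>" "\<eta> \<le> rcp p" using p c(1) W(2) by (auto simp: \<eta>_def)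
  let ?h = "cut_power (rcp p - \<eta>) 0 d"
  let ?f = "\<lambda>x. complex_of_real (?h x)"
  define k where "k = (\<eta> * W') powr (- 1 / W')"
  have k: "2 * c \<le> k"
  proof -
    have "\<eta> * W' \<le> (1 / (2 * c)) powr W'"
      using W(2) by (simp add: \<eta>_def min_mult_distrib_right)
    then have "((1 / (2 * c)) powr W') powr (- 1 / W') \<le> k"
      unfolding k_def using \<eta>(1) W(2) by (intro powr_mono2') auto
    moreover have "((1 / (2 * c)) powr W') powr (- 1 / W') = 2 * c"
      using W(2) c(1) by (simp add: powr_powr powr_minus_divide)
    ultimately show ?thesis by simp
  qed
  have k0: "0 < k" using k c(1) by simp
  have LL: "LL_norm L p r b q a ?f \<le> ennreal 1 * B_norm L p r b q a (\<lambda>x. ennreal (?h x))"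
    unfolding LL_norm_def
    by (rule B_norm_mono_fun[OF assms(3-6) _ cut_power_measurable_on rearr_measurable[OF is_interval_einterval]])
      (use \<eta>(2) in \<open>auto simp: rearr_cut_power[OF _ d(1)]\<close>)
  have "B_norm L p r b q a (\<lambda>x. ennreal (?h x)) \<le> ennreal (1 / k) * B_norm L p r b q a (H_upper L U W ?f)"
  proof (rule B_norm_mono_fun[OF assms(3-6) _ H_upper_measurable[OF assms(8)] cut_power_measurable_on])
    fix u assume u: "u \<in> einterval 0 L"
    have "ennreal (1 / k) * (ennreal k * ennreal (?h u)) \<le> ennreal (1 / k) * H_upper L U W ?f u"
      unfolding W k_def by (intro mult_left_mono H_upper_cut_power_ge W(2) \<eta> pU d(1) u) simp
    then show "ennreal (?h u) \<le> ennreal (1 / k) * H_upper L U W ?f u"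
      using k0 by (simp add: mult.assoc[symmetric] ennreal_mult[symmetric])
  qed (use k0 in simp)
  also have "\<dots> \<le> ennreal (1 / k) * (ennreal c * (ennreal 1 * B_norm L p r b q a (\<lambda>x. ennreal (?h x))))"
    by (intro mult_left_mono order_trans[OF c(2)[OF cut_power_in_Mfun]] LL) simp_all
  also have "\<dots> = ennreal (c / k) * B_norm L p r b q a (\<lambda>x. ennreal (?h x))"
    using k0 c(1) by (simp add: mult.assoc[symmetric] ennreal_mult[symmetric])
  finally have "1 \<le> c / k"
  proof (rule ennreal_one_le_if_le_mult)
    show "0 < B_norm L p r b q a (\<lambda>x. ennreal (?h x))"
      by (rule B_norm_pos[OF assms(3-6) d(1) cut_power_measurable_on]) (simp add: cut_power_def)
    show "B_norm L p r b q a (\<lambda>x. ennreal (?h x)) < \<infinity>"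
      by (rule B_norm_cut_power_finite[OF assms(3-6) d]) (use \<eta> in auto)
  qed
  then show False using k k0 c(1) by (simp add: field_simps)
qed

text \<open>Only the values on (m, N m) with m = max u \<delta> are kept, since the test function is
  a genuine power from \<delta> on. There s powr (- \<eta>) loses at most the factor N powr (-
  \<eta>) against m powr (- \<eta>), while the interval has measure ln N with respect to ds/s. The
  given \<open>N\<close> maximises (ln N) powr (1/W) * N powr (- \<eta>), and the maximum is the
  constant in the claim.\<close>

lemma H_lower_cut_power_ge:
  assumes "0 < W'" "0 < \<eta>" "0 \<le> \<rho>" "\<rho> \<le> rcp V" "d \<in> einterval 0 L" "0 < \<delta>" "0 < u"
    and N: "N = exp (1 / (\<eta> * W'))" "N * max u \<delta> \<le> d"
  shows "ennreal ((\<eta> * W' * exp 1) powr (- 1 / W')) * ennreal (max u \<delta> powr (- (\<rho> + \<eta>)))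
    \<le> H_lower L V (ereal W') (\<lambda>x. complex_of_real (cut_power (\<rho> + \<eta>) \<delta> d x)) u"
proof -
  let ?f = "\<lambda>x. complex_of_real (cut_power (\<rho> + \<eta>) \<delta> d x)" and ?W = "ereal W'"
  let ?A = "einterval (ereal u) L"
  define m where "m = max u \<delta>"
  have m: "0 < m" "u \<le> m" using assms(7) by (auto simp: m_def)
  have N1: "1 < N" using assms(1,2) by (simp add: N(1))
  have lnN: "ln (N * m / m) = 1 / (\<eta> * W')" using m by (simp add: N(1))
  have sub: "{m<..<N * m} \<subseteq> ?A"
  proof
    fix s assume s: "s \<in> {m<..<N * m}"
    have "ereal s < ereal d" using s N(2) by (simp add: m_def)
    also have "ereal d < L" using assms(5) by (simp add: einterval_0_mem)
    finally show "s \<in> ?A" using s m by (simp add: einterval_iff)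
  qed
  have "ennreal (ln (N * m / m) powr rcp ?W) * ennreal (u powr rcp V * (m powr (- \<rho>) * (N * m) powr (- \<eta>)))
      \<le> wnorm ?W ?A (\<lambda>v. v powr rcp V) (rearr L ?f)"
  proof (rule wnorm_ge_const)
    fix s assume s: "s \<in> {m<..<N * m}"
    then have s0: "u < s" "0 < s" "s < d" using m N(2) by (auto simp: m_def)
    have "ereal s < ereal d" using s0 by simp
    also have "ereal d < L" using assms(5) by (simp add: einterval_0_mem)
    finally have sL: "s \<in> einterval 0 L" using s0 by (simp add: einterval_0_mem)
    have "u powr rcp V * (m powr (- \<rho>) * (N * m) powr (- \<eta>))
        \<le> u powr rcp V * (u powr (- \<rho>) * s powr (- \<eta>))"
      using s s0 m assms(2,3,7) by (intro mult_left_mono mult_mono powr_mono2') auto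
    also have "\<dots> = u powr (rcp V - \<rho>) * s powr (- \<eta>)"
      by (simp add: powr_add[symmetric] mult.assoc[symmetric])
    also have "\<dots> \<le> s powr (rcp V - \<rho>) * s powr (- \<eta>)"
      using s0 assms(4,7) by (intro mult_right_mono powr_mono2) auto
    also have "\<dots> = s powr rcp V * cut_power (\<rho> + \<eta>) \<delta> d s"
    proof -
      have "max s \<delta> = s" using s by (simp add: m_def)
      then show ?thesis using s0 by (simp add: cut_power_def powr_add[symmetric] algebra_simps)
    qed
    finally have "ennreal (u powr rcp V * (m powr (- \<rho>) * (N * m) powr (- \<eta>)))
        \<le> ennreal (s powr rcp V * cut_power (\<rho> + \<eta>) \<delta> d s)"
      by (rule ennreal_leI)
    also have "\<dots> = ennreal (s powr rcp V) * rearr L ?f s"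
      using assms(2,3) by (subst rearr_cut_power[OF _ assms(5) sL]) (auto simp: ennreal_mult)
    finally show "ennreal (u powr rcp V * (m powr (- \<rho>) * (N * m) powr (- \<eta>)))
        \<le> ennreal (s powr rcp V) * rearr L ?f s" .
  qed (use m N1 sub assms(1) rearr_measurable[OF is_interval_einterval] in auto)
  then have le: "ennreal (u powr (- rcp V)) * (ennreal (ln (N * m / m) powr rcp ?W) *
      ennreal (u powr rcp V * (m powr (- \<rho>) * (N * m) powr (- \<eta>)))) \<le> H_lower L V ?W ?f u"
    unfolding H_lower_eq_wnorm by (rule mult_left_mono) simp
  have "N powr (- \<eta>) = exp 1 powr (- 1 / W')"
    using assms(1,2) by (simp add: N(1) powr_def)
  moreover have "(1 / (\<eta> * W')) powr rcp ?W = (\<eta> * W') powr (- 1 / W')"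
    using assms(1,2) by (simp add: rcp_ereal powr_divide powr_minus_divide)
  moreover have "u powr (- rcp V) * u powr rcp V = 1"
    using assms(7) by (simp add: powr_add[symmetric])
  ultimately have eq: "(\<eta> * W' * exp 1) powr (- 1 / W') * m powr (- (\<rho> + \<eta>))
      = u powr (- rcp V) * (ln (N * m / m) powr rcp ?W * (u powr rcp V * (m powr (- \<rho>) * (N * m) powr (- \<eta>))))"
    unfolding lnN powr_mult by (simp add: powr_add[symmetric] algebra_simps)
  show ?thesis
    unfolding ennreal_mult[symmetric, OF powr_ge_zero powr_ge_zero] m_def[symmetric] eq using le
    by (simp only: ennreal_mult powr_ge_zero mult_nonneg_nonneg)
qed

text \<open>For every t in (d', d) the inner norm includes the part over (0, \<delta>), which is at
  least a multiple of \<delta> powr (1/p) * a \<delta> * g \<delta>; bounding \<open>a\<close> from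
  below costs a further \<delta> powr \<epsilon>. Since \<kappa> depends neither on \<delta> nor on
  \<open>g\<close>, powers steeper than 1/p + \<epsilon>, truncated at \<delta>, have norms tending
  to infinity as \<delta> tends to 0.\<close>

lemma B_norm_ge_at:
  assumes "0 < p" "0 < r" "0 < q" "a \<in> SV L" "b \<in> SV L" "d \<in> einterval 0 L" "0 < \<epsilon>" "0 < d'" "d' < d"
  obtains \<kappa> :: ennreal where "0 < \<kappa>"
    "\<And>\<delta> g. 0 < \<delta> \<Longrightarrow> \<delta> < d' \<Longrightarrow> antimono_on (einterval 0 L) g \<Longrightarrow>
      \<kappa> * ennreal (\<delta> powr (rcp p + \<epsilon>)) * g \<delta> \<le> B_norm L p r b q a g"
proof -
  let ?w = "\<lambda>u. u powr rcp p * a u" and ?A = "einterval 0 L"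
  let ?I = "\<lambda>g t. wnorm q {0<..<t} ?w g"
  obtain K where K: "0 < K" "\<And>t g. t \<in> ?A \<Longrightarrow> antimono_on ?A g \<Longrightarrow> ennreal (?w t) * g t \<le> ennreal K * ?I g t"
    using pointwise_le_wnorm[OF assms(3,4) rcp_nonneg[OF assms(1)]] by blast
  obtain C where C: "0 < C"
    "\<And>s t. s \<in> ?A \<Longrightarrow> t \<in> ?A \<Longrightarrow> kern \<epsilon> (t / s) * a t \<le> C * a s"
    using SV_kern[OF assms(4,7)] by blast
  define k where "k = d powr (- \<epsilon>) * a d / (C * K)"
  have d0: "0 < d" using assms(6) by (simp add: einterval_0_mem)
  have k: "0 < k" using C(1) K(1) SV_pos[OF assms(4,6)] d0 by (simp add: k_def)
  have w: "?w \<in> borel_measurable (lebesgue_on ?A)" by (rule powr_times_SV_measurable[OF assms(4)])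
  have b: "b \<in> borel_measurable (lebesgue_on ?A)" by (rule SV_measurable[OF assms(5)])
  have subd: "{d'<..<d} \<subseteq> ?A" using Ioo_subset_einterval_0[OF assms(6), of d'] assms(8) by simp
  define \<kappa> where "\<kappa> = ennreal k * wnorm r {d'<..<d} b (\<lambda>_. 1)"
  show ?thesis
  proof (rule that[of \<kappa>])
    have "0 < wnorm r {d'<..<d} b (\<lambda>_. 1)"
      using assms(8,9) measurable_lebesgue_on_subset[OF b subd] SV_pos[OF assms(5)] subd
      by (intro wnorm_pos[OF assms(2)]) auto
    then show "0 < \<kappa>" using k by (simp add: \<kappa>_def ennreal_zero_less_mult_iff)
    fix \<delta> and g :: "real \<Rightarrow> ennreal"
    assume \<delta>: "0 < \<delta>" "\<delta> < d'" and g: "antimono_on ?A g"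
    have gm: "g \<in> borel_measurable (lebesgue_on ?A)"
      by (rule borel_measurable_antimono_on[OF g is_interval_einterval])
    have \<delta>A: "\<delta> \<in> ?A" using \<delta> assms(9) by (intro einterval_0_down[OF assms(6)]) auto
    have "k * \<delta> powr (rcp p + \<epsilon>) \<le> ?w \<delta> / K"
    proof -
      have "(d / \<delta>) powr (- \<epsilon>) * a d \<le> C * a \<delta>"
        using C(2)[OF \<delta>A assms(6)] \<delta> assms(7,9) by (simp add: kern_eq_powr_minus)
      then have "\<delta> powr \<epsilon> * d powr (- \<epsilon>) * a d \<le> C * a \<delta>"
        using \<delta> d0 by (simp add: powr_divide powr_minus_divide)
      then have "\<delta> powr rcp p * (\<delta> powr \<epsilon> * d powr (- \<epsilon>) * a d) / (C * K) \<le> \<delta> powr rcp p * (C * a \<delta>) / (C * K)"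
        using C(1) K(1) by (intro divide_right_mono mult_left_mono) auto
      then show ?thesis using C(1) by (simp add: k_def powr_add mult_ac)
    qed
    then have "ennreal (k * \<delta> powr (rcp p + \<epsilon>)) * g \<delta> \<le> ennreal (?w \<delta> / K) * g \<delta>"
      by (intro mult_right_mono ennreal_leI) simp_all
    also have "\<dots> = ennreal (1 / K) * (ennreal (?w \<delta>) * g \<delta>)"
      using K(1) SV_pos[OF assms(4) \<delta>A] by (simp add: mult.assoc[symmetric] ennreal_mult[symmetric])
    also have "\<dots> \<le> ennreal (1 / K) * (ennreal K * ?I g \<delta>)"
      by (intro mult_left_mono K(2)[OF \<delta>A g]) simp
    also have "\<dots> = ?I g \<delta>"
      using K(1) by (simp add: mult.assoc[symmetric] ennreal_mult[symmetric])
    finally have le: "ennreal (k * \<delta> powr (rcp p + \<epsilon>)) * g \<delta> \<le> ?I g \<delta>" .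
    let ?c = "ennreal (k * \<delta> powr (rcp p + \<epsilon>)) * g \<delta>"
    have "?c * wnorm r {d'<..<d} b (\<lambda>_. 1) = wnorm r {d'<..<d} b (\<lambda>_. ?c * 1)"
      by (rule wnorm_cmult[OF assms(2) measurable_lebesgue_on_subset[OF b subd], symmetric]) simp
    also have "\<dots> \<le> wnorm r {d'<..<d} b (?I g)"
    proof (rule wnorm_mono[OF assms(2) measurable_lebesgue_on_subset[OF b subd]])
      fix t assume t: "t \<in> {d'<..<d}"
      show "0 \<le> b t" "0 \<le> b t" using SV_pos[OF assms(5), of t] subd t by auto
      have "t \<in> ?A" using subd t by auto
      then have sub: "{0<..<t} \<subseteq> ?A" by (rule Ioo_subset_einterval_0) simp
      have "?I g \<delta> \<le> ?I g t"
        by (rule wnorm_subset[OF assms(3) measurable_lebesgue_on_subset[OF w sub] measurable_lebesgue_on_subset[OF gm sub]])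
          (use t \<delta> in auto)
      then have "?c * 1 \<le> ?I g t" using le by (simp add: order_trans)
      then show "ennreal (b t) * (?c * 1) \<le> ennreal (b t) * ?I g t"
        by (rule mult_left_mono) simp
    qed simp
    also have "\<dots> \<le> B_norm L p r b q a g"
      unfolding B_norm_eq_wnorm
      by (rule wnorm_subset[OF assms(2) b wnorm_Ioo_measurable[OF assms(3) w gm] subd]) simp_all
    finally show "\<kappa> * ennreal (\<delta> powr (rcp p + \<epsilon>)) * g \<delta> \<le> B_norm L p r b q a g"
      using k by (simp add: \<kappa>_def ennreal_mult mult_ac)
  qed
qed

text \<open>The truncation level \<open>\<delta>\<close> is chosen last: the part of the test function beyond \<open>d / N\<close> has a norm
  bounded independently of \<open>\<delta>\<close>, whereas the norm of the part near the origin tends to infinity as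
  \<open>\<delta>\<close> tends to \<open>0\<close>, and it is this part on which the averaging operator gains a large factor.\<close>

lemma not_equiv_H_lower:
  assumes "L = 1 \<or> L = \<infinity>" "0 < p" "0 < r" "0 < q" "a \<in> SV L" "b \<in> SV L"
    "LL_space L p r b q a \<noteq> null_funs L" "0 < W" "W < \<infinity>" "0 < V" "V \<le> p"
  shows "\<not> equiv_on (Mfun L) (LL_norm L p r b q a) (\<lambda>f. B_norm L p r b q a (H_lower L V W f))"
proof
  let ?B = "B_norm L p r b q a"
  assume "equiv_on (Mfun L) (LL_norm L p r b q a) (\<lambda>f. B_norm L p r b q a (H_lower L V W f))"
  then obtain c where c: "0 < c"
    "\<And>f. f \<in> Mfun L \<Longrightarrow> ?B (H_lower L V W f) \<le> ennreal c * LL_norm L p r b q a f"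
    by (rule equiv_on_ge) blast
  obtain d where d: "d \<in> einterval 0 L" "?B (\<lambda>x. ennreal (cut_power 0 0 d x)) < \<infinity>"
    using nontrivial_cut_power[OF assms(1,3-7)] .
  have d0: "0 < d" using d(1) by (simp add: einterval_0_mem)
  obtain W' where W: "W = ereal W'" "0 < W'" using assms(8,9) by (cases W) auto
  have pV: "rcp p \<le> rcp V" by (rule rcp_antimono[OF assms(10,11)])
  define C where "C = 2 * 2 powr rcp q * (2 * 2 powr rcp r)"
  have C: "0 < C" by (simp add: C_def)
  \<comment> \<open>Makes the gain of the averaging operator equal to \<open>4 * C * c\<close>: the
    factor \<open>2 * C\<close> is lost in absorbing the part of the test function beyond d', the
    factor \<open>c\<close> in the assumed equivalence, and 2 is left for the contradiction.\<close>
  define \<eta> where "\<eta> = (1 / (4 * C * c)) powr W' / (W' * exp 1)"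
  have \<eta>: "0 < \<eta>" using C c(1) W(2) by (simp add: \<eta>_def)
  have k: "(\<eta> * W' * exp 1) powr (- 1 / W') = 4 * C * c"
    using C c(1) W(2) by (simp add: \<eta>_def powr_powr powr_minus_divide)
  define \<theta> where "\<theta> = rcp p + \<eta>"
  have \<theta>: "0 < \<theta>" using \<eta> rcp_nonneg[OF assms(2)] by (simp add: \<theta>_def)
  define N where "N = exp (1 / (\<eta> * W'))"
  have N: "1 < N" using \<eta> W(2) by (simp add: N_def)
  \<comment> \<open>For u < d' the interval from max u \<delta> to N max u \<delta> stays inside (0,
    d), as the gain requires.\<close>
  define d' where "d' = d / N"
  have d': "0 < d'" "d' < d" "N * d' = d" using d0 N by (auto simp: d'_def field_simps)
  have d'L: "d' \<in> einterval 0 L" using d' by (intro einterval_0_down[OF d(1)]) auto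
  define M where "M = ennreal (d' powr (- \<theta>)) * ?B (\<lambda>x. ennreal (cut_power 0 0 d x))"
  have M: "M < \<infinity>" using d(2) by (simp add: M_def ennreal_mult_less_top)
  obtain \<kappa> where \<kappa>: "0 < \<kappa>" "\<And>\<delta> g. 0 < \<delta> \<Longrightarrow> \<delta> < d' \<Longrightarrow> antimono_on (einterval 0 L) g \<Longrightarrow>
      \<kappa> * ennreal (\<delta> powr (rcp p + \<eta> / 2)) * g \<delta> \<le> ?B g"
    using B_norm_ge_at[OF assms(2-6) d(1) half_gt_zero[OF \<eta>] d'(1,2)] by blast
  obtain X where X: "0 < X" "M \<le> ennreal X * \<kappa>"
    using ex_real_mult_ge[OF \<kappa>(1), of "enn2real M"] M by auto
  \<comment> \<open>The first entry keeps \<delta> below d'. The second gives \<delta> powr (-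
    \<eta> / 2) at least \<open>X\<close>; this power is what remains in the lower bound, because
    \<theta> exceeds 1/p + \<eta> / 2 by \<eta> / 2.\<close>
  define \<delta> where "\<delta> = min (d' / 2) (X powr (- 2 / \<eta>))"
  have \<delta>: "0 < \<delta>" "\<delta> < d'" using d' X(1) by (auto simp: \<delta>_def)
  have X\<delta>: "X \<le> \<delta> powr (- \<eta> / 2)"
  proof -
    have "(X powr (- 2 / \<eta>)) powr (- \<eta> / 2) \<le> \<delta> powr (- \<eta> / 2)"
      using \<delta>(1) \<eta> by (intro powr_mono2') (auto simp: \<delta>_def)
    then show ?thesis using \<eta> X(1) by (simp add: powr_powr)
  qed
  let ?h = "cut_power \<theta> \<delta> d"
  let ?f = "\<lambda>x. complex_of_real (?h x)"
  let ?F = "\<lambda>x. ennreal (?h x)" and ?F1 = "\<lambda>x. ennreal (cut_power \<theta> \<delta> d' x)"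
  have H: "H_lower L V W ?f \<in> borel_measurable (lebesgue_on (einterval 0 L))"
    by (rule borel_measurable_antimono_on[OF H_lower_antimono_on[OF assms(8,10)] is_interval_einterval])
  have LL: "LL_norm L p r b q a ?f \<le> ennreal 1 * ?B ?F"
    unfolding LL_norm_def
    by (rule B_norm_mono_fun[OF assms(3-6) _ cut_power_measurable_on rearr_measurable[OF is_interval_einterval]])
      (use \<theta> in \<open>auto simp: rearr_cut_power[OF _ d(1)]\<close>)
  have "M \<le> ?B ?F1"
  proof -
    have "\<kappa> * ennreal (\<delta> powr (rcp p + \<eta> / 2)) * ?F1 \<delta> \<le> ?B ?F1"
      using \<theta> by (intro \<kappa>(2) \<delta> monotone_onI ennreal_leI cut_power_antimono) (auto simp: einterval_0_mem)
    moreover have "\<delta> powr (rcp p + \<eta> / 2) * cut_power \<theta> \<delta> d' \<delta> = \<delta> powr (- \<eta> / 2)"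
      using \<delta> by (simp add: cut_power_def \<theta>_def powr_add[symmetric])
    ultimately have "\<kappa> * ennreal (\<delta> powr (- \<eta> / 2)) \<le> ?B ?F1"
      by (simp only: mult.assoc ennreal_mult[symmetric, OF powr_ge_zero cut_power_nonneg])
    moreover have "ennreal X * \<kappa> \<le> \<kappa> * ennreal (\<delta> powr (- \<eta> / 2))"
      unfolding mult.commute[of "ennreal X"] by (intro mult_left_mono ennreal_leI X\<delta>) simp
    ultimately show ?thesis using X(2) by (meson order_trans)
  qed
  moreover have "?B ?F \<le> ennreal C * (?B ?F1 + M)"
  proof -
    let ?G = "\<lambda>x. ennreal (d' powr (- \<theta>)) * ennreal (cut_power 0 0 d x)"
    have G: "?G \<in> borel_measurable (lebesgue_on (einterval 0 L))"
      using cut_power_measurable_on by measurable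
    have "?B ?F \<le> ennreal 1 * ?B (\<lambda>x. ?F1 x + ?G x)"
    proof (rule B_norm_mono_fun[OF assms(3-6) _ borel_measurable_add[OF cut_power_measurable_on G] cut_power_measurable_on])
      fix u assume "u \<in> einterval 0 L"
      then have u: "0 < u" by (simp add: einterval_0_mem)
      have "?F u \<le> ?F1 u + ?G u"
      proof (cases "u < d'")
        case True
        then show ?thesis using d' by (simp add: cut_power_def)
      next
        case False
        have "max u \<delta> powr (- \<theta>) \<le> d' powr (- \<theta>)"
          using False d' \<theta> by (intro powr_mono2') auto
        then show ?thesis using u False by (auto simp: cut_power_def intro: ennreal_leI)
      qed
      then show "?F u \<le> ennreal 1 * (?F1 u + ?G u)" by simp
    qed simp
    also have "\<dots> = ?B (\<lambda>x. ?F1 x + ?G x)" by simp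
    also have "\<dots> \<le> ennreal C * (?B ?F1 + ?B ?G)"
      unfolding C_def by (rule B_norm_add[OF assms(3-6) cut_power_measurable_on G])
    also have "?B ?G \<le> M"
      unfolding M_def by (rule B_norm_mono_fun[OF assms(3-6) _ cut_power_measurable_on G]) simp_all
    finally show ?thesis by (simp add: mult_left_mono)
  qed
  ultimately have "?B ?F \<le> ennreal C * (?B ?F1 + ?B ?F1)"
    by (meson add_left_mono mult_left_mono order_trans zero_le)
  also have "\<dots> = ennreal (2 * C) * ?B ?F1"
    using C by (simp add: ennreal_mult mult_2 mult_ac distrib_left)
  also have "?B ?F1 \<le> ennreal (1 / (4 * C * c)) * ?B (H_lower L V W ?f)"
  proof (rule B_norm_mono_fun[OF assms(3-6) _ H cut_power_measurable_on])
    fix u assume "u \<in> einterval 0 L"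
    then have u: "0 < u" by (simp add: einterval_0_mem)
    show "?F1 u \<le> ennreal (1 / (4 * C * c)) * H_lower L V W ?f u"
    proof (cases "u < d'")
      case True
      have "N * max u \<delta> \<le> N * d'"
        using True \<delta> N by (intro mult_left_mono) auto
      then have Nd: "N * max u \<delta> \<le> d" using d'(3) by simp
      have "ennreal (4 * C * c) * ?F1 u \<le> H_lower L V W ?f u"
        using H_lower_cut_power_ge[OF W(2) \<eta> rcp_nonneg[OF assms(2)] pV d(1) \<delta>(1) u N_def Nd] True
        unfolding k W(1) \<theta>_def cut_power_def by simp
      then have "ennreal (1 / (4 * C * c)) * (ennreal (4 * C * c) * ?F1 u)
          \<le> ennreal (1 / (4 * C * c)) * H_lower L V W ?f u"
        by (rule mult_left_mono) simp
      then show ?thesis using C c(1) by (simp add: mult.assoc[symmetric] ennreal_mult[symmetric])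
    qed (simp add: cut_power_def)
  qed (use C c(1) in simp)
  also have "?B (H_lower L V W ?f) \<le> ennreal c * (ennreal 1 * ?B ?F)"
    by (rule order_trans[OF c(2)[OF cut_power_in_Mfun] mult_left_mono[OF LL]]) simp
  also have "ennreal (2 * C) * (ennreal (1 / (4 * C * c)) * (ennreal c * (ennreal 1 * ?B ?F))) = ennreal (1 / 2) * ?B ?F"
    using C c(1) by (simp add: mult.assoc[symmetric] ennreal_mult[symmetric])
  finally have "?B ?F \<le> ennreal (1 / 2) * ?B ?F"
    by (simp add: mult_left_mono)
  then have "1 \<le> (1 / 2 :: real)"
  proof (rule ennreal_one_le_if_le_mult)
    show "0 < ?B ?F"
      using \<delta>(1) by (intro B_norm_pos[OF assms(3-6) d(1) cut_power_measurable_on]) (auto simp: cut_power_def)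
    \<comment> \<open>The truncation bounds the test function by a multiple of the indicator of (0,
      d), so its norm is finite and can be cancelled.\<close>
    have "?B ?F \<le> ennreal (\<delta> powr (- \<theta>)) * ?B (\<lambda>x. ennreal (cut_power 0 0 d x))"
    proof (rule B_norm_mono_fun[OF assms(3-6) _ cut_power_measurable_on cut_power_measurable_on])
      fix u assume "u \<in> einterval 0 L"
      then have u: "0 < u" by (simp add: einterval_0_mem)
      have "max u \<delta> powr (- \<theta>) \<le> \<delta> powr (- \<theta>)"
        using \<delta> \<theta> by (intro powr_mono2') auto
      then show "?F u \<le> ennreal (\<delta> powr (- \<theta>)) * ennreal (cut_power 0 0 d u)"
        using u by (simp add: cut_power_def ennreal_leI)
    qed simp
    also have "\<dots> < \<infinity>" using d(2) by (simp add: ennreal_mult_less_top)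
    finally show "?B ?F < \<infinity>" .
  qed
  then show False by simp
qed

theorem theorem50:
  fixes L p r q U V W :: ereal and a b :: "real \<Rightarrow> real"
  assumes "L = 1 \<or> L = \<infinity>"
    and "0 < p" and "0 < r" and "0 < q"
    and "a \<in> SV L" and "b \<in> SV L"
    and "LL_space L p r b q a \<noteq> null_funs L"
    and "0 < W" and "W < \<infinity>"
    and "0 < U" and "U < \<infinity>"
    and "0 < V"
  shows "(equiv_on (Mfun L) (LL_norm L p r b q a) (\<lambda>f. B_norm L p r b q a (H_upper L U W f))
            \<longleftrightarrow> p > U) \<and>
         (equiv_on (Mfun L) (LL_norm L p r b q a) (\<lambda>f. B_norm L p r b q a (H_lower L V W f))
            \<longleftrightarrow> p < V)"
proof (intro conjI iffI)
  show "U < p" if "equiv_on (Mfun L) (LL_norm L p r b q a) (\<lambda>f. B_norm L p r b q a (H_upper L U W f))"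
    using not_equiv_H_upper[OF assms(1-9,11)] that not_le by blast
  show "equiv_on (Mfun L) (LL_norm L p r b q a) (\<lambda>f. B_norm L p r b q a (H_upper L U W f))" if "U < p"
    using equiv_H_upper[OF assms(2-6,8-10) that] .
  show "p < V" if "equiv_on (Mfun L) (LL_norm L p r b q a) (\<lambda>f. B_norm L p r b q a (H_lower L V W f))"
    using not_equiv_H_lower[OF assms(1-9,12)] that not_le by blast
  show "equiv_on (Mfun L) (LL_norm L p r b q a) (\<lambda>f. B_norm L p r b q a (H_lower L V W f))" if "p < V"
    using equiv_H_lower[OF assms(2-6,8,9,12) that] .
qed

end
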